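(* Let $(\Omega,\mathcal F,(\mathcal F_s)_{s\ge 0},\mathbb P)$ be a filtered probability space satisfying the usual conditions, let $(B_s)$ be a $d$-dimensional $(\mathcal F_s)$-Brownian motion, let $t>0$, and let $f$ be a progressively measurable process with values in $\mathbb R^d$ such that $\int_0^t|f(s)|^2\,ds<\infty$ almost surely. If $$\mathbb E\left[\left(\int_0^t|f(s)|^2\,ds\right)^{\alpha/2}\right]=\infty$$ for some number $\alpha\in(0,1)$, then the stochastic integral process $\left(\int_0^r\langle f(s),dB_s\rangle,\ 0\le r\le t\right)$ is a strict local martingale.
   Context: The underlying filtered probability space satisfies the usual conditions (right continuity and completeness of the filtration). A strict local martingale is a local martingale which is not a (true) martingale; for a process indexed by $[0,t]$ this means that it is a local martingale on $[0,t]$ but not a martingale on $[0,t]$. Here $\langle\cdot,\cdot\rangle$ and $|\cdot|$ are the Euclidean inner product and norm on $\mathbb R^d$. *)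

theory Defs
  imports "HOL-Probability.Probability"
begin

text \<open>Processes are indexed by type \<^typ>\<open>real\<close>, but only the times in \<open>[0, \<infinity>)\<close> (or \<open>[0, t]\<close>)
  are ever constrained. For this reason the library's \<^locale>\<open>filtration\<close> and
  \<^const>\<open>stopping_time\<close>, which quantify over the whole index type, are not used.\<close>

locale usual_filtered_prob_space = prob_space M + complete_measure M
  for M :: "'w measure" and F :: "real \<Rightarrow> 'w measure" +
  assumes subalgebra_F: "0 \<le> s \<Longrightarrow> subalgebra M (F s)"
    and sets_F_mono: "0 \<le> s \<Longrightarrow> s \<le> u \<Longrightarrow> sets (F s) \<subseteq> sets (F u)"
    and right_continuous_F: "0 \<le> s \<Longrightarrow> sets (F s) = (\<Inter>u\<in>{s<..}. sets (F u))"
    and null_sets_F0: "null_sets M \<subseteq> sets (F 0)"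

definition brownian_motion ::
  "'w measure \<Rightarrow> (real \<Rightarrow> 'w measure) \<Rightarrow> (real \<Rightarrow> 'w \<Rightarrow> real ^ 'd) \<Rightarrow> bool" where
  "brownian_motion M F B \<longleftrightarrow>
     (\<forall>s\<ge>0. B s \<in> borel_measurable (F s)) \<and>
     (AE \<omega> in M. B 0 \<omega> = 0) \<and>
     (AE \<omega> in M. continuous_on {0..} (\<lambda>s. B s \<omega>)) \<and>
     (\<forall>s u. 0 \<le> s \<and> s < u \<longrightarrow>
        distributed M lborel (\<lambda>\<omega>. B u \<omega> - B s \<omega>)
          (\<lambda>x. ennreal (\<Prod>i\<in>UNIV. normal_density 0 (sqrt (u - s)) (x $ i))) \<and>
        prob_space.indep_set M (sets (F s))
          (sets (vimage_algebra (space M) (\<lambda>\<omega>. B u \<omega> - B s \<omega>) borel)))"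

definition progressively_measurable ::
  "(real \<Rightarrow> 'w measure) \<Rightarrow> (real \<Rightarrow> 'w \<Rightarrow> 'b::topological_space) \<Rightarrow> bool" where
  "progressively_measurable F f \<longleftrightarrow>
     (\<forall>u\<ge>0. (\<lambda>(s, \<omega>). f s \<omega>)
        \<in> borel_measurable (restrict_space borel {0..u} \<Otimes>\<^sub>M F u))"

definition martingale_upto ::
  "'w measure \<Rightarrow> (real \<Rightarrow> 'w measure) \<Rightarrow> real \<Rightarrow> (real \<Rightarrow> 'w \<Rightarrow> real) \<Rightarrow> bool" where
  "martingale_upto M F t X \<longleftrightarrow>
     (\<forall>r\<in>{0..t}. X r \<in> borel_measurable (F r) \<and> integrable M (X r)) \<and>
     (\<forall>s r. 0 \<le> s \<and> s \<le> r \<and> r \<le> t \<longrightarrow>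
        (AE \<omega> in M. real_cond_exp M (F s) (X r) \<omega> = X s \<omega>))"

definition cadlag_upto :: "real \<Rightarrow> (real \<Rightarrow> real) \<Rightarrow> bool" where
  "cadlag_upto t x \<longleftrightarrow>
     (\<forall>r\<in>{0..<t}. continuous (at_right r) x) \<and>
     (\<forall>r\<in>{0<..t}. \<exists>l. (x \<longlongrightarrow> l) (at_left r))"

text \<open>On the closed interval \<open>[0, t]\<close> the localizing times have to reach \<open>t\<close>: almost surely
  \<open>\<tau>\<^sub>n = t\<close> for all large \<open>n\<close>. Mere convergence \<open>\<tau>\<^sub>n \<up> t\<close> would only describe a local martingale
  on \<open>[0, t)\<close>. Values of the processes after time \<open>t\<close> play no role.\<close>

definition local_martingale_upto ::
  "'w measure \<Rightarrow> (real \<Rightarrow> 'w measure) \<Rightarrow> real \<Rightarrow> (real \<Rightarrow> 'w \<Rightarrow> real) \<Rightarrow> bool" where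
  "local_martingale_upto M F t X \<longleftrightarrow>
     (\<forall>r\<in>{0..t}. X r \<in> borel_measurable (F r)) \<and>
     (AE \<omega> in M. cadlag_upto t (\<lambda>r. X r \<omega>)) \<and>
     (\<exists>\<tau> :: nat \<Rightarrow> 'w \<Rightarrow> real.
        (\<forall>n. \<forall>\<omega>\<in>space M. \<tau> n \<omega> \<in> {0..t} \<and> \<tau> n \<omega> \<le> \<tau> (Suc n) \<omega>) \<and>
        (\<forall>n. \<forall>s\<in>{0..t}. Measurable.pred (F s) (\<lambda>\<omega>. \<tau> n \<omega> \<le> s)) \<and>
        (AE \<omega> in M. \<exists>n. \<tau> n \<omega> = t) \<and>
        (\<forall>n. martingale_upto M F t (\<lambda>r \<omega>. X (min r (\<tau> n \<omega>)) \<omega> - X 0 \<omega>)))"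

definition strict_local_martingale_upto ::
  "'w measure \<Rightarrow> (real \<Rightarrow> 'w measure) \<Rightarrow> real \<Rightarrow> (real \<Rightarrow> 'w \<Rightarrow> real) \<Rightarrow> bool" where
  "strict_local_martingale_upto M F t X \<longleftrightarrow>
     local_martingale_upto M F t X \<and> \<not> martingale_upto M F t X"

text \<open>\<open>simple_integral M F B t \<phi> I\<close>: the process \<open>\<phi>\<close> is a simple process
  \<open>\<Sum>i<n. \<xi>\<^sub>i \<one>\<^bsub>(p\<^sub>i, p\<^sub>i\<^sub>+\<^sub>1]\<^esub>\<close> on \<open>[0, t]\<close> with bounded \<open>\<F>\<^bsub>p\<^sub>i\<^esub>\<close>-measurable coefficients, and \<open>I\<close> is its
  elementary integral process with respect to \<open>B\<close>.\<close>

definition simple_integral ::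
  "'w measure \<Rightarrow> (real \<Rightarrow> 'w measure) \<Rightarrow> (real \<Rightarrow> 'w \<Rightarrow> real ^ 'd) \<Rightarrow> real \<Rightarrow>
     (real \<Rightarrow> 'w \<Rightarrow> real ^ 'd) \<Rightarrow> (real \<Rightarrow> 'w \<Rightarrow> real) \<Rightarrow> bool" where
  "simple_integral M F B t \<phi> I \<longleftrightarrow>
     (\<exists>(n::nat) (p :: nat \<Rightarrow> real) (\<xi> :: nat \<Rightarrow> 'w \<Rightarrow> real ^ 'd).
        p 0 = 0 \<and> p n = t \<and> (\<forall>i<n. p i < p (Suc i)) \<and>
        (\<forall>i<n. \<xi> i \<in> borel_measurable (F (p i)) \<and> (\<exists>C. \<forall>\<omega>\<in>space M. norm (\<xi> i \<omega>) \<le> C)) \<and>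
        \<phi> = (\<lambda>s \<omega>. \<Sum>i<n. indicator {p i<..p (Suc i)} s *\<^sub>R \<xi> i \<omega>) \<and>
        I = (\<lambda>r \<omega>. \<Sum>i<n. \<xi> i \<omega> \<bullet> (B (min r (p (Suc i))) \<omega> - B (min r (p i)) \<omega>)))"

text \<open>\<open>ito_integral M F B t f X\<close>: the process \<open>X\<close> is a continuous version of
  \<open>\<integral>\<^sub>0\<^sup>r \<langle>f(s), dB\<^sub>s\<rangle>\<close>, \<open>0 \<le> r \<le> t\<close>. It is the limit, uniformly on \<open>[0, t]\<close> in probability, of the
  integrals of simple processes \<open>\<phi>\<^sub>k\<close> with \<open>\<integral>\<^sub>0\<^sup>t |\<phi>\<^sub>k(s) - f(s)|\<^sup>2 ds \<rightarrow> 0\<close> in probability. For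
  progressively measurable \<open>f\<close> with \<open>\<integral>\<^sub>0\<^sup>t |f(s)|\<^sup>2 ds < \<infinity>\<close> almost surely such an \<open>X\<close> exists and is
  unique up to indistinguishability. The events below are measurable because \<open>f\<close> is jointly
  measurable and because the paths of \<open>B\<close> and \<open>X\<close> are almost surely continuous and \<open>M\<close> is
  complete.\<close>

definition ito_integral ::
  "'w measure \<Rightarrow> (real \<Rightarrow> 'w measure) \<Rightarrow> (real \<Rightarrow> 'w \<Rightarrow> real ^ 'd) \<Rightarrow> real \<Rightarrow>
     (real \<Rightarrow> 'w \<Rightarrow> real ^ 'd) \<Rightarrow> (real \<Rightarrow> 'w \<Rightarrow> real) \<Rightarrow> bool" where
  "ito_integral M F B t f X \<longleftrightarrow>
     (\<forall>r\<in>{0..t}. X r \<in> borel_measurable (F r)) \<and>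
     (AE \<omega> in M. continuous_on {0..t} (\<lambda>r. X r \<omega>)) \<and>
     (\<exists>\<phi> I. (\<forall>k::nat. simple_integral M F B t (\<phi> k) (I k)) \<and>
        (\<forall>\<epsilon>>0. (\<lambda>k. measure M {\<omega>\<in>space M.
            (\<integral>\<^sup>+s\<in>{0..t}. ennreal ((norm (\<phi> k s \<omega> - f s \<omega>))\<^sup>2) \<partial>lborel) > ennreal \<epsilon>})
          \<longlonglongrightarrow> 0) \<and>
        (\<forall>\<epsilon>>0. (\<lambda>k. measure M {\<omega>\<in>space M. \<exists>r\<in>{0..t}. \<bar>I k r \<omega> - X r \<omega>\<bar> > \<epsilon>})
          \<longlonglongrightarrow> 0))"

end

theory Submission
  imports Defs
begin

text \<open>
  \<^bold>\<open>The integral is not a martingale.\<close> The square function of a martingale is of weak type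
  \<open>(1, 1)\<close>: if \<open>X\<close> is a martingale on \<open>[0, t]\<close> and \<open>A = \<integral>\<^sub>0\<^sup>t |f(s)|\<^sup>2 ds\<close>, then
  \<open>P(\<surd>A > \<lambda>) \<le> K / \<lambda>\<close> for large \<open>\<lambda>\<close>, where \<open>K\<close> depends only on \<open>E|X\<^sub>t|\<close>. Such a tail bound makes
  \<open>E[(\<surd>A)\<^sup>\<alpha>]\<close> finite for every \<open>\<alpha> < 1\<close>, which contradicts the hypothesis.

  The tail bound is proved first for a simple integrand \<open>\<phi>\<close> whose integral \<open>I\<close> is uniformly close to
  \<open>X\<close>. Let \<open>T\<close> be the first point of a fine grid at which \<open>|I|\<close> exceeds \<open>\<mu>\<close>. Stopping at \<open>T\<close> turns
  \<open>I\<close> into another simple integral, with terminal value \<open>I\<^sub>T\<close>, and the isometry says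
  \<open>E \<integral>\<^sub>0\<^sup>T |\<phi>|\<^sup>2 ds = E I\<^sub>T\<^sup>2\<close>. Up to the overshoot, \<open>I\<^sub>T\<^sup>2\<close> is at most \<open>\<mu> |I\<^sub>T|\<close>, hence
  essentially at most \<open>\<mu> |X\<^sub>T|\<close>, and \<open>E|X\<^sub>T| \<le> E|X\<^sub>t|\<close> because \<open>X\<close> is a martingale. If
  \<open>\<integral>\<^sub>0\<^sup>t |\<phi>|\<^sup>2 ds > \<mu>\<^sup>2\<close>, then either \<open>T\<close> stopped early, so that \<open>I\<^sub>T\<^sup>2 > \<mu>\<^sup>2\<close>, or
  \<open>\<integral>\<^sub>0\<^sup>T |\<phi>|\<^sup>2 ds > \<mu>\<^sup>2\<close>. Markov's inequality bounds the probability of both by \<open>O(1 / \<mu>)\<close> (lemma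
  \<open>step_weak_type\<close>). The bound passes to \<open>f\<close> along the simple integrands that define the integral
  (\<open>energy_weak_type\<close>).

  \<^bold>\<open>The integral is a local martingale.\<close> The localizing times are the hitting times \<open>\<tau>\<^sub>n\<close> of the
  level \<open>n\<close> by \<open>|X|\<close>. The processes \<open>X\<close> stopped at \<open>\<tau>\<^sub>n\<close> are limits of simple integrals that are
  stopped at the first grid point not before \<open>\<tau>\<^sub>n\<close>, or earlier if they themselves become larger than
  \<open>n + 1\<close>. The second clause keeps them bounded up to the overshoot, so that the martingale property
  survives in the limit by dominated convergence (\<open>bounded_stopped_martingale\<close>).

  Both parts use stopping only on finite grids and pay for it by an overshoot of at most one increment
  of the simple integral. The increments are made small in mean square by refining the grid, because
  the sum of the fourth moments of Brownian increments over a partition is at most a constant multiple of the mesh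
  (\<open>step_increment_maximal\<close>).
\<close>

section \<open>Moments of Gaussian vectors\<close>

text \<open>Brownian increments are described by densities that are products over the coordinates of \<open>real ^ 'd\<close>,
  while Fubini's theorem for \<^const>\<open>lborel\<close> is stated for products over the standard basis; this
  identity links the two.\<close>

lemma prod_UNIV_eq_prod_Basis:
  fixes x :: "real ^ 'd" and f :: "'d \<Rightarrow> real \<Rightarrow> 'b::comm_monoid_mult"
  shows "(\<Prod>i\<in>UNIV. f i (x $ i)) = (\<Prod>b\<in>Basis. f (THE i. b = axis i 1) (x \<bullet> b))"
proof -
  have B: "(Basis :: (real ^ 'd) set) = range (\<lambda>i. axis i 1)"
    by (auto simp: Basis_vec_def)
  have inj: "inj (\<lambda>i. axis i (1::real) :: real ^ 'd)"
    by (auto simp: inj_on_def axis_eq_axis)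
  show ?thesis
    unfolding B by (subst prod.reindex[OF inj]) (simp add: axis_eq_axis inner_axis)
qed

lemma nn_integral_lborel_vec_prod:
  fixes f :: "'d::finite \<Rightarrow> real \<Rightarrow> ennreal"
  assumes [measurable]: "\<And>i. f i \<in> borel_measurable borel"
  shows "(\<integral>\<^sup>+x. (\<Prod>i\<in>UNIV. f i ((x :: real ^ 'd) $ i)) \<partial>lborel) = (\<Prod>i\<in>UNIV. \<integral>\<^sup>+x. f i x \<partial>lborel)"
proof -
  have "(\<integral>\<^sup>+x. (\<Prod>i\<in>UNIV. f i ((x :: real ^ 'd) $ i)) \<partial>lborel) =
      (\<integral>\<^sup>+x. (\<Prod>b\<in>Basis. f (THE i. b = axis i 1) ((x :: real ^ 'd) \<bullet> b)) \<partial>lborel)"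
    by (subst prod_UNIV_eq_prod_Basis) simp
  also have "\<dots> = (\<Prod>b\<in>(Basis :: (real ^ 'd) set). \<integral>\<^sup>+x. f (THE i. b = axis i 1) x \<partial>lborel)"
    by (intro nn_integral_lborel_prod) auto
  also have "\<dots> = (\<Prod>i\<in>UNIV. \<integral>\<^sup>+x. f i x \<partial>lborel)"
    using prod_UNIV_eq_prod_Basis[of "\<lambda>i _. \<integral>\<^sup>+x. f i x \<partial>lborel" "0 :: real ^ 'd"] by simp
  finally show ?thesis .
qed

context prob_space
begin

text \<open>On a rectangle the density and the indicator both factor over the coordinates, hence so does the
  integral. The law of one component and the joint law of two components are obtained from rectangles
  with all other sides equal to the whole line.\<close>

lemma emeasure_vec_rectangle:
  fixes W :: "'a \<Rightarrow> real ^ 'd" and g :: "real \<Rightarrow> real"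
  assumes W: "distributed M lborel W (\<lambda>x. ennreal (\<Prod>i\<in>UNIV. g (x $ i)))"
    and [measurable]: "g \<in> borel_measurable borel" and g0: "\<And>x. 0 \<le> g x"
    and S: "\<And>i. S i \<in> sets borel"
  shows "emeasure M {\<omega>\<in>space M. \<forall>i. W \<omega> $ i \<in> S i} = (\<Prod>i\<in>UNIV. \<integral>\<^sup>+x\<in>S i. ennreal (g x) \<partial>lborel)"
proof -
  note [measurable] = S
  have A: "{x :: real ^ 'd. \<forall>i. x $ i \<in> S i} \<in> sets lborel"
  proof -
    have "{x :: real ^ 'd. \<forall>i. x $ i \<in> S i} = (\<Inter>i. {x \<in> space borel. x $ i \<in> S i})" by auto
    also have "\<dots> \<in> sets borel" by (intro sets.countable_INT') (auto)
    finally show ?thesis by simp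
  qed
  have "{\<omega>\<in>space M. \<forall>i. W \<omega> $ i \<in> S i} = W -` {x. \<forall>i. x $ i \<in> S i} \<inter> space M" by auto
  then have "emeasure M {\<omega>\<in>space M. \<forall>i. W \<omega> $ i \<in> S i} =
      (\<integral>\<^sup>+x. ennreal (\<Prod>i\<in>UNIV. g (x $ i)) * indicator {x. \<forall>i. x $ i \<in> S i} x \<partial>lborel)"
    using distributed_emeasure[OF W A] by simp
  also have "\<dots> = (\<integral>\<^sup>+x. (\<Prod>i\<in>UNIV. ennreal (g (x $ i)) * indicator (S i) (x $ i)) \<partial>lborel)"
  proof (intro nn_integral_cong)
    fix x :: "real ^ 'd"
    have "(\<Prod>i\<in>UNIV. indicator (S i) (x $ i)) = (indicator {x. \<forall>i. x $ i \<in> S i} x :: ennreal)"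
    proof (cases "\<forall>i. x $ i \<in> S i")
      case False
      then obtain i where "x $ i \<notin> S i" by auto
      then have "(\<Prod>i\<in>UNIV. indicator (S i) (x $ i)) = (0::ennreal)"
        by (intro prod_zero) (auto intro!: exI[of _ i])
      with False show ?thesis by simp
    qed simp
    then show "ennreal (\<Prod>i\<in>UNIV. g (x $ i)) * indicator {x. \<forall>i. x $ i \<in> S i} x =
        (\<Prod>i\<in>UNIV. ennreal (g (x $ i)) * indicator (S i) (x $ i))"
      by (simp add: prod.distrib prod_ennreal g0)
  qed
  also have "\<dots> = (\<Prod>i\<in>UNIV. \<integral>\<^sup>+x\<in>S i. ennreal (g x) \<partial>lborel)"
    by (rule nn_integral_lborel_vec_prod[of "\<lambda>i y. ennreal (g y) * indicator (S i) y"]) simp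
  finally show ?thesis .
qed

lemma
  fixes W :: "'a \<Rightarrow> real ^ 'd" and g :: "real \<Rightarrow> real"
  assumes W: "distributed M lborel W (\<lambda>x. ennreal (\<Prod>i\<in>UNIV. g (x $ i)))"
    and [measurable]: "g \<in> borel_measurable borel" and g0: "\<And>x. 0 \<le> g x"
    and g1: "(\<integral>\<^sup>+x. ennreal (g x) \<partial>lborel) = 1"
  shows distributed_vec_component: "distributed M lborel (\<lambda>\<omega>. W \<omega> $ a) g"
    and indep_var_vec_components: "a \<noteq> b \<Longrightarrow> indep_var borel (\<lambda>\<omega>. W \<omega> $ a) borel (\<lambda>\<omega>. W \<omega> $ b)"
proof -
  have [measurable]: "W \<in> borel_measurable M" using distributed_measurable[OF W] by simp
  have rv: "(\<lambda>\<omega>. W \<omega> $ i) \<in> borel_measurable M" for i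
    by (rule measurable_compose[OF \<open>W \<in> borel_measurable M\<close>])
      (intro borel_measurable_continuous_onI continuous_intros)
  have one: "emeasure M {\<omega>\<in>space M. W \<omega> $ a \<in> S} = (\<integral>\<^sup>+x\<in>S. ennreal (g x) \<partial>lborel)"
    if "S \<in> sets borel" for S a
  proof -
    have "{\<omega>\<in>space M. W \<omega> $ a \<in> S} = {\<omega>\<in>space M. \<forall>i. W \<omega> $ i \<in> (if i = a then S else UNIV)}" by auto
    also have "emeasure M \<dots> = (\<Prod>i\<in>UNIV. \<integral>\<^sup>+x\<in>(if i = a then S else UNIV). ennreal (g x) \<partial>lborel)"
      using that by (intro emeasure_vec_rectangle[OF W]) (auto simp: g0)
    also have "\<dots> = (\<Prod>i\<in>UNIV. if i = a then (\<integral>\<^sup>+x\<in>S. ennreal (g x) \<partial>lborel) else 1)"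
      by (intro prod.cong) (auto simp: g1)
    also have "\<dots> = (\<integral>\<^sup>+x\<in>S. ennreal (g x) \<partial>lborel)" by simp
    finally show ?thesis .
  qed
  show "distributed M lborel (\<lambda>\<omega>. W \<omega> $ a) g"
    unfolding distributed_def
  proof (intro conjI measure_eqI)
    show "(\<lambda>\<omega>. W \<omega> $ a) \<in> measurable M lborel" using rv[of a] by simp
    fix S assume "S \<in> sets (distr M lborel (\<lambda>\<omega>. W \<omega> $ a))"
    then have S [measurable]: "S \<in> sets borel" by simp
    have "emeasure (distr M lborel (\<lambda>\<omega>. W \<omega> $ a)) S = emeasure M {\<omega>\<in>space M. W \<omega> $ a \<in> S}"
      by (subst emeasure_distr) (auto simp: rv intro!: arg_cong[where f = "emeasure M"])
    also have "\<dots> = emeasure (density lborel g) S"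
      by (simp add: one emeasure_density)
    finally show "emeasure (distr M lborel (\<lambda>\<omega>. W \<omega> $ a)) S = emeasure (density lborel g) S" .
  qed simp_all
  assume ab: "a \<noteq> b"
  have two: "emeasure M {\<omega>\<in>space M. W \<omega> $ a \<in> S \<and> W \<omega> $ b \<in> T} =
      (\<integral>\<^sup>+x\<in>S. ennreal (g x) \<partial>lborel) * (\<integral>\<^sup>+x\<in>T. ennreal (g x) \<partial>lborel)"
    if "S \<in> sets borel" "T \<in> sets borel" for S T
  proof -
    let ?U = "\<lambda>i. if i = a then S else if i = b then T else UNIV"
    have "{\<omega>\<in>space M. W \<omega> $ a \<in> S \<and> W \<omega> $ b \<in> T} = {\<omega>\<in>space M. \<forall>i. W \<omega> $ i \<in> ?U i}"
      using ab by auto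
    also have "emeasure M \<dots> = (\<Prod>i\<in>UNIV. \<integral>\<^sup>+x\<in>?U i. ennreal (g x) \<partial>lborel)"
      using that by (intro emeasure_vec_rectangle[OF W]) (auto simp: g0)
    also have "\<dots> = (\<Prod>i\<in>UNIV. (if i = a then (\<integral>\<^sup>+x\<in>S. ennreal (g x) \<partial>lborel) else 1) *
        (if i = b then (\<integral>\<^sup>+x\<in>T. ennreal (g x) \<partial>lborel) else 1))"
      using ab by (intro prod.cong) (auto simp: g1)
    also have "\<dots> = (\<integral>\<^sup>+x\<in>S. ennreal (g x) \<partial>lborel) * (\<integral>\<^sup>+x\<in>T. ennreal (g x) \<partial>lborel)"
      by (simp add: prod.distrib)
    finally show ?thesis .
  qed
  have st: "Int_stable {(\<lambda>\<omega>. W \<omega> $ i) -` A \<inter> space M |A. A \<in> sets borel}" for i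
  proof (safe intro!: Int_stableI)
    fix A B :: "real set" assume "A \<in> sets borel" "B \<in> sets borel"
    then show "\<exists>C. (\<lambda>\<omega>. W \<omega> $ i) -` A \<inter> space M \<inter> ((\<lambda>\<omega>. W \<omega> $ i) -` B \<inter> space M) =
        (\<lambda>\<omega>. W \<omega> $ i) -` C \<inter> space M \<and> C \<in> sets borel"
      by (intro exI[of _ "A \<inter> B"]) auto
  qed
  show "indep_var borel (\<lambda>\<omega>. W \<omega> $ a) borel (\<lambda>\<omega>. W \<omega> $ b)"
    unfolding indep_var_eq
  proof (intro conjI indep_set_sigma_sets st rv)
    show "indep_set {(\<lambda>\<omega>. W \<omega> $ a) -` A \<inter> space M |A. A \<in> sets borel}
        {(\<lambda>\<omega>. W \<omega> $ b) -` A \<inter> space M |A. A \<in> sets borel}"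
      unfolding indep_sets2_eq
    proof (safe, goal_cases)
      case (1 _ A) then show ?case by (intro measurable_sets[OF rv])
    next
      case (2 _ A) then show ?case by (intro measurable_sets[OF rv])
    next
      case (3 _ _ A B)
      have "emeasure M {\<omega>\<in>space M. W \<omega> $ a \<in> A \<and> W \<omega> $ b \<in> B} =
          emeasure M {\<omega>\<in>space M. W \<omega> $ a \<in> A} * emeasure M {\<omega>\<in>space M. W \<omega> $ b \<in> B}"
        using 3 by (simp add: one two)
      then have "prob {\<omega>\<in>space M. W \<omega> $ a \<in> A \<and> W \<omega> $ b \<in> B} =
          prob {\<omega>\<in>space M. W \<omega> $ a \<in> A} * prob {\<omega>\<in>space M. W \<omega> $ b \<in> B}"
        by (simp add: emeasure_eq_measure flip: ennreal_mult)
      moreover have "(\<lambda>\<omega>. W \<omega> $ a) -` A \<inter> space M \<inter> ((\<lambda>\<omega>. W \<omega> $ b) -` B \<inter> space M)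
          = {\<omega>\<in>space M. W \<omega> $ a \<in> A \<and> W \<omega> $ b \<in> B}" by auto
      moreover have "(\<lambda>\<omega>. W \<omega> $ i) -` C \<inter> space M = {\<omega>\<in>space M. W \<omega> $ i \<in> C}" for i C by auto
      ultimately show ?case by simp
    qed
  qed
qed

text \<open>The second moments give the isometry of the stochastic integral; the fourth moments control how far
  a stopped integral can overshoot its level.\<close>

lemma
  fixes W :: "'a \<Rightarrow> real ^ 'd"
  assumes W: "distributed M lborel W (\<lambda>x. ennreal (\<Prod>i\<in>UNIV. normal_density 0 (sqrt h) (x $ i)))"
    and h: "0 < h"
  shows integrable_gaussian_vec: "integrable M (\<lambda>\<omega>. W \<omega> $ a)"
    and expectation_gaussian_vec: "expectation (\<lambda>\<omega>. W \<omega> $ a) = 0"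
    and integrable_gaussian_vec_mult: "integrable M (\<lambda>\<omega>. W \<omega> $ a * W \<omega> $ b)"
    and expectation_gaussian_vec_mult: "expectation (\<lambda>\<omega>. W \<omega> $ a * W \<omega> $ b) = (if a = b then h else 0)"
    and integrable_gaussian_vec_power4: "integrable M (\<lambda>\<omega>. (W \<omega> $ a) ^ 4)"
    and expectation_gaussian_vec_power4: "expectation (\<lambda>\<omega>. (W \<omega> $ a) ^ 4) = 3 * h\<^sup>2"
proof -
  let ?g = "normal_density 0 (sqrt h)"
  have g1: "(\<integral>\<^sup>+x. ennreal (?g x) \<partial>lborel) = 1"
    using h by (simp add: nn_integral_eq_integral)
  have D: "distributed M lborel (\<lambda>\<omega>. W \<omega> $ i) ?g" for i
    by (rule distributed_vec_component[OF W]) (auto simp: g1)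
  have pos: "0 < sqrt h" using h by simp
  have I: "integrable M (\<lambda>\<omega>. (W \<omega> $ i) ^ k)" for i k
    using integrable_normal_moment[OF pos, of 0 k] distributed_integrable[OF D, of "\<lambda>x. x ^ k"] by simp
  have E: "expectation (\<lambda>\<omega>. (W \<omega> $ i) ^ k) = (\<integral>x. ?g x * x ^ k \<partial>lborel)" for i k
    using distributed_integral[OF D, of "\<lambda>x. x ^ k"] by simp
  show i1: "integrable M (\<lambda>\<omega>. W \<omega> $ a)" for a using I[of a 1] by simp
  show e1: "expectation (\<lambda>\<omega>. W \<omega> $ a) = 0" for a
    using E[of a 1] integral_normal_moment_odd[OF pos, of 0 0] by simp
  show "integrable M (\<lambda>\<omega>. (W \<omega> $ a) ^ 4)" by (rule I)
  show "expectation (\<lambda>\<omega>. (W \<omega> $ a) ^ 4) = 3 * h\<^sup>2"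
    using E[of a 4] integral_normal_moment_even[OF pos, of 0 2] h
    by (simp add: fact_numeral field_simps power2_eq_square power4_eq_xxxx)
  have "integrable M (\<lambda>\<omega>. W \<omega> $ a * W \<omega> $ b) \<and>
    expectation (\<lambda>\<omega>. W \<omega> $ a * W \<omega> $ b) = (if a = b then h else 0)"
  proof (cases "a = b")
    case True
    then show ?thesis
      using I[of b 2] E[of b 2] integral_normal_moment_even[OF pos, of 0 1] h
      by (simp add: power2_eq_square)
  next
    case False
    then have "indep_var borel (\<lambda>\<omega>. W \<omega> $ a) borel (\<lambda>\<omega>. W \<omega> $ b)"
      by (intro indep_var_vec_components[OF W]) (auto simp: g1)
    from indep_var_integrable[OF this i1 i1] indep_var_lebesgue_integral[OF this i1 i1] False
    show ?thesis by (simp add: e1)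
  qed
  then show "integrable M (\<lambda>\<omega>. W \<omega> $ a * W \<omega> $ b)"
    "expectation (\<lambda>\<omega>. W \<omega> $ a * W \<omega> $ b) = (if a = b then h else 0)" by auto
qed

end

section \<open>Filtrations, martingales and Brownian increments\<close>

context usual_filtered_prob_space
begin

lemma space_F: "0 \<le> s \<Longrightarrow> space (F s) = space M"
  using subalgebra_F by (auto simp: subalgebra_def)

lemma sets_F_subset: "0 \<le> s \<Longrightarrow> A \<in> sets (F s) \<Longrightarrow> A \<in> sets M"
  using subalgebra_F by (auto simp: subalgebra_def)

lemma measurable_F_imp_M: "0 \<le> s \<Longrightarrow> g \<in> measurable (F s) N \<Longrightarrow> g \<in> measurable M N"
  using measurable_from_subalg[OF subalgebra_F] by blast

lemma measurable_F_mono: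
  assumes "0 \<le> s" "s \<le> u" "g \<in> measurable (F s) N" shows "g \<in> measurable (F u) N"
proof -
  have "subalgebra (F u) (F s)"
    using assms space_F[of s] space_F[of u] sets_F_mono[of s u] by (auto simp: subalgebra_def)
  from measurable_from_subalg[OF this] assms(3) show ?thesis by blast
qed

lemma sigma_finite_subalgebra_F: "0 \<le> s \<Longrightarrow> sigma_finite_subalgebra M (F s)"
  by (intro finite_measure_subalgebra_is_sigma_finite finite_measure_subalgebra.intro
      finite_measure_subalgebra_axioms.intro finite_measure_axioms subalgebra_F)

lemma null_sets_F: "0 \<le> s \<Longrightarrow> A \<in> null_sets M \<Longrightarrow> A \<in> sets (F s)"
  using null_sets_F0 sets_F_mono[of 0 s] by auto

text \<open>An almost sure limit of \<open>\<F>\<^sub>s\<close>-measurable functions is \<open>\<F>\<^sub>s\<close>-measurable because every subset of the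
  exceptional set is an \<open>\<F>\<^sub>s\<close>-measurable null set: the measure is complete and \<open>\<F>\<^sub>0\<close> contains all
  null sets.\<close>

lemma measurable_F_AE_LIMSEQ:
  fixes h :: "'w \<Rightarrow> real"
  assumes s: "0 \<le> s" and g: "\<And>i. g i \<in> borel_measurable (F s)"
    and lim: "AE \<omega> in M. (\<lambda>i. g i \<omega>) \<longlonglongrightarrow> h \<omega>"
  shows "h \<in> borel_measurable (F s)"
proof -
  define Z where "Z = {\<omega>\<in>space M. \<not> (\<lambda>i. g i \<omega>) \<longlonglongrightarrow> h \<omega>}"
  have Z0: "Z \<in> null_sets M" using lim unfolding Z_def by (simp add: AE_iff_null_sets)
  have ZM: "Z \<subseteq> space M" unfolding Z_def by auto
  have ZF: "A \<in> sets (F s)" if "A \<subseteq> Z" for A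
    using null_sets_F[OF s] complete2[OF that Z0] by blast
  have lim': "(\<lambda>\<omega>. indicator (space M - Z) \<omega> * h \<omega>) \<in> borel_measurable (F s)"
  proof (rule borel_measurable_LIMSEQ_real)
    have [measurable]: "Z \<in> sets (F s)" by (rule ZF) simp
    note [measurable] = g
    have "space M - Z \<in> sets (F s)" using sets.compl_sets[of Z "F s"] by (simp add: space_F s ZF)
    then show "(\<lambda>\<omega>. indicator (space M - Z) \<omega> * g i \<omega>) \<in> borel_measurable (F s)" for i
      by measurable
    show "(\<lambda>i. indicator (space M - Z) \<omega> * g i \<omega>) \<longlonglongrightarrow> indicator (space M - Z) \<omega> * h \<omega>"
      if "\<omega> \<in> space (F s)" for \<omega>
      using that by (auto simp: Z_def space_F s indicator_def)
  qed
  show ?thesis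
  proof (rule measurableI)
    fix S :: "real set" assume S: "S \<in> sets borel"
    have 1: "(\<lambda>\<omega>. indicator (space M - Z) \<omega> * h \<omega>) -` S \<inter> space M \<in> sets (F s)"
      using measurable_sets[OF lim' S] by (simp add: space_F s)
    have "h -` S \<inter> space (F s) =
        (((\<lambda>\<omega>. indicator (space M - Z) \<omega> * h \<omega>) -` S \<inter> space M) - Z) \<union> (h -` S \<inter> space M \<inter> Z)"
    proof -
      have "indicator (space M - Z) \<omega> * h \<omega> = h \<omega>" if "\<omega> \<in> space M" "\<omega> \<notin> Z" for \<omega>
        using that by simp
      then have "indicator (space M - Z) \<omega> * h \<omega> \<in> S \<longleftrightarrow> h \<omega> \<in> S" if "\<omega> \<in> space M" "\<omega> \<notin> Z" for \<omega>
        using that by metis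
      then show ?thesis unfolding space_F[OF s] by blast
    qed
    also have "\<dots> \<in> sets (F s)"
      by (intro sets.Un sets.Diff 1) (auto intro: ZF)
    finally show "h -` S \<inter> space (F s) \<in> sets (F s)" .
  qed simp
qed

text \<open>In terms of integrals over the events of \<open>\<F>\<^sub>s\<close>, the martingale property is stable under limits in
  \<open>L\<^sup>1\<close> and is checked without computing conditional expectations. This lemma and the next translate
  between the two forms.\<close>

lemma martingale_uptoI:
  assumes "\<And>r. 0 \<le> r \<Longrightarrow> r \<le> t \<Longrightarrow> Y r \<in> borel_measurable (F r)"
    and int: "\<And>r. 0 \<le> r \<Longrightarrow> r \<le> t \<Longrightarrow> integrable M (Y r)"
    and eq: "\<And>s r A. 0 \<le> s \<Longrightarrow> s \<le> r \<Longrightarrow> r \<le> t \<Longrightarrow> A \<in> sets (F s) \<Longrightarrow>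
      (LINT \<omega>:A|M. Y r \<omega>) = (LINT \<omega>:A|M. Y s \<omega>)"
  shows "martingale_upto M F t Y"
  unfolding martingale_upto_def
proof (intro conjI ballI allI impI)
  fix s r assume *: "0 \<le> s \<and> s \<le> r \<and> r \<le> t"
  interpret sigma_finite_subalgebra M "F s" using * by (intro sigma_finite_subalgebra_F) simp
  show "AE \<omega> in M. real_cond_exp M (F s) (Y r) \<omega> = Y s \<omega>"
    using * assms by (intro real_cond_exp_charact) auto
qed (use assms in auto)

lemma martingale_upto_set_integral:
  assumes Y: "martingale_upto M F t Y" and "0 \<le> s" "s \<le> r" "r \<le> t" "A \<in> sets (F s)"
  shows "(LINT \<omega>:A|M. Y r \<omega>) = (LINT \<omega>:A|M. Y s \<omega>)"
proof -
  interpret sigma_finite_subalgebra M "F s" using assms by (intro sigma_finite_subalgebra_F) simp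
  have "integrable M (Y r)" using Y assms by (auto simp: martingale_upto_def)
  then have "(LINT \<omega>:A|M. Y r \<omega>) = (LINT \<omega>:A|M. real_cond_exp M (F s) (Y r) \<omega>)"
    using assms by (intro real_cond_exp_intA)
  also have "\<dots> = (LINT \<omega>:A|M. Y s \<omega>)"
    unfolding set_lebesgue_integral_def
  proof (intro integral_cong_AE)
    have "A \<in> sets M" using assms sets_F_subset by auto
    moreover have "Y s \<in> borel_measurable M"
      using Y assms by (auto simp: martingale_upto_def dest!: bspec[of _ _ s])
    ultimately show "(\<lambda>x. indicat_real A x *\<^sub>R Y s x) \<in> borel_measurable M"
      "(\<lambda>x. indicat_real A x *\<^sub>R real_cond_exp M (F s) (Y r) x) \<in> borel_measurable M"
      by measurable
    show "AE x in M. indicat_real A x *\<^sub>R real_cond_exp M (F s) (Y r) x = indicat_real A x *\<^sub>R Y s x"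
    proof -
      have "AE x in M. real_cond_exp M (F s) (Y r) x = Y s x"
        using Y assms by (auto simp: martingale_upto_def)
      then show ?thesis by eventually_elim simp
    qed
  qed
  finally show ?thesis .
qed

end

text \<open>The integral of the step process \<open>\<Sum>j<N. \<xi>\<^sub>j \<one>\<^bsub>(q\<^sub>j, q\<^sub>j\<^sub>+\<^sub>1]\<^esub>\<close> with grid \<open>q\<close> and
  coefficients \<open>\<xi>\<close> as explicit parameters, since refinement changes the grid and stopping changes
  the coefficients.\<close>

definition step_integral ::
  "(real \<Rightarrow> 'w \<Rightarrow> real ^ 'd) \<Rightarrow> (nat \<Rightarrow> real) \<Rightarrow> (nat \<Rightarrow> 'w \<Rightarrow> real ^ 'd) \<Rightarrow> nat \<Rightarrow> real \<Rightarrow> 'w \<Rightarrow> real" where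
  "step_integral B q \<xi> N r \<omega> = (\<Sum>j<N. \<xi> j \<omega> \<bullet> (B (min r (q (Suc j))) \<omega> - B (min r (q j)) \<omega>))"

definition step_data ::
  "'w measure \<Rightarrow> (real \<Rightarrow> 'w measure) \<Rightarrow> real \<Rightarrow> (nat \<Rightarrow> real) \<Rightarrow> (nat \<Rightarrow> 'w \<Rightarrow> real ^ 'd) \<Rightarrow> nat \<Rightarrow> bool" where
  "step_data M F t q \<xi> N \<longleftrightarrow> q 0 = 0 \<and> q N = t \<and> (\<forall>j<N. q j < q (Suc j)) \<and>
     (\<forall>j<N. \<xi> j \<in> borel_measurable (F (q j)) \<and> (\<exists>C. \<forall>\<omega>\<in>space M. norm (\<xi> j \<omega>) \<le> C))"

lemma step_data_mono:
  assumes "step_data M F t q \<xi> N" "i \<le> j" "j \<le> N" shows "q i \<le> q j"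
  using assms(2,3)
proof (induction j rule: dec_induct)
  case (step j)
  then have "q j < q (Suc j)" using assms(1) by (auto simp: step_data_def)
  with step show ?case by auto
qed simp

lemma step_data_bounds:
  assumes "step_data M F t q \<xi> N" "j \<le> N" shows "0 \<le> q j" "q j \<le> t"
  using step_data_mono[OF assms(1), of 0 j] step_data_mono[OF assms(1), of j N] assms
  by (auto simp: step_data_def)

locale brownian_filtration = usual_filtered_prob_space M F
  for M :: "'w measure" and F +
  fixes B :: "real \<Rightarrow> 'w \<Rightarrow> real ^ 'd"
  assumes bm: "brownian_motion M F B"
begin

lemma B_measurable_F: "0 \<le> s \<Longrightarrow> s \<le> u \<Longrightarrow> B s \<in> borel_measurable (F u)"
  using bm by (auto simp: brownian_motion_def intro: measurable_F_mono)

lemma B_measurable: "0 \<le> s \<Longrightarrow> B s \<in> borel_measurable M"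
  using B_measurable_F measurable_F_imp_M by blast

lemma vec_nth_measurable: "W \<in> borel_measurable N \<Longrightarrow> (\<lambda>\<omega>. (W \<omega> :: real ^ 'd) $ i) \<in> borel_measurable N"
  by (rule measurable_compose, assumption) (intro borel_measurable_continuous_onI continuous_intros)

text \<open>The vector-valued increment enters through a real function \<open>g\<close>, which will be a coordinate or a
  product of two coordinates; expectations of products with \<open>\<eta>\<close> then factor by the theorem on
  independent real random variables.\<close>

lemma indep_increment:
  fixes \<eta> :: "'w \<Rightarrow> real" and g :: "real ^ 'd \<Rightarrow> real"
  assumes uv: "0 \<le> u" "u < v" and \<eta>: "\<eta> \<in> borel_measurable (F u)" and g: "g \<in> borel_measurable borel"
  shows "indep_var borel \<eta> borel (\<lambda>\<omega>. g (B v \<omega> - B u \<omega>))"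
  unfolding indep_var_eq
proof (intro conjI)
  have Bm [measurable]: "B v \<in> borel_measurable M" "B u \<in> borel_measurable M"
    using uv by (auto intro: B_measurable)
  note [measurable] = g
  show "random_variable borel \<eta>" using measurable_F_imp_M[OF _ \<eta>] uv by simp
  show "random_variable borel (\<lambda>\<omega>. g (B v \<omega> - B u \<omega>))" by measurable
  let ?V = "vimage_algebra (space M) (\<lambda>\<omega>. B v \<omega> - B u \<omega>) borel"
  have ind: "indep_set (sets (F u)) (sets ?V)"
    using bm uv by (auto simp: brownian_motion_def)
  have 1: "sigma_sets (space M) {\<eta> -` A \<inter> space M |A. A \<in> sets borel} \<subseteq> sets (F u)"
  proof (intro sets.sigma_sets_subset')
    show "space M \<in> sets (F u)" using sets.top[of "F u"] uv by (simp add: space_F)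
    show "{\<eta> -` A \<inter> space M |A. A \<in> sets borel} \<subseteq> sets (F u)"
      using measurable_sets[OF \<eta>] uv by (auto simp: space_F)
  qed
  have "(\<lambda>\<omega>. B v \<omega> - B u \<omega>) \<in> measurable ?V borel"
    by (rule measurable_vimage_algebra1) simp
  then have "(\<lambda>\<omega>. g (B v \<omega> - B u \<omega>)) \<in> measurable ?V borel" by measurable
  then have 2: "sigma_sets (space M) {(\<lambda>\<omega>. g (B v \<omega> - B u \<omega>)) -` A \<inter> space M |A. A \<in> sets borel} \<subseteq> sets ?V"
    using sets.top[of ?V] by (intro sets.sigma_sets_subset') (auto dest: measurable_sets)
  show "indep_set (sigma_sets (space M) {\<eta> -` A \<inter> space M |A. A \<in> sets borel})
     (sigma_sets (space M) {(\<lambda>\<omega>. g (B v \<omega> - B u \<omega>)) -` A \<inter> space M |A. A \<in> sets borel})"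
    using ind 1 2 unfolding indep_sets2_eq by blast
qed

text \<open>The coefficient \<open>\<eta>\<close> is independent of the centred increment after time \<open>u\<close>, so each coordinate of
  the inner product has expectation zero. It is stated for integrable \<open>\<eta>\<close>
  because the proof of the isometry applies it to an unbounded one.\<close>

lemma
  fixes \<eta> :: "'w \<Rightarrow> real ^ 'd"
  assumes uv: "0 \<le> u" "u \<le> v" and \<eta>: "\<eta> \<in> borel_measurable (F u)"
    and int: "\<And>a. integrable M (\<lambda>\<omega>. \<eta> \<omega> $ a)"
  shows integrable_inner_increment: "integrable M (\<lambda>\<omega>. \<eta> \<omega> \<bullet> (B v \<omega> - B u \<omega>))"
    and expectation_inner_increment: "expectation (\<lambda>\<omega>. \<eta> \<omega> \<bullet> (B v \<omega> - B u \<omega>)) = 0"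
proof -
  have "integrable M (\<lambda>\<omega>. \<eta> \<omega> \<bullet> (B v \<omega> - B u \<omega>)) \<and> expectation (\<lambda>\<omega>. \<eta> \<omega> \<bullet> (B v \<omega> - B u \<omega>)) = 0"
  proof (cases "u = v")
    case False
    then have uv': "u < v" using uv by simp
    have D: "distributed M lborel (\<lambda>\<omega>. B v \<omega> - B u \<omega>)
          (\<lambda>x. ennreal (\<Prod>i\<in>UNIV. normal_density 0 (sqrt (v - u)) (x $ i)))"
      using bm uv' uv(1) by (auto simp: brownian_motion_def)
    have h: "0 < v - u" using uv' by simp
    have ind: "indep_var borel (\<lambda>\<omega>. \<eta> \<omega> $ a) borel (\<lambda>\<omega>. (B v \<omega> - B u \<omega>) $ a)" for a
      by (intro indep_increment uv uv' vec_nth_measurable \<eta>) simp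
    note i = integrable_gaussian_vec[OF D h] and e = expectation_gaussian_vec[OF D h]
    have "integrable M (\<lambda>\<omega>. \<eta> \<omega> $ a * (B v \<omega> - B u \<omega>) $ a)"
      and "expectation (\<lambda>\<omega>. \<eta> \<omega> $ a * (B v \<omega> - B u \<omega>) $ a) = 0" for a
      using indep_var_integrable[OF ind int i] indep_var_lebesgue_integral[OF ind int i] e by auto
    then show ?thesis by (simp add: inner_vec_def)
  qed simp
  then show "integrable M (\<lambda>\<omega>. \<eta> \<omega> \<bullet> (B v \<omega> - B u \<omega>))"
    "expectation (\<lambda>\<omega>. \<eta> \<omega> \<bullet> (B v \<omega> - B u \<omega>)) = 0" by auto
qed

lemma bounded_vec_integrable:
  fixes \<eta> :: "'w \<Rightarrow> real ^ 'd"
  assumes "\<eta> \<in> borel_measurable M" and C: "\<And>\<omega>. \<omega> \<in> space M \<Longrightarrow> norm (\<eta> \<omega>) \<le> C"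
  shows "integrable M (\<lambda>\<omega>. \<eta> \<omega> $ a)" "integrable M (\<lambda>\<omega>. \<eta> \<omega> $ a * \<eta> \<omega> $ b)"
    "integrable M (\<lambda>\<omega>. (norm (\<eta> \<omega>))\<^sup>2)"
proof -
  note [measurable] = assms(1) vec_nth_measurable[OF assms(1)]
  have c: "\<bar>\<eta> \<omega> $ a\<bar> \<le> C" if "\<omega> \<in> space M" for \<omega> a
    using component_le_norm_cart[of "\<eta> \<omega>" a] C[OF that] by simp
  show "integrable M (\<lambda>\<omega>. \<eta> \<omega> $ a)"
    by (rule integrable_const_bound[of _ C]) (auto simp: c)
  show "integrable M (\<lambda>\<omega>. \<eta> \<omega> $ a * \<eta> \<omega> $ b)"
    by (rule integrable_const_bound[of _ "C * C"])
      (auto simp: c abs_mult intro!: mult_mono order_trans[OF abs_ge_zero c])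
  show "integrable M (\<lambda>\<omega>. (norm (\<eta> \<omega>))\<^sup>2)"
    by (rule integrable_const_bound[of _ "C\<^sup>2"]) (auto intro!: power_mono C)
qed

text \<open>Expanding the square over pairs of coordinates, the mixed terms vanish since distinct components of
  the increment are uncorrelated. For the fourth moment the Cauchy-Schwarz inequality, in \<open>real ^ 'd\<close>
  and then over the coordinates, separates the bounded coefficient from the increment.\<close>

lemma
  fixes \<eta> :: "'w \<Rightarrow> real ^ 'd"
  assumes uv: "0 \<le> u" "u \<le> v" and \<eta>: "\<eta> \<in> borel_measurable (F u)"
    and C: "\<And>\<omega>. \<omega> \<in> space M \<Longrightarrow> norm (\<eta> \<omega>) \<le> C"
  shows integrable_inner_increment_sq: "integrable M (\<lambda>\<omega>. (\<eta> \<omega> \<bullet> (B v \<omega> - B u \<omega>))\<^sup>2)"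
    and expectation_inner_increment_sq:
      "expectation (\<lambda>\<omega>. (\<eta> \<omega> \<bullet> (B v \<omega> - B u \<omega>))\<^sup>2) = (v - u) * expectation (\<lambda>\<omega>. (norm (\<eta> \<omega>))\<^sup>2)"
    and integrable_inner_increment_power4: "integrable M (\<lambda>\<omega>. (\<eta> \<omega> \<bullet> (B v \<omega> - B u \<omega>)) ^ 4)"
    and expectation_inner_increment_power4:
      "expectation (\<lambda>\<omega>. (\<eta> \<omega> \<bullet> (B v \<omega> - B u \<omega>)) ^ 4) \<le> 3 * (real CARD('d))\<^sup>2 * C ^ 4 * (v - u)\<^sup>2"
proof -
  have \<eta>M: "\<eta> \<in> borel_measurable M" using measurable_F_imp_M[OF _ \<eta>] uv by simp
  note bi = bounded_vec_integrable[OF \<eta>M C]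
  have "integrable M (\<lambda>\<omega>. (\<eta> \<omega> \<bullet> (B v \<omega> - B u \<omega>))\<^sup>2) \<and>
    expectation (\<lambda>\<omega>. (\<eta> \<omega> \<bullet> (B v \<omega> - B u \<omega>))\<^sup>2) = (v - u) * expectation (\<lambda>\<omega>. (norm (\<eta> \<omega>))\<^sup>2) \<and>
    integrable M (\<lambda>\<omega>. (\<eta> \<omega> \<bullet> (B v \<omega> - B u \<omega>)) ^ 4) \<and>
    expectation (\<lambda>\<omega>. (\<eta> \<omega> \<bullet> (B v \<omega> - B u \<omega>)) ^ 4) \<le> 3 * (real CARD('d))\<^sup>2 * C ^ 4 * (v - u)\<^sup>2"
  proof (cases "u = v")
    case False
    then have uv': "u < v" using uv by simp
    define W where "W = (\<lambda>\<omega>. B v \<omega> - B u \<omega>)"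
    have D: "distributed M lborel W
          (\<lambda>x. ennreal (\<Prod>i\<in>UNIV. normal_density 0 (sqrt (v - u)) (x $ i)))"
      using bm uv' uv(1) by (auto simp: brownian_motion_def W_def)
    have [measurable]: "W \<in> borel_measurable M" using distributed_measurable[OF D] by simp
    have h: "0 < v - u" using uv' by simp
    have ind: "indep_var borel (\<lambda>\<omega>. \<eta> \<omega> $ a * \<eta> \<omega> $ b) borel (\<lambda>\<omega>. W \<omega> $ a * W \<omega> $ b)" for a b
      unfolding W_def
      by (intro indep_increment[of u v _ "\<lambda>x. x $ a * x $ b"] uv uv' borel_measurable_times
          vec_nth_measurable \<eta> borel_measurable_continuous_onI continuous_intros)
    note i = integrable_gaussian_vec_mult[OF D h] and e = expectation_gaussian_vec_mult[OF D h]
    have 1: "(\<eta> \<omega> \<bullet> W \<omega>)\<^sup>2 = (\<Sum>a\<in>UNIV. \<Sum>b\<in>UNIV. (\<eta> \<omega> $ a * \<eta> \<omega> $ b) * (W \<omega> $ a * W \<omega> $ b))" for \<omega>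
      by (simp add: inner_vec_def power2_eq_square sum_product ac_simps)
    have I: "integrable M (\<lambda>\<omega>. (\<eta> \<omega> $ a * \<eta> \<omega> $ b) * (W \<omega> $ a * W \<omega> $ b))"
      and E: "expectation (\<lambda>\<omega>. (\<eta> \<omega> $ a * \<eta> \<omega> $ b) * (W \<omega> $ a * W \<omega> $ b)) =
        (if a = b then (v - u) * expectation (\<lambda>\<omega>. \<eta> \<omega> $ a * \<eta> \<omega> $ b) else 0)" for a b
      using indep_var_integrable[OF ind bi(2) i] indep_var_lebesgue_integral[OF ind bi(2) i] e
      by auto
    have "expectation (\<lambda>\<omega>. (\<eta> \<omega> \<bullet> W \<omega>)\<^sup>2) = (v - u) * expectation (\<lambda>\<omega>. (norm (\<eta> \<omega>))\<^sup>2)"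
    proof -
      have "expectation (\<lambda>\<omega>. (\<eta> \<omega> \<bullet> W \<omega>)\<^sup>2) = (v - u) * (\<Sum>a\<in>UNIV. expectation (\<lambda>\<omega>. \<eta> \<omega> $ a * \<eta> \<omega> $ a))"
        unfolding 1 by (simp add: I E sum_distrib_left)
      also have "(\<Sum>a\<in>UNIV. expectation (\<lambda>\<omega>. \<eta> \<omega> $ a * \<eta> \<omega> $ a)) = expectation (\<lambda>\<omega>. (norm (\<eta> \<omega>))\<^sup>2)"
        by (simp add: power2_norm_eq_inner inner_vec_def bi)
      finally show ?thesis .
    qed
    moreover have "integrable M (\<lambda>\<omega>. (\<eta> \<omega> \<bullet> W \<omega>)\<^sup>2)" by (simp add: 1 I)
    moreover
    note i4 = integrable_gaussian_vec_power4[OF D h] and e4 = expectation_gaussian_vec_power4[OF D h]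
    let ?d = "real CARD('d)"
    have le: "(\<eta> \<omega> \<bullet> W \<omega>) ^ 4 \<le> C ^ 4 * (?d * (\<Sum>a\<in>UNIV. (W \<omega> $ a) ^ 4))" if "\<omega> \<in> space M" for \<omega>
    proof -
      have C0: "0 \<le> C" using C[OF that] norm_ge_zero order_trans by blast
      have "\<bar>\<eta> \<omega> \<bullet> W \<omega>\<bar> \<le> C * norm (W \<omega>)"
        using Cauchy_Schwarz_ineq2[of "\<eta> \<omega>" "W \<omega>"] mult_right_mono[OF C[OF that] norm_ge_zero[of "W \<omega>"]]
        by linarith
      then have "\<bar>\<eta> \<omega> \<bullet> W \<omega>\<bar> ^ 4 \<le> (C * norm (W \<omega>)) ^ 4" by (intro power_mono) auto
      then have "(\<eta> \<omega> \<bullet> W \<omega>) ^ 4 \<le> C ^ 4 * ((norm (W \<omega>))\<^sup>2)\<^sup>2"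
        by (simp add: power_mult_distrib)
      also have "((norm (W \<omega>))\<^sup>2)\<^sup>2 = (\<Sum>a\<in>UNIV. (W \<omega> $ a)\<^sup>2)\<^sup>2"
        unfolding power2_norm_eq_inner inner_vec_def by (simp add: power2_eq_square)
      also have "\<dots> \<le> ?d * (\<Sum>a\<in>UNIV. ((W \<omega> $ a)\<^sup>2)\<^sup>2)"
        using sum_squared_le_sum_of_squares[of "\<lambda>a. (W \<omega> $ a)\<^sup>2" UNIV] by (simp add: mult.commute)
      finally show ?thesis using C0 by (simp add: mult_left_mono)
    qed
    have ib: "integrable M (\<lambda>\<omega>. C ^ 4 * (?d * (\<Sum>a\<in>UNIV. (W \<omega> $ a) ^ 4)))" using i4 by simp
    have i4': "integrable M (\<lambda>\<omega>. (\<eta> \<omega> \<bullet> W \<omega>) ^ 4)"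
      by (rule Bochner_Integration.integrable_bound[OF ib])
        (use \<eta>M le in \<open>auto intro!: AE_I2 order_trans[OF _ abs_ge_self]\<close>)
    moreover have "expectation (\<lambda>\<omega>. (\<eta> \<omega> \<bullet> W \<omega>) ^ 4) \<le> 3 * ?d\<^sup>2 * C ^ 4 * (v - u)\<^sup>2"
      using integral_mono[OF i4' ib le] by (simp add: i4 e4 power2_eq_square algebra_simps)
    ultimately show ?thesis by (simp add: W_def)
  qed simp
  then show "integrable M (\<lambda>\<omega>. (\<eta> \<omega> \<bullet> (B v \<omega> - B u \<omega>))\<^sup>2)"
    "expectation (\<lambda>\<omega>. (\<eta> \<omega> \<bullet> (B v \<omega> - B u \<omega>))\<^sup>2) = (v - u) * expectation (\<lambda>\<omega>. (norm (\<eta> \<omega>))\<^sup>2)"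
    "integrable M (\<lambda>\<omega>. (\<eta> \<omega> \<bullet> (B v \<omega> - B u \<omega>)) ^ 4)"
    "expectation (\<lambda>\<omega>. (\<eta> \<omega> \<bullet> (B v \<omega> - B u \<omega>)) ^ 4) \<le> 3 * (real CARD('d))\<^sup>2 * C ^ 4 * (v - u)\<^sup>2"
    by auto
qed

end

section \<open>Integrals of step processes and stopping on a grid\<close>

text \<open>Stopping at the first grid index at which \<open>P\<close> holds: the interval that begins at that index is
  already switched off, so the stopped coefficients remain adapted to the left end points.\<close>

definition stopped_coeff :: "(nat \<Rightarrow> 'w \<Rightarrow> bool) \<Rightarrow> (nat \<Rightarrow> 'w \<Rightarrow> 'b::zero) \<Rightarrow> nat \<Rightarrow> 'w \<Rightarrow> 'b" where
  "stopped_coeff P \<xi> j \<omega> = (if \<exists>i\<le>j. P i \<omega> then 0 else \<xi> j \<omega>)"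

text \<open>The default value \<open>N\<close>, taken when \<open>P\<close> never holds before \<open>N\<close>, is the index of the final time.\<close>

definition first_index :: "(nat \<Rightarrow> 'w \<Rightarrow> bool) \<Rightarrow> nat \<Rightarrow> 'w \<Rightarrow> nat" where
  "first_index P N \<omega> = (LEAST i. P i \<omega> \<or> i = N)"

lemma first_index_le: "first_index P N \<omega> \<le> N"
  unfolding first_index_def by (rule Least_le) simp

lemma first_index_hit: "P (first_index P N \<omega>) \<omega> \<or> first_index P N \<omega> = N"
  unfolding first_index_def by (rule LeastI[of _ N]) simp

lemma first_index_le_iff:
  assumes "j < N" shows "first_index P N \<omega> \<le> j \<longleftrightarrow> (\<exists>i\<le>j. P i \<omega>)"
proof
  assume "first_index P N \<omega> \<le> j"
  then show "\<exists>i\<le>j. P i \<omega>" using first_index_hit[of P N \<omega>] assms by auto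
next
  assume "\<exists>i\<le>j. P i \<omega>"
  then obtain i where i: "i \<le> j" "P i \<omega>" by blast
  have "first_index P N \<omega> \<le> i" unfolding first_index_def using i(2) by (intro Least_le) simp
  with i(1) show "first_index P N \<omega> \<le> j" by simp
qed

lemma not_P_before_first_index: "i < first_index P N \<omega> \<Longrightarrow> \<not> P i \<omega>"
  unfolding first_index_def by (drule not_less_Least) simp

text \<open>Cutting the coefficients off at a grid index and stopping the integral process at the corresponding
  time have the same effect on every increment, because the stopping time is a grid point. Thus a
  stopped step integral is again a step integral.\<close>

lemma stopped_step_integral:
  assumes sd: "step_data M F t q \<xi> N"
  shows "step_integral B q (stopped_coeff P \<xi>) N r \<omega> =
    step_integral B q \<xi> N (min r (q (first_index P N \<omega>))) \<omega>"
  unfolding step_integral_def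
proof (intro sum.cong refl)
  fix j assume "j \<in> {..<N}"
  then have j: "j < N" by simp
  let ?T = "first_index P N \<omega>"
  show "stopped_coeff P \<xi> j \<omega> \<bullet> (B (min r (q (Suc j))) \<omega> - B (min r (q j)) \<omega>) =
    \<xi> j \<omega> \<bullet> (B (min (min r (q ?T)) (q (Suc j))) \<omega> - B (min (min r (q ?T)) (q j)) \<omega>)"
  proof (cases "?T \<le> j")
    case True
    then have "q ?T \<le> q j" "q ?T \<le> q (Suc j)" using j by (auto intro!: step_data_mono[OF sd])
    then have "min (min r (q ?T)) (q (Suc j)) = min (min r (q ?T)) (q j)" by auto
    with True j show ?thesis by (simp add: stopped_coeff_def first_index_le_iff)
  next
    case False
    then have "q j \<le> q ?T" "q (Suc j) \<le> q ?T"
      using first_index_le[of P N \<omega>] by (auto intro!: step_data_mono[OF sd])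
    then have "min (min r (q ?T)) (q (Suc j)) = min r (q (Suc j))" "min (min r (q ?T)) (q j) = min r (q j)"
      by auto
    moreover have "stopped_coeff P \<xi> j \<omega> = \<xi> j \<omega>"
      using False unfolding first_index_le_iff[OF j] stopped_coeff_def by (rule if_not_P)
    ultimately show ?thesis by simp
  qed
qed

text \<open>A grid point that does not stop the integral has a value of at most \<open>c\<close>, and after the last such
  grid point at most one more increment is added; \<open>Q\<close> bounds its square. The time \<open>u\<close> need not be a
  grid point: increments that begin after \<open>u\<close> are zero.\<close>

lemma stopped_step_integral_le:
  assumes sd: "step_data M F t q \<xi> N" and c: "0 \<le> c" and Q0: "0 \<le> Q"
    and bd: "\<And>j. j < N \<Longrightarrow> \<not> P j \<omega> \<Longrightarrow> \<bar>step_integral B q \<xi> N (q j) \<omega>\<bar> \<le> c"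
    and Q: "\<And>j. j < N \<Longrightarrow> (\<xi> j \<omega> \<bullet> (B (min u (q (Suc j))) \<omega> - B (min u (q j)) \<omega>))\<^sup>2 \<le> Q"
  shows "\<bar>step_integral B q (stopped_coeff P \<xi>) N u \<omega>\<bar> \<le> c + sqrt Q"
proof -
  let ?y = "\<lambda>j. B (min u (q (Suc j))) \<omega> - B (min u (q j)) \<omega>"
  have "\<bar>\<Sum>j<i. stopped_coeff P \<xi> j \<omega> \<bullet> ?y j\<bar> \<le> c + sqrt Q" if "i \<le> N" for i
    using that
  proof (induction i)
    case 0
    then show ?case using c Q0 by simp
  next
    case (Suc i)
    show ?case
    proof (cases "stopped_coeff P \<xi> i \<omega> \<bullet> ?y i = 0")
      case True
      then show ?thesis using Suc by simp
    next
      case False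
      have alive: "\<not> (\<exists>l\<le>i. P l \<omega>)"
      proof
        assume "\<exists>l\<le>i. P l \<omega>"
        then have "stopped_coeff P \<xi> i \<omega> = 0" by (simp add: stopped_coeff_def)
        with False show False by simp
      qed
      have qi: "q i < u"
      proof (rule ccontr)
        assume "\<not> q i < u"
        moreover have "q i \<le> q (Suc i)" using Suc.prems by (intro step_data_mono[OF sd]) auto
        ultimately have "min u (q (Suc i)) = min u (q i)" by auto
        with False show False by simp
      qed
      have "(\<Sum>j<i. stopped_coeff P \<xi> j \<omega> \<bullet> ?y j) =
          (\<Sum>j<i. \<xi> j \<omega> \<bullet> (B (min (q i) (q (Suc j))) \<omega> - B (min (q i) (q j)) \<omega>))"
      proof (intro sum.cong refl)
        fix j assume "j \<in> {..<i}"
        then have j: "j < i" by simp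
        then have "q j \<le> q i" "q (Suc j) \<le> q i" using Suc.prems by (auto intro!: step_data_mono[OF sd])
        with qi j alive show "stopped_coeff P \<xi> j \<omega> \<bullet> ?y j =
            \<xi> j \<omega> \<bullet> (B (min (q i) (q (Suc j))) \<omega> - B (min (q i) (q j)) \<omega>)"
          by (auto simp: stopped_coeff_def min_def)
      qed
      also have "\<dots> = step_integral B q \<xi> N (q i) \<omega>"
        unfolding step_integral_def
      proof (intro sum.mono_neutral_left ballI)
        fix j assume "j \<in> {..<N} - {..<i}"
        then have "q i \<le> q j" "q i \<le> q (Suc j)" by (auto intro!: step_data_mono[OF sd])
        then show "\<xi> j \<omega> \<bullet> (B (min (q i) (q (Suc j))) \<omega> - B (min (q i) (q j)) \<omega>) = 0" by simp
      qed (use Suc.prems in auto)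
      finally have "\<bar>\<Sum>j<i. stopped_coeff P \<xi> j \<omega> \<bullet> ?y j\<bar> \<le> c"
        using bd[of i] alive Suc.prems by auto
      moreover have "\<bar>stopped_coeff P \<xi> i \<omega> \<bullet> ?y i\<bar> \<le> sqrt Q"
        using Q[of i] alive Suc.prems by (intro real_le_rsqrt) (auto simp: stopped_coeff_def)
      ultimately show ?thesis by simp
    qed
  qed
  then show ?thesis unfolding step_integral_def by simp
qed

context brownian_filtration
begin

text \<open>The change, between times \<open>s\<close> and \<open>r\<close>, of one summand of a step integral is governed by an increment
  of \<open>B\<close> that starts after both \<open>s\<close> and \<open>q\<^sub>j\<close>, hence is independent of \<open>\<xi>\<^sub>j\<close> and of the events of
  \<open>\<F>\<^sub>s\<close>. When the interval of the summand does not meet \<open>[s, r]\<close>, the increment is trivial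
  (\<open>u = v\<close>).\<close>

lemma step_increment:
  assumes sd: "step_data M F t q \<xi> N" and j: "j < N" and sr: "0 \<le> s" "s \<le> r"
  obtains u v where "s \<le> u" "q j \<le> u" "u \<le> v" "v - u \<le> q (Suc j) - q j"
    "\<And>\<omega>. (B (min r (q (Suc j))) \<omega> - B (min r (q j)) \<omega>) - (B (min s (q (Suc j))) \<omega> - B (min s (q j)) \<omega>)
      = B v \<omega> - B u \<omega>"
proof (cases "r \<le> q j \<or> q (Suc j) \<le> s")
  case True
  have qq: "q j \<le> q (Suc j)" using step_data_mono[OF sd, of j "Suc j"] j by simp
  have "(B (min r (q (Suc j))) \<omega> - B (min r (q j)) \<omega>) - (B (min s (q (Suc j))) \<omega> - B (min s (q j)) \<omega>) = 0" for \<omega>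
  proof (cases "r \<le> q j")
    case True
    with sr qq have "min r (q (Suc j)) = r" "min r (q j) = r" "min s (q (Suc j)) = s" "min s (q j) = s"
      by auto
    then show ?thesis by simp
  next
    case False
    with True sr qq have "min r (q (Suc j)) = q (Suc j)" "min r (q j) = q j"
      "min s (q (Suc j)) = q (Suc j)" "min s (q j) = q j" by auto
    then show ?thesis by simp
  qed
  then show ?thesis using that[of "max s (q j)" "max s (q j)"] qq by simp
next
  case False
  then show ?thesis
    using that[of "max s (q j)" "min r (q (Suc j))"] sr step_data_mono[OF sd, of j "Suc j"] j
    by (auto simp: min_def max_def)
qed

lemma step_coeff:
  assumes sd: "step_data M F t q \<xi> N" and j: "j < N"
  shows "u \<ge> q j \<Longrightarrow> \<xi> j \<in> borel_measurable (F u)" "\<exists>C. \<forall>\<omega>\<in>space M. norm (\<xi> j \<omega>) \<le> C"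
  using sd j step_data_bounds[OF sd, of j] by (auto simp: step_data_def intro: measurable_F_mono)

lemma step_term:
  assumes sd: "step_data M F t q \<xi> N" and j: "j < N" and r: "0 \<le> r"
  obtains u v where "q j \<le> u" "u \<le> v" "v - u \<le> q (Suc j) - q j"
    "\<And>\<omega>. B (min r (q (Suc j))) \<omega> - B (min r (q j)) \<omega> = B v \<omega> - B u \<omega>"
proof -
  have "0 \<le> q j" "0 \<le> q (Suc j)" using step_data_bounds[OF sd] j by auto
  then have z: "B (min 0 (q (Suc j))) \<omega> - B (min 0 (q j)) \<omega> = 0" for \<omega> by (simp add: min_absorb1)
  obtain u v where "0 \<le> u" "q j \<le> u" "u \<le> v" "v - u \<le> q (Suc j) - q j"
    "\<And>\<omega>. (B (min r (q (Suc j))) \<omega> - B (min r (q j)) \<omega>) - (B (min 0 (q (Suc j))) \<omega> - B (min 0 (q j)) \<omega>)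
      = B v \<omega> - B u \<omega>"
    by (rule step_increment[OF sd j order_refl r]) blast
  then show ?thesis using that[of u v] unfolding z by simp
qed

lemma step_integral_adapted:
  assumes sd: "step_data M F t q \<xi> N" and r: "0 \<le> r"
  shows "step_integral B q \<xi> N r \<in> borel_measurable (F r)"
  unfolding step_integral_def
proof (intro borel_measurable_sum)
  fix j assume "j \<in> {..<N}"
  then have j: "j < N" by simp
  have q: "0 \<le> q j" "0 \<le> q (Suc j)" using step_data_bounds[OF sd] j by auto
  show "(\<lambda>\<omega>. \<xi> j \<omega> \<bullet> (B (min r (q (Suc j))) \<omega> - B (min r (q j)) \<omega>)) \<in> borel_measurable (F r)"
  proof (cases "q j \<le> r")
    case True
    then show ?thesis using r q step_coeff(1)[OF sd j]
      by (intro borel_measurable_inner borel_measurable_diff B_measurable_F) auto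
  next
    case False
    then have "min r (q (Suc j)) = min r (q j)" using step_data_mono[OF sd, of j "Suc j"] j by auto
    then show ?thesis by simp
  qed
qed

lemma step_integral_integrable:
  assumes sd: "step_data M F t q \<xi> N" and r: "0 \<le> r"
  shows "integrable M (step_integral B q \<xi> N r)"
  unfolding step_integral_def
proof (intro Bochner_Integration.integrable_sum)
  fix j assume "j \<in> {..<N}"
  then have j: "j < N" by simp
  have q: "0 \<le> q j" using step_data_bounds[OF sd] j by auto
  obtain u v where *: "q j \<le> u" "u \<le> v" "v - u \<le> q (Suc j) - q j"
    "\<And>\<omega>. B (min r (q (Suc j))) \<omega> - B (min r (q j)) \<omega> = B v \<omega> - B u \<omega>"
    by (rule step_term[OF sd j r]) blast
  note m = step_coeff(1)[OF sd j *(1)]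
  obtain C where C: "\<And>\<omega>. \<omega> \<in> space M \<Longrightarrow> norm (\<xi> j \<omega>) \<le> C" using step_coeff(2)[OF sd j] by blast
  have "\<xi> j \<in> borel_measurable M" using measurable_F_imp_M[OF _ m] q *(1,2) by simp
  from bounded_vec_integrable(1)[OF this C] m
  show "integrable M (\<lambda>\<omega>. \<xi> j \<omega> \<bullet> (B (min r (q (Suc j))) \<omega> - B (min r (q j)) \<omega>))"
    unfolding *(4) using q *(1,2) by (intro integrable_inner_increment) auto
qed

text \<open>For an event \<open>A\<close> of \<open>\<F>\<^sub>s\<close>, the product of its indicator and \<open>\<xi>\<^sub>j\<close> is again a bounded coefficient that is
  known when the increment starts, so every summand has expectation zero.\<close>

lemma step_integral_martingale:
  assumes sd: "step_data M F t q \<xi> N"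
  shows "martingale_upto M F t (step_integral B q \<xi> N)"
proof (rule martingale_uptoI)
  fix s r A assume sr: "0 \<le> s" "s \<le> r" "r \<le> t" and A: "A \<in> sets (F s)"
  let ?I = "step_integral B q \<xi> N"
  have AM: "A \<in> sets M" using sets_F_subset[OF sr(1) A] .
  have i: "integrable M (\<lambda>\<omega>. indicat_real A \<omega> *\<^sub>R ?I u \<omega>)" if "0 \<le> u" for u
    using AM step_integral_integrable[OF sd that] by (rule integrable_mult_indicator)
  have "(LINT \<omega>:A|M. ?I r \<omega>) - (LINT \<omega>:A|M. ?I s \<omega>) =
      expectation (\<lambda>\<omega>. indicat_real A \<omega> *\<^sub>R ?I r \<omega> - indicat_real A \<omega> *\<^sub>R ?I s \<omega>)"
    unfolding set_lebesgue_integral_def using i sr by simp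
  also have "\<dots> = expectation (\<lambda>\<omega>. \<Sum>j<N. (indicat_real A \<omega> *\<^sub>R \<xi> j \<omega>) \<bullet>
      ((B (min r (q (Suc j))) \<omega> - B (min r (q j)) \<omega>) - (B (min s (q (Suc j))) \<omega> - B (min s (q j)) \<omega>)))"
    unfolding step_integral_def
    by (simp add: sum_distrib_left sum_subtractf inner_diff_right right_diff_distrib)
  also have "\<dots> = (\<Sum>j<N. 0)"
  proof -
    have "integrable M (\<lambda>\<omega>. (indicat_real A \<omega> *\<^sub>R \<xi> j \<omega>) \<bullet>
      ((B (min r (q (Suc j))) \<omega> - B (min r (q j)) \<omega>) - (B (min s (q (Suc j))) \<omega> - B (min s (q j)) \<omega>))) \<and>
      expectation (\<lambda>\<omega>. (indicat_real A \<omega> *\<^sub>R \<xi> j \<omega>) \<bullet>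
      ((B (min r (q (Suc j))) \<omega> - B (min r (q j)) \<omega>) - (B (min s (q (Suc j))) \<omega> - B (min s (q j)) \<omega>))) = 0"
      if j: "j < N" for j
    proof -
      obtain u v where *: "s \<le> u" "q j \<le> u" "u \<le> v" "v - u \<le> q (Suc j) - q j"
        "\<And>\<omega>. (B (min r (q (Suc j))) \<omega> - B (min r (q j)) \<omega>) - (B (min s (q (Suc j))) \<omega> - B (min s (q j)) \<omega>)
          = B v \<omega> - B u \<omega>"
        by (rule step_increment[OF sd j sr(1,2)]) blast
      have [measurable]: "\<xi> j \<in> borel_measurable (F u)" using step_coeff(1)[OF sd j *(2)] .
      have [measurable]: "A \<in> sets (F u)" using A sets_F_mono[of s u] sr *(1-3) by auto
      have m: "(\<lambda>\<omega>. indicat_real A \<omega> *\<^sub>R \<xi> j \<omega>) \<in> borel_measurable (F u)" by measurable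
      then have mM: "(\<lambda>\<omega>. indicat_real A \<omega> *\<^sub>R \<xi> j \<omega>) \<in> borel_measurable M"
        using measurable_F_imp_M[OF _ m] sr *(1-3) by simp
      obtain C where C: "\<And>\<omega>. \<omega> \<in> space M \<Longrightarrow> norm (\<xi> j \<omega>) \<le> C" using step_coeff(2)[OF sd j] by blast
      have "norm (indicat_real A \<omega> *\<^sub>R \<xi> j \<omega>) \<le> C" if "\<omega> \<in> space M" for \<omega>
        using C[OF that] order_trans[OF norm_ge_zero C[OF that]] by (auto simp: indicator_def)
      from bounded_vec_integrable(1)[OF mM this] m
      show ?thesis unfolding *(5) using sr *(1-3)
        by (intro conjI integrable_inner_increment expectation_inner_increment) auto
    qed
    then show ?thesis by (subst Bochner_Integration.integral_sum) (blast, intro sum.cong refl, blast)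
  qed
  finally show "(LINT \<omega>:A|M. ?I r \<omega>) = (LINT \<omega>:A|M. ?I s \<omega>)" by simp
qed (use step_integral_adapted[OF sd] step_integral_integrable[OF sd] in auto)

text \<open>The isometry: increments are orthogonal to the past. Here the partial sum \<open>S\<close> is square integrable
  but unbounded, and \<open>S \<xi>\<^sub>i\<close> plays the role of the coefficient in the mixed term.\<close>

lemma
  assumes sd: "step_data M F t q \<xi> N"
  shows integrable_step_integral_sq: "integrable M (\<lambda>\<omega>. (step_integral B q \<xi> N t \<omega>)\<^sup>2)"
    and expectation_step_integral_sq: "expectation (\<lambda>\<omega>. (step_integral B q \<xi> N t \<omega>)\<^sup>2) =
      (\<Sum>j<N. (q (Suc j) - q j) * expectation (\<lambda>\<omega>. (norm (\<xi> j \<omega>))\<^sup>2))"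
proof -
  define y where "y j \<omega> = \<xi> j \<omega> \<bullet> (B (q (Suc j)) \<omega> - B (q j) \<omega>)" for j \<omega>
  have It: "step_integral B q \<xi> N t = (\<lambda>\<omega>. \<Sum>j<N. y j \<omega>)"
    using step_data_bounds(2)[OF sd] by (auto simp: step_integral_def y_def fun_eq_iff intro!: sum.cong)
  have "(\<lambda>\<omega>. \<Sum>j<i. y j \<omega>) \<in> borel_measurable (F (q i)) \<and> integrable M (\<lambda>\<omega>. (\<Sum>j<i. y j \<omega>)\<^sup>2) \<and>
    expectation (\<lambda>\<omega>. (\<Sum>j<i. y j \<omega>)\<^sup>2) = (\<Sum>j<i. (q (Suc j) - q j) * expectation (\<lambda>\<omega>. (norm (\<xi> j \<omega>))\<^sup>2))"
    if "i \<le> N" for i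
    using that
  proof (induction i)
    case (Suc i)
    define S where "S \<omega> = (\<Sum>j<i. y j \<omega>)" for \<omega>
    have i: "i < N" using Suc.prems by simp
    have IH: "S \<in> borel_measurable (F (q i))" "integrable M (\<lambda>\<omega>. (S \<omega>)\<^sup>2)"
      "expectation (\<lambda>\<omega>. (S \<omega>)\<^sup>2) = (\<Sum>j<i. (q (Suc j) - q j) * expectation (\<lambda>\<omega>. (norm (\<xi> j \<omega>))\<^sup>2))"
      using Suc unfolding S_def by auto
    have q: "0 \<le> q i" "q i \<le> q (Suc i)"
      using step_data_bounds[OF sd, of i] step_data_mono[OF sd, of i "Suc i"] i by auto
    note m = step_coeff(1)[OF sd i order_refl]
    note mM = measurable_F_imp_M[OF q(1) m]
    have [measurable]: "S \<in> borel_measurable M" using measurable_F_imp_M[OF q(1) IH(1)] .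
    have Si: "integrable M S"
      by (rule square_integrable_imp_integrable[OF _ IH(2)]) simp
    obtain C where C: "\<And>\<omega>. \<omega> \<in> space M \<Longrightarrow> norm (\<xi> i \<omega>) \<le> C" using step_coeff(2)[OF sd i] by blast
    have m2: "(\<lambda>\<omega>. S \<omega> *\<^sub>R \<xi> i \<omega>) \<in> borel_measurable (F (q i))"
      using IH(1) m by (intro borel_measurable_scaleR)
    have int2: "integrable M (\<lambda>\<omega>. (S \<omega> *\<^sub>R \<xi> i \<omega>) $ a)" for a
    proof (rule Bochner_Integration.integrable_bound)
      show "integrable M (\<lambda>\<omega>. C * \<bar>S \<omega>\<bar>)" using Si by simp
      show "(\<lambda>\<omega>. (S \<omega> *\<^sub>R \<xi> i \<omega>) $ a) \<in> borel_measurable M"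
        using measurable_F_imp_M[OF q(1) m2] by (rule vec_nth_measurable)
      show "AE \<omega> in M. norm ((S \<omega> *\<^sub>R \<xi> i \<omega>) $ a) \<le> norm (C * \<bar>S \<omega>\<bar>)"
      proof (rule AE_I2)
        fix \<omega> assume "\<omega> \<in> space M"
        then have "\<bar>\<xi> i \<omega> $ a\<bar> \<le> \<bar>C\<bar>" using component_le_norm_cart[of "\<xi> i \<omega>" a] C[of \<omega>] by simp
        then show "norm ((S \<omega> *\<^sub>R \<xi> i \<omega>) $ a) \<le> norm (C * \<bar>S \<omega>\<bar>)"
          using mult_left_mono[of "\<bar>\<xi> i \<omega> $ a\<bar>" "\<bar>C\<bar>" "\<bar>S \<omega>\<bar>"] by (simp add: abs_mult mult.commute)
      qed
    qed
    have yS: "S \<omega> * y i \<omega> = (S \<omega> *\<^sub>R \<xi> i \<omega>) \<bullet> (B (q (Suc i)) \<omega> - B (q i) \<omega>)" for \<omega>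
      by (simp add: y_def)
    have Y: "integrable M (\<lambda>\<omega>. (y i \<omega>)\<^sup>2)"
      "expectation (\<lambda>\<omega>. (y i \<omega>)\<^sup>2) = (q (Suc i) - q i) * expectation (\<lambda>\<omega>. (norm (\<xi> i \<omega>))\<^sup>2)"
      unfolding y_def
      by (rule integrable_inner_increment_sq[OF q m C], assumption)
        (rule expectation_inner_increment_sq[OF q m C])
    have SY: "integrable M (\<lambda>\<omega>. S \<omega> * y i \<omega>)" "expectation (\<lambda>\<omega>. S \<omega> * y i \<omega>) = 0"
      unfolding yS by (intro integrable_inner_increment expectation_inner_increment q m2 int2)+
    have eq: "(\<Sum>j<Suc i. y j \<omega>)\<^sup>2 = (S \<omega>)\<^sup>2 + 2 * (S \<omega> * y i \<omega>) + (y i \<omega>)\<^sup>2" for \<omega>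
      by (simp add: S_def power2_sum)
    have "(\<lambda>\<omega>. \<Sum>j<Suc i. y j \<omega>) \<in> borel_measurable (F (q (Suc i)))"
    proof -
      have "S \<in> borel_measurable (F (q (Suc i)))" using measurable_F_mono[OF q IH(1)] .
      moreover have "y i \<in> borel_measurable (F (q (Suc i)))"
        unfolding y_def using q step_coeff(1)[OF sd i]
        by (intro borel_measurable_inner borel_measurable_diff B_measurable_F) auto
      ultimately show ?thesis by (simp add: S_def[abs_def])
    qed
    then show ?case unfolding eq using IH Y SY by simp
  qed simp
  from this[OF order_refl]
  show "integrable M (\<lambda>\<omega>. (step_integral B q \<xi> N t \<omega>)\<^sup>2)"
    "expectation (\<lambda>\<omega>. (step_integral B q \<xi> N t \<omega>)\<^sup>2) =
      (\<Sum>j<N. (q (Suc j) - q j) * expectation (\<lambda>\<omega>. (norm (\<xi> j \<omega>))\<^sup>2))"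
    unfolding It by auto
qed

lemma step_data_stopped:
  assumes sd: "step_data M F t q \<xi> N"
    and P: "\<And>j. j < N \<Longrightarrow> Measurable.pred (F (q j)) (P j)"
  shows "step_data M F t q (stopped_coeff P \<xi>) N"
proof -
  have "stopped_coeff P \<xi> j \<in> borel_measurable (F (q j)) \<and>
      (\<exists>C. \<forall>\<omega>\<in>space M. norm (stopped_coeff P \<xi> j \<omega>) \<le> C)" if j: "j < N" for j
  proof
    have [measurable]: "Measurable.pred (F (q j)) (P i)" if "i \<le> j" for i
      using measurable_F_mono[OF _ _ P[of i]] step_data_mono[OF sd that] step_data_bounds[OF sd, of i] that j
      by auto
    have "Measurable.pred (F (q j)) (\<lambda>\<omega>. \<exists>i\<in>{..j}. P i \<omega>)"
      by (intro pred_intros_finite) auto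
    then have [measurable]: "Measurable.pred (F (q j)) (\<lambda>\<omega>. \<exists>i\<le>j. P i \<omega>)" by (simp add: Bex_def)
    have [measurable]: "\<xi> j \<in> borel_measurable (F (q j))" using step_coeff(1)[OF sd j] by simp
    show "stopped_coeff P \<xi> j \<in> borel_measurable (F (q j))"
      unfolding stopped_coeff_def[abs_def] by measurable
    obtain C where "\<And>\<omega>. \<omega> \<in> space M \<Longrightarrow> norm (\<xi> j \<omega>) \<le> C" using step_coeff(2)[OF sd j] by blast
    then show "\<exists>C. \<forall>\<omega>\<in>space M. norm (stopped_coeff P \<xi> j \<omega>) \<le> C"
      by (intro exI[of _ "\<bar>C\<bar>"]) (force simp: stopped_coeff_def)
  qed
  with sd show ?thesis by (auto simp: step_data_def)
qed

text \<open>A single integrable \<open>Q\<close> dominates the squares \<open>y\<^sub>j\<^sup>2\<close> of all increments at once and has small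
  expectation on a fine grid: by the elementary inequality \<open>y\<^sup>2 \<le> \<delta> + y\<^sup>4 / \<delta>\<close> one may take
  \<open>Q = \<delta> + (\<Sum>j. y\<^sub>j\<^sup>4) / \<delta>\<close>, and the fourth moments sum to \<open>O(h)\<close>, where \<open>h\<close> bounds the mesh.\<close>

lemma step_increment_maximal:
  assumes sd: "step_data M F t q \<xi> N" and C: "\<And>j \<omega>. j < N \<Longrightarrow> \<omega> \<in> space M \<Longrightarrow> norm (\<xi> j \<omega>) \<le> C"
    and h: "\<And>j. j < N \<Longrightarrow> q (Suc j) - q j \<le> h" and \<delta>: "0 < \<delta>" and u: "0 \<le> u"
  shows "\<exists>Q. integrable M Q \<and> expectation Q \<le> \<delta> + 3 * (real CARD('d))\<^sup>2 * C ^ 4 * t * h / \<delta> \<and>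
    (\<forall>\<omega>. 0 \<le> Q \<omega> \<and> (\<forall>j<N. (\<xi> j \<omega> \<bullet> (B (min u (q (Suc j))) \<omega> - B (min u (q j)) \<omega>))\<^sup>2 \<le> Q \<omega>))"
proof (intro exI conjI allI impI)
  let ?K = "3 * (real CARD('d))\<^sup>2 * C ^ 4"
  define y where "y j \<omega> = \<xi> j \<omega> \<bullet> (B (min u (q (Suc j))) \<omega> - B (min u (q j)) \<omega>)" for j \<omega>
  let ?Q = "\<lambda>\<omega>. \<delta> + (\<Sum>j<N. (y j \<omega>) ^ 4) / \<delta>"
  have y: "integrable M (\<lambda>\<omega>. (y j \<omega>) ^ 4)"
    "expectation (\<lambda>\<omega>. (y j \<omega>) ^ 4) \<le> ?K * h * (q (Suc j) - q j)" if j: "j < N" for j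
  proof -
    obtain a b where *: "q j \<le> a" "a \<le> b" "b - a \<le> q (Suc j) - q j"
      "\<And>\<omega>. B (min u (q (Suc j))) \<omega> - B (min u (q j)) \<omega> = B b \<omega> - B a \<omega>"
      by (rule step_term[OF sd j u]) blast
    have a: "0 \<le> a" using *(1) step_data_bounds[OF sd, of j] j by simp
    note m = step_coeff(1)[OF sd j *(1)]
    show "integrable M (\<lambda>\<omega>. (y j \<omega>) ^ 4)"
      unfolding y_def *(4) by (rule integrable_inner_increment_power4[OF a *(2) m C[OF j]])
    have "expectation (\<lambda>\<omega>. (y j \<omega>) ^ 4) \<le> ?K * (b - a)\<^sup>2"
      unfolding y_def *(4) by (rule expectation_inner_increment_power4[OF a *(2) m C[OF j]])
    also have "(b - a)\<^sup>2 \<le> h * (q (Suc j) - q j)"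
      unfolding power2_eq_square using *(1-3) h[OF j] by (intro mult_mono) auto
    finally show "expectation (\<lambda>\<omega>. (y j \<omega>) ^ 4) \<le> ?K * h * (q (Suc j) - q j)"
      by (simp add: mult_left_mono mult.assoc)
  qed
  show "integrable M ?Q"
    by (intro Bochner_Integration.integrable_add Bochner_Integration.integrable_divide
        Bochner_Integration.integrable_sum) (simp_all add: y)
  have "expectation (\<lambda>\<omega>. \<Sum>j<N. (y j \<omega>) ^ 4) \<le> (\<Sum>j<N. ?K * h * (q (Suc j) - q j))"
    by (subst Bochner_Integration.integral_sum) (auto intro!: sum_mono y)
  also have "\<dots> = ?K * h * t"
    using sd by (simp add: sum_distrib_left[symmetric] sum_lessThan_telescope step_data_def)
  finally have "expectation (\<lambda>\<omega>. \<Sum>j<N. (y j \<omega>) ^ 4) / \<delta> \<le> ?K * h * t / \<delta>"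
    using \<delta> by (intro divide_right_mono) auto
  moreover have "expectation ?Q = \<delta> + expectation (\<lambda>\<omega>. \<Sum>j<N. (y j \<omega>) ^ 4) / \<delta>"
    by (subst Bochner_Integration.integral_add) (auto simp: prob_space intro!: y)
  ultimately show "expectation ?Q \<le> \<delta> + ?K * t * h / \<delta>" by (simp add: ac_simps)
  fix \<omega>
  have nn: "0 \<le> (\<Sum>j<N. (y j \<omega>) ^ 4)" by (intro sum_nonneg) simp
  then show "0 \<le> ?Q \<omega>" using \<delta> by simp
  fix j assume "j < N"
  have "(y j \<omega>)\<^sup>2 \<le> \<delta> + (y j \<omega>) ^ 4 / \<delta>"
  proof (cases "(y j \<omega>)\<^sup>2 \<le> \<delta>")
    case False
    then have "(y j \<omega>)\<^sup>2 * \<delta> \<le> (y j \<omega>)\<^sup>2 * (y j \<omega>)\<^sup>2" by (intro mult_left_mono) auto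
    also have "\<dots> = (y j \<omega>) ^ 4" by (simp flip: power_add)
    finally show ?thesis using \<delta> by (simp add: field_simps add_increasing)
  qed (use \<delta> in \<open>auto intro!: add_increasing2 divide_nonneg_pos\<close>)
  also have "\<dots> \<le> ?Q \<omega>"
    using \<delta> \<open>j < N\<close> by (intro add_left_mono divide_right_mono member_le_sum) auto
  finally show "(\<xi> j \<omega> \<bullet> (B (min u (q (Suc j))) \<omega> - B (min u (q j)) \<omega>))\<^sup>2 \<le> ?Q \<omega>"
    by (simp add: y_def)
qed

end

section \<open>The weak-type inequality for step processes\<close>

lemma first_index_eq_iff:
  assumes "j \<le> N"
  shows "first_index P N \<omega> = j \<longleftrightarrow> (P j \<omega> \<or> j = N) \<and> (\<forall>i<j. \<not> P i \<omega>)"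
proof
  assume "first_index P N \<omega> = j"
  then show "(P j \<omega> \<or> j = N) \<and> (\<forall>i<j. \<not> P i \<omega>)"
    using first_index_hit[of P N \<omega>] not_P_before_first_index[of _ P N \<omega>] by auto
next
  assume *: "(P j \<omega> \<or> j = N) \<and> (\<forall>i<j. \<not> P i \<omega>)"
  show "first_index P N \<omega> = j"
    unfolding first_index_def
  proof (rule Least_equality)
    show "P j \<omega> \<or> j = N" using * by simp
    fix i assume "P i \<omega> \<or> i = N"
    with * assms show "j \<le> i" by (metis le_less_linear)
  qed
qed

context usual_filtered_prob_space
begin

text \<open>This is Jensen's inequality for the absolute value on the event \<open>G\<close>: split \<open>G\<close> by the sign of \<open>X\<^sub>s\<close>
  and use the martingale property on each part.\<close>

lemma martingale_upto_set_integral_abs_le: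
  assumes X: "martingale_upto M F t X" and s: "0 \<le> s" "s \<le> t" and G: "G \<in> sets (F s)"
  shows "expectation (\<lambda>\<omega>. indicator G \<omega> * \<bar>X s \<omega>\<bar>) \<le> expectation (\<lambda>\<omega>. indicator G \<omega> * \<bar>X t \<omega>\<bar>)"
proof -
  define U where "U = {\<omega>\<in>space M. \<omega> \<in> G \<and> 0 \<le> X s \<omega>}"
  define V where "V = {\<omega>\<in>space M. \<omega> \<in> G \<and> X s \<omega> < 0}"
  have [measurable]: "X s \<in> borel_measurable (F s)" "G \<in> sets (F s)"
    using X s G by (auto simp: martingale_upto_def)
  have "{\<omega>\<in>space (F s). \<omega> \<in> G \<and> 0 \<le> X s \<omega>} \<in> sets (F s)" "{\<omega>\<in>space (F s). \<omega> \<in> G \<and> X s \<omega> < 0} \<in> sets (F s)"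
    by measurable
  then have UF: "U \<in> sets (F s)" and VF: "V \<in> sets (F s)" using s by (auto simp: U_def V_def space_F)
  have [measurable]: "U \<in> sets M" "V \<in> sets M" "G \<in> sets M" using UF VF G s sets_F_subset by auto
  have i: "integrable M (X s)" "integrable M (X t)" using X s by (auto simp: martingale_upto_def)
  have ind: "integrable M (\<lambda>\<omega>. indicat_real A \<omega> * X r \<omega>)"
    if "A \<in> sets M" "r = s \<or> r = t" for A r
    using integrable_mult_indicator[OF that(1), of "X r"] i that(2) by auto
  have eq: "expectation (\<lambda>\<omega>. indicat_real A \<omega> * X s \<omega>) = expectation (\<lambda>\<omega>. indicat_real A \<omega> * X t \<omega>)"
    if "A \<in> sets (F s)" for A
    using martingale_upto_set_integral[OF X s order_refl that] by (simp add: set_lebesgue_integral_def)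
  have G_space: "G \<subseteq> space M" using sets.sets_into_space[of G M] by simp
  have "expectation (\<lambda>\<omega>. indicator G \<omega> * \<bar>X s \<omega>\<bar>) =
      expectation (\<lambda>\<omega>. indicator U \<omega> * X s \<omega> - indicator V \<omega> * X s \<omega>)"
    using G_space by (intro Bochner_Integration.integral_cong) (auto simp: U_def V_def indicator_def)
  also have "\<dots> = expectation (\<lambda>\<omega>. indicator U \<omega> * X t \<omega> - indicator V \<omega> * X t \<omega>)"
    using UF VF by (simp add: ind eq)
  also have "\<dots> \<le> expectation (\<lambda>\<omega>. indicator G \<omega> * \<bar>X t \<omega>\<bar>)"
  proof (rule integral_mono)
    show "integrable M (\<lambda>\<omega>. indicator U \<omega> * X t \<omega> - indicator V \<omega> * X t \<omega>)" by (simp add: ind)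
    show "integrable M (\<lambda>\<omega>. indicat_real G \<omega> * \<bar>X t \<omega>\<bar>)"
      using integrable_mult_indicator[of G M "\<lambda>\<omega>. \<bar>X t \<omega>\<bar>"] i by simp
    show "indicator U \<omega> * X t \<omega> - indicator V \<omega> * X t \<omega> \<le> indicator G \<omega> * \<bar>X t \<omega>\<bar>" for \<omega>
      by (auto simp: U_def V_def indicator_def)
  qed
  finally show ?thesis .
qed

text \<open>Optional stopping for \<open>|X|\<close> on a finite grid: decompose according to the value of the stopping
  index and compare \<open>X\<close> at that index with \<open>X\<^sub>t\<close> on each piece.\<close>

lemma
  assumes X: "martingale_upto M F t X" and sd: "step_data M F t q \<xi> N"
    and P: "\<And>j. j < N \<Longrightarrow> Measurable.pred (F (q j)) (P j)"
  shows integrable_martingale_first_index: "integrable M (\<lambda>\<omega>. \<bar>X (q (first_index P N \<omega>)) \<omega>\<bar>)"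
    and martingale_first_index_abs_le:
      "expectation (\<lambda>\<omega>. \<bar>X (q (first_index P N \<omega>)) \<omega>\<bar>) \<le> expectation (\<lambda>\<omega>. \<bar>X t \<omega>\<bar>)"
proof -
  let ?T = "first_index P N"
  define G where "G j = {\<omega>\<in>space M. ?T \<omega> = j}" for j
  have q: "0 \<le> q j" "q j \<le> t" if "j \<le> N" for j using step_data_bounds[OF sd that] .
  have GF: "G j \<in> sets (F (q j))" if j: "j \<le> N" for j
  proof -
    have m: "Measurable.pred (F (q j)) (P i)" if "i \<le> j" "i < N" for i
      using measurable_F_mono[OF _ _ P[of i]] step_data_mono[OF sd that(1)] q that j by auto
    have "Measurable.pred (F (q j)) (\<lambda>\<omega>. P j \<omega> \<or> j = N)"
      using m[of j] j by (cases "j = N") auto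
    moreover have "Measurable.pred (F (q j)) (\<lambda>\<omega>. \<forall>i\<in>{..<j}. \<not> P i \<omega>)"
      using m j by (intro pred_intros_finite pred_intros_logic) auto
    ultimately have "Measurable.pred (F (q j)) (\<lambda>\<omega>. (P j \<omega> \<or> j = N) \<and> (\<forall>i\<in>{..<j}. \<not> P i \<omega>))"
      by (rule pred_intros_logic)
    then have "{\<omega>\<in>space (F (q j)). (P j \<omega> \<or> j = N) \<and> (\<forall>i\<in>{..<j}. \<not> P i \<omega>)} \<in> sets (F (q j))"
      by (simp add: pred_def)
    then show ?thesis using q j by (simp add: G_def space_F first_index_eq_iff Ball_def)
  qed
  have GM: "G j \<in> sets M" if "j \<le> N" for j using GF that q sets_F_subset by blast
  have i: "integrable M (X (q j))" "integrable M (X t)" if "j \<le> N" for j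
    using X q[OF that] q[OF order_refl] by (auto simp: martingale_upto_def)
  have ind: "integrable M (\<lambda>\<omega>. indicat_real (G j) \<omega> * \<bar>X r \<omega>\<bar>)"
    if "j \<le> N" "r = q j \<or> r = t" for j r
    using integrable_mult_indicator[OF GM[OF that(1)], of "\<lambda>\<omega>. \<bar>X r \<omega>\<bar>"] i that by auto
  have eq: "\<bar>X (h (?T \<omega>)) \<omega>\<bar> = (\<Sum>j\<le>N. indicat_real (G j) \<omega> * \<bar>X (h j) \<omega>\<bar>)"
    if "\<omega> \<in> space M" for \<omega> h
  proof -
    have "(\<Sum>j\<le>N. indicat_real (G j) \<omega> * \<bar>X (h j) \<omega>\<bar>) = (\<Sum>j\<le>N. if j = ?T \<omega> then \<bar>X (h j) \<omega>\<bar> else 0)"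
      using that by (intro sum.cong) (auto simp: G_def)
    then show ?thesis using first_index_le[of P N \<omega>] by simp
  qed
  have int: "integrable M (\<lambda>\<omega>. \<Sum>j\<le>N. indicat_real (G j) \<omega> * \<bar>X (q j) \<omega>\<bar>)"
    using ind by (intro Bochner_Integration.integrable_sum) auto
  moreover have "integrable M (\<lambda>\<omega>. \<bar>X (q (?T \<omega>)) \<omega>\<bar>) =
      integrable M (\<lambda>\<omega>. \<Sum>j\<le>N. indicat_real (G j) \<omega> * \<bar>X (q j) \<omega>\<bar>)"
    by (intro Bochner_Integration.integrable_cong refl eq)
  ultimately show "integrable M (\<lambda>\<omega>. \<bar>X (q (?T \<omega>)) \<omega>\<bar>)" by simp
  have "expectation (\<lambda>\<omega>. \<bar>X (q (?T \<omega>)) \<omega>\<bar>) = expectation (\<lambda>\<omega>. \<Sum>j\<le>N. indicat_real (G j) \<omega> * \<bar>X (q j) \<omega>\<bar>)"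
    by (intro Bochner_Integration.integral_cong refl eq)
  also have "\<dots> = (\<Sum>j\<le>N. expectation (\<lambda>\<omega>. indicat_real (G j) \<omega> * \<bar>X (q j) \<omega>\<bar>))"
    using ind by (intro Bochner_Integration.integral_sum) auto
  also have "\<dots> \<le> (\<Sum>j\<le>N. expectation (\<lambda>\<omega>. indicat_real (G j) \<omega> * \<bar>X t \<omega>\<bar>))"
    using q GF by (intro sum_mono martingale_upto_set_integral_abs_le[OF X]) auto
  also have "\<dots> = expectation (\<lambda>\<omega>. \<Sum>j\<le>N. indicat_real (G j) \<omega> * \<bar>X t \<omega>\<bar>)"
    using ind by (intro Bochner_Integration.integral_sum[symmetric]) auto
  also have "\<dots> = expectation (\<lambda>\<omega>. \<bar>X t \<omega>\<bar>)"
    by (intro Bochner_Integration.integral_cong refl eq[of _ "\<lambda>_. t", symmetric])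
  finally show "expectation (\<lambda>\<omega>. \<bar>X (q (?T \<omega>)) \<omega>\<bar>) \<le> expectation (\<lambda>\<omega>. \<bar>X t \<omega>\<bar>)" .
qed

end

text \<open>The intervals of the grid are disjoint, so the squared norm of the step process is the step process
  of the squared norms.\<close>

lemma nn_integral_step_norm_sq:
  assumes sd: "step_data M F t q \<xi> N"
  shows "(\<integral>\<^sup>+s\<in>{0..t}. ennreal ((norm (\<Sum>j<N. indicat_real {q j<..q (Suc j)} s *\<^sub>R \<xi> j \<omega>))\<^sup>2) \<partial>lborel) =
    ennreal (\<Sum>j<N. (q (Suc j) - q j) * (norm (\<xi> j \<omega>))\<^sup>2)"
proof -
  have eq: "(norm (\<Sum>j<N. indicat_real {q j<..q (Suc j)} s *\<^sub>R \<xi> j \<omega>))\<^sup>2 =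
      (\<Sum>j<N. (norm (\<xi> j \<omega>))\<^sup>2 * indicat_real {q j<..q (Suc j)} s)" for s
  proof (cases "\<exists>j<N. s \<in> {q j<..q (Suc j)}")
    case True
    then obtain j where j: "j < N" "s \<in> {q j<..q (Suc j)}" by blast
    have u: "indicat_real {q i<..q (Suc i)} s = (if i = j then 1 else 0)" if i: "i < N" for i
    proof (cases i j rule: linorder_cases)
      case less
      then have "q (Suc i) \<le> q j" using j by (intro step_data_mono[OF sd]) auto
      with less j show ?thesis by auto
    next
      case greater
      then have "q (Suc j) \<le> q i" using i by (intro step_data_mono[OF sd]) auto
      with greater j show ?thesis by auto
    qed (use j in auto)
    have "(\<Sum>i<N. indicat_real {q i<..q (Suc i)} s *\<^sub>R \<xi> i \<omega>) = (\<Sum>i<N. if i = j then \<xi> i \<omega> else 0)"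
      using u by (intro sum.cong) auto
    moreover have "(\<Sum>i<N. (norm (\<xi> i \<omega>))\<^sup>2 * indicat_real {q i<..q (Suc i)} s) =
        (\<Sum>i<N. if i = j then (norm (\<xi> i \<omega>))\<^sup>2 else 0)"
      using u by (intro sum.cong) auto
    ultimately show ?thesis using j by simp
  next
    case False
    then have "indicat_real {q j<..q (Suc j)} s = 0" if "j < N" for j using that by auto
    then show ?thesis by simp
  qed
  have ind: "indicat_real {q j<..q (Suc j)} s * indicat_real {0..t} s = indicat_real {q j<..q (Suc j)} s"
    if "j < N" for j s
    using step_data_bounds[OF sd, of j] step_data_bounds[OF sd, of "Suc j"] that by (auto simp: indicator_def)
  have "(\<integral>\<^sup>+s\<in>{0..t}. ennreal ((norm (\<Sum>j<N. indicat_real {q j<..q (Suc j)} s *\<^sub>R \<xi> j \<omega>))\<^sup>2) \<partial>lborel) =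
      (\<integral>\<^sup>+s. (\<Sum>j<N. ennreal ((norm (\<xi> j \<omega>))\<^sup>2) * indicator {q j<..q (Suc j)} s) \<partial>lborel)"
  proof (intro nn_integral_cong)
    fix s
    have "ennreal ((norm (\<Sum>j<N. indicat_real {q j<..q (Suc j)} s *\<^sub>R \<xi> j \<omega>))\<^sup>2) * indicator {0..t} s =
        ennreal ((\<Sum>j<N. (norm (\<xi> j \<omega>))\<^sup>2 * indicat_real {q j<..q (Suc j)} s) * indicat_real {0..t} s)"
      unfolding eq by (subst ennreal_mult) (auto intro!: sum_nonneg simp: ennreal_indicator)
    also have "\<dots> = ennreal (\<Sum>j<N. (norm (\<xi> j \<omega>))\<^sup>2 * indicat_real {q j<..q (Suc j)} s)"
      unfolding sum_distrib_right using ind by (intro arg_cong[where f = ennreal] sum.cong refl) (simp only: mult.assoc lessThan_iff)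
    also have "\<dots> = (\<Sum>j<N. ennreal ((norm (\<xi> j \<omega>))\<^sup>2) * indicator {q j<..q (Suc j)} s)"
      by (subst sum_ennreal[symmetric]) (auto simp: ennreal_mult ennreal_indicator)
    finally show "ennreal ((norm (\<Sum>j<N. indicat_real {q j<..q (Suc j)} s *\<^sub>R \<xi> j \<omega>))\<^sup>2) * indicator {0..t} s =
        (\<Sum>j<N. ennreal ((norm (\<xi> j \<omega>))\<^sup>2) * indicator {q j<..q (Suc j)} s)" .
  qed
  also have "\<dots> = (\<Sum>j<N. ennreal ((norm (\<xi> j \<omega>))\<^sup>2) * ennreal (q (Suc j) - q j))"
  proof (subst nn_integral_sum)
    show "(\<Sum>j<N. \<integral>\<^sup>+s. ennreal ((norm (\<xi> j \<omega>))\<^sup>2) * indicator {q j<..q (Suc j)} s \<partial>lborel) =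
      (\<Sum>j<N. ennreal ((norm (\<xi> j \<omega>))\<^sup>2) * ennreal (q (Suc j) - q j))"
      using step_data_mono[OF sd] by (intro sum.cong refl) (simp add: nn_integral_cmult)
  qed simp
  also have "\<dots> = ennreal (\<Sum>j<N. (q (Suc j) - q j) * (norm (\<xi> j \<omega>))\<^sup>2)"
    using step_data_mono[OF sd] by (subst sum_ennreal[symmetric]) (auto simp: ennreal_mult mult.commute)
  finally show ?thesis .
qed

context brownian_filtration
begin

text \<open>Every interval of the given partition is cut into \<open>m\<close> equal parts, and the coefficients are repeated.
  This changes neither the process nor its integral, but for large \<open>m\<close> it makes the mesh and the
  increments small. The grid point with index \<open>i * m + l\<close>, where \<open>l \<le> m\<close>, lies at the fraction
  \<open>l / m\<close> of the \<open>i\<close>-th interval.\<close>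

lemma simple_integral_fine_step:
  assumes si: "simple_integral M F B t \<phi> I" and \<epsilon>: "0 < \<epsilon>"
  obtains q \<xi> N where "step_data M F t q \<xi> N" "\<And>j. j < N \<Longrightarrow> q (Suc j) - q j \<le> \<epsilon>"
    "I = step_integral B q \<xi> N"
    "\<phi> = (\<lambda>s \<omega>. \<Sum>j<N. indicator {q j<..q (Suc j)} s *\<^sub>R \<xi> j \<omega>)"
    "\<And>u. 0 \<le> u \<Longrightarrow> \<exists>Q. integrable M Q \<and> expectation Q \<le> \<epsilon> \<and>
      (\<forall>\<omega>. 0 \<le> Q \<omega> \<and> (\<forall>j<N. (\<xi> j \<omega> \<bullet> (B (min u (q (Suc j))) \<omega> - B (min u (q j)) \<omega>))\<^sup>2 \<le> Q \<omega>))"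
proof -
  from si obtain n p and \<eta> :: "nat \<Rightarrow> 'w \<Rightarrow> real ^ 'd" where
    p: "p 0 = 0" "p n = t" "\<And>i. i < n \<Longrightarrow> p i < p (Suc i)"
    and \<eta>: "\<And>i. i < n \<Longrightarrow> \<eta> i \<in> borel_measurable (F (p i))"
      "\<And>i. i < n \<Longrightarrow> \<exists>C. \<forall>\<omega>\<in>space M. norm (\<eta> i \<omega>) \<le> C"
    and \<phi>: "\<phi> = (\<lambda>s \<omega>. \<Sum>i<n. indicator {p i<..p (Suc i)} s *\<^sub>R \<eta> i \<omega>)"
    and I: "I = (\<lambda>r \<omega>. \<Sum>i<n. \<eta> i \<omega> \<bullet> (B (min r (p (Suc i))) \<omega> - B (min r (p i)) \<omega>))"
    unfolding simple_integral_def by blast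
  have sd0: "step_data M F t p \<eta> n" using p \<eta> by (auto simp: step_data_def)
  have t0: "0 \<le> t" using step_data_bounds[OF sd0, of n] p by simp
  from \<eta>(2) obtain c where c: "\<And>i \<omega>. i < n \<Longrightarrow> \<omega> \<in> space M \<Longrightarrow> norm (\<eta> i \<omega>) \<le> c i" by metis
  \<comment> \<open>The sum serves as a common bound for the finitely many coefficients.\<close>
  define C where "C = (\<Sum>i<n. \<bar>c i\<bar>)"
  have C: "norm (\<eta> i \<omega>) \<le> C" if "i < n" "\<omega> \<in> space M" for i \<omega>
  proof -
    have "norm (\<eta> i \<omega>) \<le> \<bar>c i\<bar>" using c[OF that] by simp
    also have "\<dots> \<le> C" unfolding C_def using that by (intro member_le_sum) auto
    finally show ?thesis .
  qed
  \<comment> \<open>With mesh \<open>t / m\<close> and \<open>\<delta> = \<epsilon> / 2\<close>, the bound in \<open>step_increment_maximal\<close> is \<open>\<epsilon> / 2 + K * (t / m)\<close>.\<close>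
  define K where "K = 3 * (real CARD('d))\<^sup>2 * C ^ 4 * t / (\<epsilon> / 2)"
  have K0: "0 \<le> K" using t0 \<epsilon> by (simp add: K_def)
  obtain m0 :: nat where m0: "t / \<epsilon> + K * t / (\<epsilon> / 2) < real m0" using reals_Archimedean2 by blast
  define m where "m = Suc m0"
  have m: "0 < m" "t / real m \<le> \<epsilon>" "K * (t / real m) \<le> \<epsilon> / 2"
  proof -
    have *: "0 \<le> t / \<epsilon>" "0 \<le> K * t / (\<epsilon> / 2)" using t0 K0 \<epsilon> by auto
    show "0 < m" by (simp add: m_def)
    have "t / \<epsilon> \<le> real m" "K * t / (\<epsilon> / 2) \<le> real m" using * m0 by (auto simp: m_def)
    then show "t / real m \<le> \<epsilon>" "K * (t / real m) \<le> \<epsilon> / 2"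
      using \<epsilon> by (auto simp: m_def field_simps)
  qed
  define q where "q j = p (j div m) + real (j mod m) / real m * (p (Suc (j div m)) - p (j div m))" for j
  define \<xi> where "\<xi> j = \<eta> (j div m)" for j
  define N where "N = n * m"
  have q_block: "q (i * m + l) = p i + real l / real m * (p (Suc i) - p i)" if "l \<le> m" for i l
  proof (cases "l = m")
    case True
    then have "i * m + l = Suc i * m" by simp
    then show ?thesis using m True by (simp only: q_def) simp
  next
    case False
    with that have "l < m" by simp
    then show ?thesis by (simp add: q_def)
  qed
  have blocks: "\<exists>i l. j = i * m + l \<and> i < n \<and> l < m" if "j < N" for j
    using that m by (intro exI[of _ "j div m"] exI[of _ "j mod m"])
      (auto simp: N_def less_mult_imp_div_less)
  have sum_blocks: "(\<Sum>j<N. g j) = (\<Sum>i<n. \<Sum>l<m. g (i * m + l))" for g :: "nat \<Rightarrow> 'e::comm_monoid_add"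
  proof -
    have "(\<Sum>j<N. g j) = (\<Sum>i<n. sum g {i * m..<i * m + m})" unfolding N_def by (rule sum.nat_group[symmetric])
    also have "\<dots> = (\<Sum>i<n. \<Sum>l<m. g (i * m + l))"
    proof (rule sum.cong[OF refl])
      fix i
      show "sum g {i * m..<i * m + m} = (\<Sum>l<m. g (i * m + l))"
        by (rule sum.reindex_bij_witness[of _ "\<lambda>l. i * m + l" "\<lambda>l. l - i * m"]) auto
    qed
    finally show ?thesis .
  qed
  have telescope: "(\<Sum>l<m. H (q (Suc (i * m + l))) - H (q (i * m + l))) = H (p (Suc i)) - H (p i)"
    for H :: "real \<Rightarrow> 'e::ab_group_add" and i
  proof -
    have "(\<Sum>l<m. H (q (i * m + Suc l)) - H (q (i * m + l))) = H (q (i * m + m)) - H (q (i * m + 0))"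
      by (rule sum_lessThan_telescope)
    then show ?thesis using q_block[of m i] q_block[of 0 i] m by simp
  qed
  have \<xi>_block: "\<xi> (i * m + l) = \<eta> i" if "l < m" for i l using that by (simp add: \<xi>_def)
  have q_diff: "q (Suc (i * m + l)) - q (i * m + l) = (p (Suc i) - p i) / real m" if "l < m" for i l
    using q_block[of l i] q_block[of "Suc l" i] that m by (simp add: field_simps)
  have sd: "step_data M F t q \<xi> N"
    unfolding step_data_def
  proof (intro conjI allI impI)
    show "q 0 = 0" using q_block[of 0 0] p by simp
    show "q N = t" using q_block[of 0 n] p by (simp add: N_def)
    fix j assume j: "j < N"
    then obtain i l where il: "j = i * m + l" "i < n" "l < m" using blocks[OF j] by blast
    have "q (Suc j) - q j > 0" unfolding il(1) q_diff[OF il(3)] using p(3)[OF il(2)] m by simp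
    then show "q j < q (Suc j)" by simp
    have "p i \<le> q j" unfolding il(1) using q_block[of l i] il p(3)[OF il(2)] by simp
    moreover have "0 \<le> p i" using step_data_bounds[OF sd0, of i] il by simp
    ultimately show "\<xi> j \<in> borel_measurable (F (q j))"
      using measurable_F_mono[OF _ _ \<eta>(1)[OF il(2)]] \<xi>_block[OF il(3)] il(1) by simp
    show "\<exists>C. \<forall>\<omega>\<in>space M. norm (\<xi> j \<omega>) \<le> C"
      using \<eta>(2)[OF il(2)] \<xi>_block[OF il(3)] il(1) by simp
  qed
  have h: "q (Suc j) - q j \<le> t / real m" if "j < N" for j
  proof -
    obtain i l where il: "j = i * m + l" "i < n" "l < m" using blocks[OF \<open>j < N\<close>] by blast
    have "p (Suc i) - p i \<le> t"
      using step_data_bounds[OF sd0, of i] step_data_bounds[OF sd0, of "Suc i"] il by simp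
    then show ?thesis unfolding il(1) q_diff[OF il(3)] using m by (intro divide_right_mono) auto
  qed
  show thesis
  proof (rule that[OF sd])
    show "q (Suc j) - q j \<le> \<epsilon>" if "j < N" for j using h[OF that] m by linarith
    show "I = step_integral B q \<xi> N"
    proof (intro ext)
      fix r \<omega>
      have "step_integral B q \<xi> N r \<omega> =
          (\<Sum>i<n. \<Sum>l<m. \<eta> i \<omega> \<bullet> (B (min r (q (Suc (i * m + l)))) \<omega> - B (min r (q (i * m + l))) \<omega>))"
        unfolding step_integral_def sum_blocks by (intro sum.cong refl) (simp add: \<xi>_block)
      also have "\<dots> = I r \<omega>"
        unfolding I inner_sum_right[symmetric] telescope[of "\<lambda>x. B (min r x) \<omega>"] ..
      finally show "I r \<omega> = step_integral B q \<xi> N r \<omega>" ..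
    qed
    show "\<phi> = (\<lambda>s \<omega>. \<Sum>j<N. indicator {q j<..q (Suc j)} s *\<^sub>R \<xi> j \<omega>)"
    proof (intro ext)
      fix s :: real and \<omega>
      have ind: "indicat_real {a<..b} s = indicat_real {..b} s - indicat_real {..a} s" if "a \<le> b" for a b
        using that by (auto simp: indicator_def)
      have "(\<Sum>j<N. indicat_real {q j<..q (Suc j)} s *\<^sub>R \<xi> j \<omega>) =
          (\<Sum>j<N. (indicat_real {..q (Suc j)} s - indicat_real {..q j} s) *\<^sub>R \<xi> j \<omega>)"
        using step_data_mono[OF sd] by (intro sum.cong refl) (simp add: ind)
      also have "\<dots> = (\<Sum>i<n. \<Sum>l<m. (indicat_real {..q (Suc (i * m + l))} s - indicat_real {..q (i * m + l)} s) *\<^sub>R \<eta> i \<omega>)"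
        unfolding sum_blocks by (intro sum.cong refl) (simp add: \<xi>_block)
      also have "\<dots> = (\<Sum>i<n. (indicat_real {..p (Suc i)} s - indicat_real {..p i} s) *\<^sub>R \<eta> i \<omega>)"
        unfolding scaleR_sum_left[symmetric] telescope[of "\<lambda>x. indicat_real {..x} s"] ..
      also have "\<dots> = \<phi> s \<omega>"
        unfolding \<phi> using step_data_mono[OF sd0] by (intro sum.cong refl) (simp add: ind)
      finally show "\<phi> s \<omega> = (\<Sum>j<N. indicator {q j<..q (Suc j)} s *\<^sub>R \<xi> j \<omega>)" ..
    qed
    fix u :: real assume u: "0 \<le> u"
    have C': "norm (\<xi> j \<omega>) \<le> C" if "j < N" "\<omega> \<in> space M" for j \<omega>
      using blocks[OF that(1)] \<xi>_block C that(2) by metis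
    have "\<epsilon> / 2 + 3 * (real CARD('d))\<^sup>2 * C ^ 4 * t * (t / real m) / (\<epsilon> / 2) \<le> \<epsilon>"
    proof -
      have eq: "3 * (real CARD('d))\<^sup>2 * C ^ 4 * t * (t / real m) / (\<epsilon> / 2) = K * (t / real m)"
        by (simp add: K_def mult_ac)
      show ?thesis unfolding eq using m(3) by linarith
    qed
    note le = this
    have "0 < \<epsilon> / 2" using \<epsilon> by simp
    from step_increment_maximal[OF sd C' h this u]
    obtain Q where Q: "integrable M Q"
        "expectation Q \<le> \<epsilon> / 2 + 3 * (real CARD('d))\<^sup>2 * C ^ 4 * t * (t / real m) / (\<epsilon> / 2)"
        "\<forall>\<omega>. 0 \<le> Q \<omega> \<and> (\<forall>j<N. (\<xi> j \<omega> \<bullet> (B (min u (q (Suc j))) \<omega> - B (min u (q j)) \<omega>))\<^sup>2 \<le> Q \<omega>)"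
      by blast
    from order_trans[OF Q(2) le] Q(1,3)
    show "\<exists>Q. integrable M Q \<and> expectation Q \<le> \<epsilon> \<and>
      (\<forall>\<omega>. 0 \<le> Q \<omega> \<and> (\<forall>j<N. (\<xi> j \<omega> \<bullet> (B (min u (q (Suc j))) \<omega> - B (min u (q j)) \<omega>))\<^sup>2 \<le> Q \<omega>))"
      by blast
  qed
qed

text \<open>The weak-type bound for a step integral that stays within distance \<open>1\<close> of the martingale \<open>X\<close> outside
  an event \<open>D\<close>. Let \<open>J\<close> be the terminal value of the integral, stopped when its absolute value first
  exceeds \<open>\<mu>\<close> on the grid, and let \<open>V\<close> be the energy of the stopped step process. By the isometry
  \<open>E V = E J\<^sup>2\<close>, and the energy of the original process can exceed \<open>\<mu>\<^sup>2\<close> only if \<open>J\<^sup>2 > \<mu>\<^sup>2\<close> (the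
  integral was stopped early) or \<open>V > \<mu>\<^sup>2\<close> (it was not). It remains to see that \<open>E J\<^sup>2\<close> is of order
  \<open>\<mu>\<close>, for which \<open>J\<^sup>2\<close> is compared with \<open>\<mu>\<close> times the martingale \<open>|X|\<close> at the stopping index.\<close>

lemma step_weak_type:
  assumes X: "martingale_upto M F t X" and sd: "step_data M F t q \<xi> N" and \<mu>: "1 \<le> \<mu>"
    and Q: "integrable M Q" "expectation Q \<le> 1"
      "\<And>\<omega>. 0 \<le> Q \<omega> \<and> (\<forall>j<N. (\<xi> j \<omega> \<bullet> (B (min t (q (Suc j))) \<omega> - B (min t (q j)) \<omega>))\<^sup>2 \<le> Q \<omega>)"
    and D: "D \<in> events"
      "\<And>\<omega> r. \<omega> \<in> space M - D \<Longrightarrow> r \<in> {0..t} \<Longrightarrow> \<bar>step_integral B q \<xi> N r \<omega> - X r \<omega>\<bar> \<le> 1"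
  shows "prob {\<omega>\<in>space M. (\<Sum>j<N. (q (Suc j) - q j) * (norm (\<xi> j \<omega>))\<^sup>2) > \<mu>\<^sup>2} \<le>
    (4 * expectation (\<lambda>\<omega>. \<bar>X t \<omega>\<bar>) + 8) / \<mu> + 4 * prob D"
proof -
  let ?I = "step_integral B q \<xi> N"
  define P where "P j \<omega> \<longleftrightarrow> \<mu> < \<bar>?I (q j) \<omega>\<bar>" for j \<omega>
  let ?\<xi> = "stopped_coeff P \<xi>"
  let ?T = "first_index P N"
  define J where "J = step_integral B q ?\<xi> N t"
  define V where "V \<omega> = (\<Sum>j<N. (q (Suc j) - q j) * (norm (?\<xi> j \<omega>))\<^sup>2)" for \<omega>
  have tq: "t = q N" using sd by (simp add: step_data_def)
  have t0: "0 \<le> t" using step_data_bounds[OF sd, of N] tq by simp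
  have P [measurable]: "Measurable.pred (F (q j)) (P j)" if "j < N" for j
  proof -
    have [measurable]: "?I (q j) \<in> borel_measurable (F (q j))"
      using step_data_bounds[OF sd, of j] that by (intro step_integral_adapted[OF sd]) auto
    show ?thesis unfolding P_def by measurable
  qed
  note sd' = step_data_stopped[OF sd P]
  have J_eq: "J \<omega> = ?I (q (?T \<omega>)) \<omega>" for \<omega>
  proof -
    have "q (?T \<omega>) \<le> t" by (rule step_data_bounds(2)[OF sd first_index_le])
    then show ?thesis unfolding J_def stopped_step_integral[OF sd] by simp
  qed
  have J_le: "\<bar>J \<omega>\<bar> \<le> \<mu> + sqrt (Q \<omega>)" for \<omega>
    unfolding J_def using \<mu> Q(3)[of \<omega>]
    by (intro stopped_step_integral_le[OF sd]) (auto simp: P_def)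
  have J2: "integrable M (\<lambda>\<omega>. (J \<omega>)\<^sup>2)" "expectation (\<lambda>\<omega>. (J \<omega>)\<^sup>2) =
      (\<Sum>j<N. (q (Suc j) - q j) * expectation (\<lambda>\<omega>. (norm (?\<xi> j \<omega>))\<^sup>2))"
    unfolding J_def by (rule integrable_step_integral_sq[OF sd'] expectation_step_integral_sq[OF sd'], assumption)+
  have \<xi>i: "integrable M (\<lambda>\<omega>. (norm (?\<xi> j \<omega>))\<^sup>2)" if j: "j < N" for j
  proof -
    obtain C where "\<And>\<omega>. \<omega> \<in> space M \<Longrightarrow> norm (?\<xi> j \<omega>) \<le> C" using step_coeff(2)[OF sd' j] by blast
    moreover have "?\<xi> j \<in> borel_measurable M"
      using step_coeff(1)[OF sd' j order_refl] step_data_bounds[OF sd, of j] j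
      by (auto intro: measurable_F_imp_M)
    ultimately show ?thesis by (intro bounded_vec_integrable)
  qed
  have V: "integrable M V" "expectation V = expectation (\<lambda>\<omega>. (J \<omega>)\<^sup>2)"
    unfolding V_def J2(2) using \<xi>i by (auto simp: Bochner_Integration.integral_sum)
  note X_T = integrable_martingale_first_index[OF X sd P] martingale_first_index_abs_le[OF X sd P]
  \<comment> \<open>With \<open>m = min |J| \<mu>\<close> one has \<open>J\<^sup>2 \<le> 2 m\<^sup>2 + 2 Q\<close> and \<open>m\<^sup>2 \<le> \<mu> m\<close>, and \<open>m\<close> is at most
    \<open>|X| + 1\<close> at the stopping index off \<open>D\<close>, and at most \<open>\<mu>\<close> on \<open>D\<close>.\<close>
  define R where "R \<omega> = 2 * \<mu> * (\<bar>X (q (?T \<omega>)) \<omega>\<bar> + 1 + \<mu> * indicator D \<omega>) + 2 * Q \<omega>" for \<omega>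
  have J2_le: "(J \<omega>)\<^sup>2 \<le> R \<omega>" if \<omega>: "\<omega> \<in> space M" for \<omega>
  proof -
    let ?m = "min \<bar>J \<omega>\<bar> \<mu>"
    have m0: "0 \<le> ?m" using \<mu> by simp
    have "(J \<omega>)\<^sup>2 \<le> (?m + sqrt (Q \<omega>))\<^sup>2"
    proof (rule abs_le_square_iff[THEN iffD1])
      have "0 \<le> sqrt (Q \<omega>)" using Q(3)[of \<omega>] by simp
      then show "\<bar>J \<omega>\<bar> \<le> \<bar>?m + sqrt (Q \<omega>)\<bar>" using J_le[of \<omega>] m0 by linarith
    qed
    also have "\<dots> \<le> 2 * ?m\<^sup>2 + 2 * Q \<omega>"
      using Q(3)[of \<omega>] sum_squares_bound[of ?m "sqrt (Q \<omega>)"] by (simp add: power2_sum)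
    also have "?m\<^sup>2 \<le> \<mu> * ?m" unfolding power2_eq_square using m0 by (intro mult_right_mono) auto
    also have "?m \<le> \<bar>X (q (?T \<omega>)) \<omega>\<bar> + 1 + \<mu> * indicator D \<omega>"
    proof (cases "\<omega> \<in> D")
      case True
      then show ?thesis by simp
    next
      case False
      have "q (?T \<omega>) \<in> {0..t}" using step_data_bounds[OF sd first_index_le[of P N \<omega>]] by simp
      with D(2)[of \<omega> "q (?T \<omega>)"] False \<omega> have "\<bar>J \<omega> - X (q (?T \<omega>)) \<omega>\<bar> \<le> 1" by (simp add: J_eq)
      with False show ?thesis by simp
    qed
    finally show ?thesis using \<mu> by (simp add: R_def mult.assoc)
  qed
  have R: "integrable M R" unfolding R_def
    by (intro Bochner_Integration.integrable_add integrable_mult_right integrable_const X_T Q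
        integrable_real_indicator D) (simp_all add: emeasure_eq_measure)
  have "expectation R = 2 * \<mu> * (expectation (\<lambda>\<omega>. \<bar>X (q (?T \<omega>)) \<omega>\<bar>) + 1 + \<mu> * prob D) + 2 * expectation Q"
  proof -
    have "integrable M (indicat_real D)" using D(1) by (simp add: emeasure_eq_measure)
    then show ?thesis
      unfolding R_def using X_T(1) Q(1) D(1)
      by (subst Bochner_Integration.integral_add) (simp_all add: prob_space)
  qed
  also have "\<dots> \<le> 2 * \<mu> * (expectation (\<lambda>\<omega>. \<bar>X t \<omega>\<bar>) + 1 + \<mu> * prob D) + 2"
    using X_T(2) Q(2) \<mu> by (intro add_mono mult_left_mono) auto
  finally have ER: "expectation R \<le> 2 * \<mu> * (expectation (\<lambda>\<omega>. \<bar>X t \<omega>\<bar>) + 1 + \<mu> * prob D) + 2" .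
  have "expectation (\<lambda>\<omega>. (J \<omega>)\<^sup>2) \<le> expectation R"
    by (rule integral_mono[OF J2(1) R J2_le])
  with ER have EJ: "expectation (\<lambda>\<omega>. (J \<omega>)\<^sup>2) \<le> 2 * \<mu> * (expectation (\<lambda>\<omega>. \<bar>X t \<omega>\<bar>) + 1 + \<mu> * prob D) + 2"
    by simp
  have int: "integrable M (\<lambda>\<omega>. (J \<omega>)\<^sup>2 + V \<omega>)" using J2(1) V(1) by simp
  have V0: "0 \<le> V \<omega>" for \<omega>
    unfolding V_def using step_data_mono[OF sd] by (intro sum_nonneg mult_nonneg_nonneg) auto
  have "prob {\<omega>\<in>space M. (\<Sum>j<N. (q (Suc j) - q j) * (norm (\<xi> j \<omega>))\<^sup>2) > \<mu>\<^sup>2} \<le>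
      prob {\<omega>\<in>space M. \<mu>\<^sup>2 \<le> (J \<omega>)\<^sup>2 + V \<omega>}"
  proof (rule finite_measure_mono)
    show "{\<omega>\<in>space M. \<mu>\<^sup>2 \<le> (J \<omega>)\<^sup>2 + V \<omega>} \<in> events"
      using int by measurable
    show "{\<omega>\<in>space M. (\<Sum>j<N. (q (Suc j) - q j) * (norm (\<xi> j \<omega>))\<^sup>2) > \<mu>\<^sup>2} \<subseteq> {\<omega>\<in>space M. \<mu>\<^sup>2 \<le> (J \<omega>)\<^sup>2 + V \<omega>}"
    proof clarsimp
      fix \<omega> assume A: "\<mu>\<^sup>2 < (\<Sum>j<N. (q (Suc j) - q j) * (norm (\<xi> j \<omega>))\<^sup>2)"
      show "\<mu>\<^sup>2 \<le> (J \<omega>)\<^sup>2 + V \<omega>"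
      proof (cases "?T \<omega> = N")
        case True
        then have "\<not> P j \<omega>" if "j < N" for j using not_P_before_first_index[of j P N \<omega>] that by simp
        then have "?\<xi> j \<omega> = \<xi> j \<omega>" if "j < N" for j using that by (auto simp: stopped_coeff_def)
        then have "V \<omega> = (\<Sum>j<N. (q (Suc j) - q j) * (norm (\<xi> j \<omega>))\<^sup>2)" by (simp add: V_def)
        with A show ?thesis by (simp add: add_increasing)
      next
        case False
        with first_index_hit[of P N \<omega>] have "\<mu> < \<bar>J \<omega>\<bar>" by (simp add: P_def J_eq)
        then have "\<mu>\<^sup>2 \<le> (J \<omega>)\<^sup>2" using \<mu> by (intro abs_le_square_iff[THEN iffD1]) auto
        with V0[of \<omega>] show ?thesis by simp
      qed
    qed
  qed
  also have "\<dots> \<le> expectation (\<lambda>\<omega>. (J \<omega>)\<^sup>2 + V \<omega>) / \<mu>\<^sup>2"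
    using V0 \<mu> by (intro integral_Markov_inequality_measure[OF int, where A = "{}"]) auto
  also have "\<dots> = 2 * expectation (\<lambda>\<omega>. (J \<omega>)\<^sup>2) / \<mu>\<^sup>2"
    using J2(1) V by simp
  also have "\<dots> \<le> 2 * (2 * \<mu> * (expectation (\<lambda>\<omega>. \<bar>X t \<omega>\<bar>) + 1 + \<mu> * prob D) + 2) / \<mu>\<^sup>2"
    using EJ by (intro divide_right_mono) auto
  also have "\<dots> = (4 * expectation (\<lambda>\<omega>. \<bar>X t \<omega>\<bar>) + 4) / \<mu> + 4 * prob D + 4 / \<mu>\<^sup>2"
    using \<mu> by (simp add: field_simps power2_eq_square)
  also have "4 / \<mu>\<^sup>2 \<le> 4 / \<mu>"
    using \<mu> by (simp add: field_simps power2_eq_square)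
  finally show ?thesis by (simp add: add_divide_distrib)
qed

end

section \<open>The energy of the integrand has a weak-type tail\<close>

text \<open>Cut the range of \<open>Y\<close> at the powers of two. The level \<open>2\<^sup>n\<^sup>+\<^sup>2\<close> contributes at most
  \<open>2\<^bsup>(n+2)\<alpha>\<^esup> K / 2\<^sup>n\<close>, which is a geometric series with ratio \<open>2\<^bsup>\<alpha>-1\<^esup> < 1\<close>.\<close>

lemma (in prob_space) weak_type_imp_powr_finite:
  fixes Y :: "'a \<Rightarrow> real"
  assumes Y [measurable]: "Y \<in> borel_measurable M" and Y0: "\<And>\<omega>. 0 \<le> Y \<omega>"
    and tail: "\<And>\<mu>. 1 \<le> \<mu> \<Longrightarrow> prob {\<omega>\<in>space M. 2 * \<mu> < Y \<omega>} \<le> K / \<mu>"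
    and \<alpha>: "0 < \<alpha>" "\<alpha> < 1"
  shows "(\<integral>\<^sup>+\<omega>. ennreal (Y \<omega> powr \<alpha>) \<partial>M) < \<infinity>"
proof -
  define E where "E n = {\<omega>\<in>space M. 2 * 2 ^ n < Y \<omega>}" for n :: nat
  have E [measurable]: "E n \<in> events" for n unfolding E_def by measurable
  \<comment> \<open>The value of \<open>Y\<^sup>\<alpha>\<close> is at most \<open>c n\<close> where \<open>2\<^sup>n\<^sup>+\<^sup>1 < Y \<le> 2\<^sup>n\<^sup>+\<^sup>2\<close>, and this set lies in \<open>E n\<close>.\<close>
  define c where "c n = (2 ^ (n + 2) :: real) powr \<alpha>" for n :: nat
  have c0: "0 \<le> c n" for n by (simp add: c_def)
  have K0: "0 \<le> K" using order_trans[OF measure_nonneg tail[of 1]] by simp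
  have "(\<integral>\<^sup>+\<omega>. ennreal (Y \<omega> powr \<alpha>) \<partial>M) \<le>
      (\<integral>\<^sup>+\<omega>. ennreal (2 powr \<alpha>) + (\<Sum>n. ennreal (c n) * indicator (E n) \<omega>) \<partial>M)"
  proof (rule nn_integral_mono)
    fix \<omega> assume \<omega>: "\<omega> \<in> space M"
    show "ennreal (Y \<omega> powr \<alpha>) \<le> ennreal (2 powr \<alpha>) + (\<Sum>n. ennreal (c n) * indicator (E n) \<omega>)"
    proof (cases "Y \<omega> \<le> 2")
      case True
      then have "ennreal (Y \<omega> powr \<alpha>) \<le> ennreal (2 powr \<alpha>)"
        using Y0 \<alpha> by (intro ennreal_leI powr_mono2) auto
      then show ?thesis by (rule add_increasing2[rotated]) simp
    next
      case False
      obtain n0 where "Y \<omega> < 2 ^ n0" using real_arch_pow[of 2 "Y \<omega>"] by auto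
      then have ex: "\<exists>n. Y \<omega> \<le> 2 ^ (n + 2)"
        by (intro exI[of _ n0]) (rule order_trans[of _ "2 ^ n0"], auto intro: power_increasing)
      define n where "n = (LEAST n. Y \<omega> \<le> 2 ^ (n + 2))"
      have n: "Y \<omega> \<le> 2 ^ (n + 2)" unfolding n_def using ex by (rule LeastI_ex)
      have "\<omega> \<in> E n"
      proof (cases n)
        case 0
        with False \<omega> show ?thesis by (simp add: E_def)
      next
        case (Suc m)
        then have "\<not> Y \<omega> \<le> 2 ^ (m + 2)" using not_less_Least[of m "\<lambda>n. Y \<omega> \<le> 2 ^ (n + 2)"] by (simp add: n_def)
        with Suc \<omega> show ?thesis by (simp add: E_def)
      qed
      have "ennreal (Y \<omega> powr \<alpha>) \<le> ennreal (c n)"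
        unfolding c_def using n Y0 \<alpha> by (intro ennreal_leI powr_mono2) auto
      also have "\<dots> = (\<Sum>i\<in>{n}. ennreal (c i) * indicator (E i) \<omega>)" using \<open>\<omega> \<in> E n\<close> by simp
      also have "\<dots> \<le> (\<Sum>n. ennreal (c n) * indicator (E n) \<omega>)"
        by (rule sum_le_suminf) auto
      finally show ?thesis by (rule add_increasing[rotated]) simp
    qed
  qed
  also have "\<dots> = ennreal (2 powr \<alpha>) + (\<Sum>n. ennreal (c n) * emeasure M (E n))"
    by (simp add: nn_integral_add nn_integral_suminf nn_integral_cmult emeasure_space_1)
  also have "(\<Sum>n. ennreal (c n) * emeasure M (E n)) \<le> (\<Sum>n. ennreal (4 powr \<alpha> * K * (2 powr (\<alpha> - 1)) ^ n))"
  proof (rule suminf_le)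
    fix n
    have "ennreal (c n) * emeasure M (E n) = ennreal (c n * prob (E n))"
      using c0 by (simp add: emeasure_eq_measure ennreal_mult)
    also have "\<dots> \<le> ennreal (4 powr \<alpha> * K * (2 powr (\<alpha> - 1)) ^ n)"
    proof (rule ennreal_leI)
      have cn: "c n = 4 powr \<alpha> * (2 powr \<alpha>) ^ n"
      proof -
        have "c n = (4 * 2 ^ n) powr \<alpha>" by (simp add: c_def power_add mult.commute)
        also have "\<dots> = 4 powr \<alpha> * (2 ^ n) powr \<alpha>" by (simp add: powr_mult)
        also have "(2 ^ n) powr \<alpha> = (2 powr \<alpha>) ^ n"
          by (simp add: powr_realpow[symmetric] powr_powr mult.commute powr_power)
        finally show ?thesis .
      qed
      have "c n * prob (E n) \<le> c n * (K / 2 ^ n)"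
        using tail[of "2 ^ n"] c0 by (intro mult_left_mono) (auto simp: E_def)
      also have "\<dots> = 4 powr \<alpha> * K * (2 powr (\<alpha> - 1)) ^ n"
        by (simp add: cn powr_diff power_divide)
      finally show "c n * prob (E n) \<le> 4 powr \<alpha> * K * (2 powr (\<alpha> - 1)) ^ n" .
    qed
    finally show "ennreal (c n) * emeasure M (E n) \<le> ennreal (4 powr \<alpha> * K * (2 powr (\<alpha> - 1)) ^ n)" .
  qed auto
  also have "\<dots> = ennreal (\<Sum>n. 4 powr \<alpha> * K * (2 powr (\<alpha> - 1)) ^ n)"
  proof (rule suminf_ennreal2)
    show "summable (\<lambda>n. 4 powr \<alpha> * K * (2 powr (\<alpha> - 1)) ^ n)"
      using \<alpha> powr_less_mono[of "\<alpha> - 1" 0 2] by (intro summable_mult summable_geometric) auto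
  qed (use K0 in auto)
  finally have "(\<integral>\<^sup>+\<omega>. ennreal (Y \<omega> powr \<alpha>) \<partial>M) \<le>
      ennreal (2 powr \<alpha>) + ennreal (\<Sum>n. 4 powr \<alpha> * K * (2 powr (\<alpha> - 1)) ^ n)"
    by (simp add: add_left_mono)
  moreover have "ennreal a + ennreal b < \<infinity>" for a b by (simp add: less_top[symmetric])
  ultimately show ?thesis by (rule order_le_less_trans)
qed

text \<open>Suprema of continuous paths can be taken over countable dense sets of times, which makes them
  measurable.\<close>

lemma exceeds_on_dense_iff:
  fixes g :: "real \<Rightarrow> real"
  assumes g: "continuous_on S g" and T: "T \<subseteq> S" "S \<subseteq> closure T"
  shows "(\<exists>r\<in>S. c < g r) \<longleftrightarrow> (\<exists>r\<in>T. c < g r)"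
proof
  assume "\<exists>r\<in>S. c < g r"
  then obtain r where r: "r \<in> S" "c < g r" by blast
  with T obtain x where x: "\<And>n. x n \<in> T" "x \<longlonglongrightarrow> r"
    unfolding closure_sequential by (metis subsetD closure_sequential)
  have "(\<lambda>n. g (x n)) \<longlonglongrightarrow> g r"
    using g r(1) x T unfolding continuous_on_sequentially by (auto simp: o_def)
  then have "\<forall>\<^sub>F n in sequentially. c < g (x n)" using r(2) by (rule order_tendstoD)
  then obtain n where "c < g (x n)" by (auto dest: eventually_happens)
  with x show "\<exists>r\<in>T. c < g r" by blast
qed (use T in blast)

context brownian_filtration
begin

lemma step_integral_continuous:
  assumes sd: "step_data M F t q \<xi> N"
  shows "AE \<omega> in M. continuous_on {0..t} (\<lambda>r. step_integral B q \<xi> N r \<omega>)"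
proof -
  have "AE \<omega> in M. continuous_on {0..} (\<lambda>s. B s \<omega>)" using bm by (simp add: brownian_motion_def)
  then show ?thesis
  proof eventually_elim
    fix \<omega> assume c: "continuous_on {0..} (\<lambda>s. B s \<omega>)"
    have c': "continuous_on {0..t} (\<lambda>r. B (min r a) \<omega>)" if "0 \<le> a" for a
      by (rule continuous_on_compose2[OF c, of _ "\<lambda>r. min r a"]) (use that in \<open>auto intro!: continuous_intros\<close>)
    show "continuous_on {0..t} (\<lambda>r. step_integral B q \<xi> N r \<omega>)"
      unfolding step_integral_def
    proof (intro continuous_on_sum continuous_on_inner continuous_on_const continuous_on_diff c')
      fix j assume "j \<in> {..<N}"
      then show "0 \<le> q (Suc j)" "0 \<le> q j" using step_data_bounds[OF sd] by auto
    qed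
  qed
qed

text \<open>Convergence in probability is only meaningful for measurable events. Here the uncountable union over
  \<open>r\<close> agrees, for continuous paths, with a countable one; completeness of the measure takes care of the
  remaining paths.\<close>

lemma uniform_deviation_event:
  fixes Y Z :: "real \<Rightarrow> 'w \<Rightarrow> real"
  assumes Y: "\<And>r. r \<in> {0..t} \<Longrightarrow> Y r \<in> borel_measurable M" "AE \<omega> in M. continuous_on {0..t} (\<lambda>r. Y r \<omega>)"
    and Z: "\<And>r. r \<in> {0..t} \<Longrightarrow> Z r \<in> borel_measurable M" "AE \<omega> in M. continuous_on {0..t} (\<lambda>r. Z r \<omega>)"
  shows "{\<omega>\<in>space M. \<exists>r\<in>{0..t}. \<bar>Y r \<omega> - Z r \<omega>\<bar> > \<epsilon>} \<in> events"
proof -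
  obtain T where T: "countable T" "T \<subseteq> {0..t}" "{0..t} \<subseteq> closure T" by (rule separable)
  have "{\<omega>\<in>space M. \<bar>Y r \<omega> - Z r \<omega>\<bar> > \<epsilon>} \<in> events" if "r \<in> T" for r
  proof -
    have [measurable]: "Y r \<in> borel_measurable M" "Z r \<in> borel_measurable M" using Y Z T that by auto
    show ?thesis by measurable
  qed
  then have 1: "(\<Union>r\<in>T. {\<omega>\<in>space M. \<bar>Y r \<omega> - Z r \<omega>\<bar> > \<epsilon>}) \<in> events"
    using T(1) by (intro sets.countable_UN') auto
  show ?thesis
  proof (rule in_sets_AE[OF _ 1])
    show "AE \<omega> in M. (\<omega> \<in> (\<Union>r\<in>T. {\<omega>\<in>space M. \<bar>Y r \<omega> - Z r \<omega>\<bar> > \<epsilon>})) =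
        (\<omega> \<in> {\<omega>\<in>space M. \<exists>r\<in>{0..t}. \<bar>Y r \<omega> - Z r \<omega>\<bar> > \<epsilon>})"
      using Y(2) Z(2)
    proof eventually_elim
      case (elim \<omega>)
      have "continuous_on {0..t} (\<lambda>r. \<bar>Y r \<omega> - Z r \<omega>\<bar>)" using elim by (intro continuous_intros)
      from exceeds_on_dense_iff[OF this T(2,3), of \<epsilon>] show ?case by auto
    qed
  qed auto
qed

end

locale ito_integral_process = brownian_filtration M F B
  for M :: "'w measure" and F and B :: "real \<Rightarrow> 'w \<Rightarrow> real ^ 'd" +
  fixes t :: real and f :: "real \<Rightarrow> 'w \<Rightarrow> real ^ 'd" and X :: "real \<Rightarrow> 'w \<Rightarrow> real"
  assumes t: "0 < t" and f: "progressively_measurable F f" and ito: "ito_integral M F B t f X"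
begin

text \<open>Progressive measurability concerns times in \<open>[0, t]\<close> only, so Lebesgue measure is restricted to that
  interval.\<close>

abbreviation "\<L> \<equiv> restrict_space lborel {0..t}"

lemma f_measurable: "(\<lambda>(\<omega>, s). f s \<omega>) \<in> borel_measurable (M \<Otimes>\<^sub>M \<L>)"
proof -
  have 1: "(\<lambda>(s, \<omega>). f s \<omega>) \<in> borel_measurable (restrict_space borel {0..t} \<Otimes>\<^sub>M F t)"
    using f t by (auto simp: progressively_measurable_def)
  have "(\<lambda>\<omega>. \<omega>) \<in> measurable M (F t)" using t by (intro measurable_F_imp_M[of t]) auto
  then have "(\<lambda>p. fst p) \<in> measurable (M \<Otimes>\<^sub>M \<L>) (F t)" by (rule measurable_compose[OF measurable_fst])
  moreover have "(\<lambda>p. snd p) \<in> measurable (M \<Otimes>\<^sub>M \<L>) (restrict_space borel {0..t})"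
  proof -
    have "sets \<L> = sets (restrict_space borel {0..t})" by (intro sets_restrict_space_cong) simp
    then have "measurable (M \<Otimes>\<^sub>M \<L>) \<L> = measurable (M \<Otimes>\<^sub>M \<L>) (restrict_space borel {0..t})"
      by (intro measurable_cong_sets refl)
    then show ?thesis using measurable_snd[of M \<L>] by simp
  qed
  ultimately have "(\<lambda>p. (snd p, fst p)) \<in> measurable (M \<Otimes>\<^sub>M \<L>) (restrict_space borel {0..t} \<Otimes>\<^sub>M F t)"
    by (intro measurable_Pair)
  from measurable_compose[OF this 1] show ?thesis by (simp add: case_prod_beta)
qed

lemma set_nn_integral_\<L>: "(\<integral>\<^sup>+s\<in>{0..t}. g s \<partial>lborel) = (\<integral>\<^sup>+s. g s \<partial>\<L>)"
  by (subst nn_integral_restrict_space) auto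

lemma sigma_finite_\<L>: "sigma_finite_measure \<L>"
  by (intro sigma_finite_measure_restrict_space sigma_finite_lborel) simp

lemma section_measurable:
  "g \<in> measurable (M \<Otimes>\<^sub>M \<L>) N \<Longrightarrow> \<omega> \<in> space M \<Longrightarrow> (\<lambda>s. g (\<omega>, s)) \<in> measurable \<L> N"
  by (rule measurable_compose[OF measurable_Pair1'])

text \<open>Values are extended nonnegative reals, so that the comparison with the energies of the approximating
  step processes holds for every path, including those of infinite energy.\<close>

definition energy :: "'w \<Rightarrow> ennreal" where
  "energy \<omega> = (\<integral>\<^sup>+s. ennreal ((norm (f s \<omega>))\<^sup>2) \<partial>\<L>)"

lemma energy_measurable [measurable]: "energy \<in> borel_measurable M"
proof -
  interpret \<L>: sigma_finite_measure \<L> by (rule sigma_finite_\<L>)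
  have [measurable]: "(\<lambda>p. f (snd p) (fst p)) \<in> borel_measurable (M \<Otimes>\<^sub>M \<L>)"
    using f_measurable by (simp add: case_prod_beta')
  show ?thesis unfolding energy_def[abs_def]
    by (rule \<L>.borel_measurable_nn_integral) (simp add: case_prod_beta')
qed

text \<open>The equation includes the paths of infinite energy, for which both sides are zero by convention.\<close>

lemma LINT_eq_energy:
  assumes "\<omega> \<in> space M"
  shows "(LINT s:{0..t}|lborel. (norm (f s \<omega>))\<^sup>2) = enn2real (energy \<omega>)"
proof -
  have [measurable]: "(\<lambda>s. f s \<omega>) \<in> borel_measurable \<L>"
    using section_measurable[OF f_measurable assms] by simp
  have "(LINT s:{0..t}|lborel. (norm (f s \<omega>))\<^sup>2) = (LINT s|\<L>. (norm (f s \<omega>))\<^sup>2)"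
    unfolding set_lebesgue_integral_def by (subst integral_restrict_space) auto
  also have "\<dots> = enn2real (energy \<omega>)"
    unfolding energy_def by (intro integral_eq_nn_integral) auto
  finally show ?thesis .
qed

definition deviates :: "(real \<Rightarrow> 'w \<Rightarrow> real) \<Rightarrow> real \<Rightarrow> 'w set" where
  "deviates I \<epsilon> = {\<omega>\<in>space M. \<exists>r\<in>{0..t}. \<bar>I r \<omega> - X r \<omega>\<bar> > \<epsilon>}"

lemma X_measurable: "r \<in> {0..t} \<Longrightarrow> X r \<in> borel_measurable (F r)"
  and X_continuous: "AE \<omega> in M. continuous_on {0..t} (\<lambda>r. X r \<omega>)"
  using ito by (auto simp: ito_integral_def)

lemma deviates_event:
  assumes "simple_integral M F B t \<phi> I"
  shows "deviates I \<epsilon> \<in> events"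
proof -
  obtain q \<xi> N where *: "step_data M F t q \<xi> N" "I = step_integral B q \<xi> N"
    by (rule simple_integral_fine_step[OF assms zero_less_one]) blast
  show ?thesis
    unfolding deviates_def *(2)
    using step_integral_adapted[OF *(1)] step_integral_continuous[OF *(1)] X_measurable X_continuous
    by (intro uniform_deviation_event) (auto intro: measurable_F_imp_M)
qed

lemma approximating_simple_integrals:
  obtains \<phi> I where "\<And>k::nat. simple_integral M F B t (\<phi> k) (I k)"
    "\<And>\<epsilon>. 0 < \<epsilon> \<Longrightarrow> (\<lambda>k. prob {\<omega>\<in>space M.
       (\<integral>\<^sup>+s. ennreal ((norm (\<phi> k s \<omega> - f s \<omega>))\<^sup>2) \<partial>\<L>) > ennreal \<epsilon>}) \<longlonglongrightarrow> 0"
    "\<And>\<epsilon>. 0 < \<epsilon> \<Longrightarrow> (\<lambda>k. prob (deviates (I k) \<epsilon>)) \<longlonglongrightarrow> 0"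
  using ito unfolding ito_integral_def set_nn_integral_\<L> deviates_def by blast

text \<open>For a suitable approximating simple process \<open>\<phi>\<^sub>k\<close>, both \<open>\<integral>\<^sub>0\<^sup>t |\<phi>\<^sub>k - f|\<^sup>2 ds \<le> \<mu>\<^sup>2\<close> and the
  closeness required in \<open>step_weak_type\<close> hold outside sets of probability at most \<open>1 / \<mu>\<close>. The bound for
  \<open>\<phi>\<^sub>k\<close> then carries over by \<open>|f|\<^sup>2 \<le> 2 |\<phi>\<^sub>k|\<^sup>2 + 2 |\<phi>\<^sub>k - f|\<^sup>2\<close>, which accounts for the
  factor \<open>4\<close> in the level.\<close>

lemma energy_weak_type:
  assumes X: "martingale_upto M F t X" and \<mu>: "1 \<le> \<mu>"
  shows "prob {\<omega>\<in>space M. energy \<omega> > ennreal (4 * \<mu>\<^sup>2)} \<le> (4 * expectation (\<lambda>\<omega>. \<bar>X t \<omega>\<bar>) + 13) / \<mu>"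
proof -
  obtain \<phi> I where simple: "\<And>k::nat. simple_integral M F B t (\<phi> k) (I k)"
    and \<phi>: "\<And>\<epsilon>. 0 < \<epsilon> \<Longrightarrow> (\<lambda>k. prob {\<omega>\<in>space M.
       (\<integral>\<^sup>+s. ennreal ((norm (\<phi> k s \<omega> - f s \<omega>))\<^sup>2) \<partial>\<L>) > ennreal \<epsilon>}) \<longlonglongrightarrow> 0"
    and I: "\<And>\<epsilon>. 0 < \<epsilon> \<Longrightarrow> (\<lambda>k. prob (deviates (I k) \<epsilon>)) \<longlonglongrightarrow> 0"
    by (rule approximating_simple_integrals) blast
  have \<mu>': "0 < 1 / \<mu>" "0 < \<mu>\<^sup>2" using \<mu> by auto
  have "\<forall>\<^sub>F k in sequentially. prob {\<omega>\<in>space M.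
      (\<integral>\<^sup>+s. ennreal ((norm (\<phi> k s \<omega> - f s \<omega>))\<^sup>2) \<partial>\<L>) > ennreal (\<mu>\<^sup>2)} < 1 / \<mu> \<and> prob (deviates (I k) 1) < 1 / \<mu>"
    using order_tendstoD(2)[OF \<phi>[OF \<mu>'(2)] \<mu>'(1)] order_tendstoD(2)[OF I[OF zero_less_one] \<mu>'(1)]
    by (rule eventually_conj)
  then obtain k where k: "prob {\<omega>\<in>space M.
      (\<integral>\<^sup>+s. ennreal ((norm (\<phi> k s \<omega> - f s \<omega>))\<^sup>2) \<partial>\<L>) > ennreal (\<mu>\<^sup>2)} < 1 / \<mu>" "prob (deviates (I k) 1) < 1 / \<mu>"
    by (auto dest: eventually_happens)
  obtain q \<xi> N where sd: "step_data M F t q \<xi> N" and I_eq: "I k = step_integral B q \<xi> N"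
    and mesh: "\<And>j. j < N \<Longrightarrow> q (Suc j) - q j \<le> 1"
    and \<phi>_eq: "\<phi> k = (\<lambda>s \<omega>. \<Sum>j<N. indicator {q j<..q (Suc j)} s *\<^sub>R \<xi> j \<omega>)"
    and Q: "\<And>u. 0 \<le> u \<Longrightarrow> \<exists>Q. integrable M Q \<and> expectation Q \<le> 1 \<and>
      (\<forall>\<omega>. 0 \<le> Q \<omega> \<and> (\<forall>j<N. (\<xi> j \<omega> \<bullet> (B (min u (q (Suc j))) \<omega> - B (min u (q j)) \<omega>))\<^sup>2 \<le> Q \<omega>))"
    by (rule simple_integral_fine_step[OF simple[of k] zero_less_one]) blast
  define V where "V \<omega> = (\<Sum>j<N. (q (Suc j) - q j) * (norm (\<xi> j \<omega>))\<^sup>2)" for \<omega>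
  define d where "d \<omega> = (\<integral>\<^sup>+s. ennreal ((norm (\<phi> k s \<omega> - f s \<omega>))\<^sup>2) \<partial>\<L>)" for \<omega>
  have \<xi> [measurable]: "\<xi> j \<in> borel_measurable M" if "j < N" for j
    using step_coeff(1)[OF sd that order_refl] step_data_bounds[OF sd, of j] that
    by (auto intro: measurable_F_imp_M)
  have \<phi>_measurable: "(\<lambda>p. \<phi> k (snd p) (fst p)) \<in> borel_measurable (M \<Otimes>\<^sub>M \<L>)"
  proof -
    have "snd \<in> borel_measurable (M \<Otimes>\<^sub>M \<L>)"
      by (rule measurable_compose[OF measurable_snd]) (simp add: measurable_restrict_space1)
    then have [measurable]: "snd \<in> borel_measurable (M \<Otimes>\<^sub>M \<L>)" .
    show ?thesis unfolding \<phi>_eq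
    proof (intro borel_measurable_sum borel_measurable_scaleR)
      fix j assume "j \<in> {..<N}"
      then have j: "j < N" by simp
      show "(\<lambda>p. \<xi> j (fst p)) \<in> borel_measurable (M \<Otimes>\<^sub>M \<L>)"
        by (rule measurable_compose[OF measurable_fst \<xi>[OF j]])
      show "(\<lambda>p. indicat_real {q j<..q (Suc j)} (snd p)) \<in> borel_measurable (M \<Otimes>\<^sub>M \<L>)"
        by measurable
    qed
  qed
  note [measurable] = \<phi>_measurable
  have [measurable]: "(\<lambda>p. f (snd p) (fst p)) \<in> borel_measurable (M \<Otimes>\<^sub>M \<L>)"
    using f_measurable by (simp add: case_prod_beta')
  have [measurable]: "d \<in> borel_measurable M"
  proof -
    interpret \<L>: sigma_finite_measure \<L> by (rule sigma_finite_\<L>)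
    show ?thesis unfolding d_def[abs_def]
      by (rule \<L>.borel_measurable_nn_integral) (simp add: case_prod_beta')
  qed
  have [measurable]: "V \<in> borel_measurable M"
    unfolding V_def[abs_def] by (intro borel_measurable_sum borel_measurable_times) auto
  have le: "energy \<omega> \<le> 2 * ennreal (V \<omega>) + 2 * d \<omega>" if \<omega>: "\<omega> \<in> space M" for \<omega>
  proof -
    have [measurable]: "(\<lambda>s. f s \<omega>) \<in> borel_measurable \<L>" "(\<lambda>s. \<phi> k s \<omega>) \<in> borel_measurable \<L>"
      using section_measurable[OF f_measurable \<omega>] section_measurable[OF \<phi>_measurable \<omega>] by simp_all
    have "energy \<omega> \<le> (\<integral>\<^sup>+s. 2 * ennreal ((norm (\<phi> k s \<omega>))\<^sup>2) + 2 * ennreal ((norm (\<phi> k s \<omega> - f s \<omega>))\<^sup>2) \<partial>\<L>)"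
      unfolding energy_def
    proof (rule nn_integral_mono)
      fix s
      have "norm (f s \<omega>) \<le> norm (\<phi> k s \<omega>) + norm (\<phi> k s \<omega> - f s \<omega>)"
        using norm_triangle_ineq4[of "\<phi> k s \<omega>" "\<phi> k s \<omega> - f s \<omega>"] by simp
      then have "(norm (f s \<omega>))\<^sup>2 \<le> (norm (\<phi> k s \<omega>) + norm (\<phi> k s \<omega> - f s \<omega>))\<^sup>2"
        by (intro power_mono) auto
      also have "\<dots> \<le> 2 * (norm (\<phi> k s \<omega>))\<^sup>2 + 2 * (norm (\<phi> k s \<omega> - f s \<omega>))\<^sup>2"
        using sum_squares_bound[of "norm (\<phi> k s \<omega>)" "norm (\<phi> k s \<omega> - f s \<omega>)"] by (simp add: power2_sum)
      finally have "ennreal ((norm (f s \<omega>))\<^sup>2) \<le> ennreal (2 * (norm (\<phi> k s \<omega>))\<^sup>2 + 2 * (norm (\<phi> k s \<omega> - f s \<omega>))\<^sup>2)"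
        by (rule ennreal_leI)
      then show "ennreal ((norm (f s \<omega>))\<^sup>2) \<le>
          2 * ennreal ((norm (\<phi> k s \<omega>))\<^sup>2) + 2 * ennreal ((norm (\<phi> k s \<omega> - f s \<omega>))\<^sup>2)"
        by (simp add: ennreal_mult)
    qed
    also have "\<dots> = 2 * (\<integral>\<^sup>+s. ennreal ((norm (\<phi> k s \<omega>))\<^sup>2) \<partial>\<L>) + 2 * d \<omega>"
      unfolding d_def by (subst nn_integral_add) (auto simp: nn_integral_cmult)
    also have "(\<integral>\<^sup>+s. ennreal ((norm (\<phi> k s \<omega>))\<^sup>2) \<partial>\<L>) = ennreal (V \<omega>)"
      using nn_integral_step_norm_sq[OF sd, of \<omega>] unfolding set_nn_integral_\<L> \<phi>_eq V_def by simp
    finally show ?thesis .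
  qed
  have "{\<omega>\<in>space M. energy \<omega> > ennreal (4 * \<mu>\<^sup>2)} \<subseteq>
      {\<omega>\<in>space M. V \<omega> > \<mu>\<^sup>2} \<union> {\<omega>\<in>space M. d \<omega> > ennreal (\<mu>\<^sup>2)}"
  proof (safe, rule ccontr)
    fix \<omega> assume \<omega>: "\<omega> \<in> space M" and 1: "ennreal (4 * \<mu>\<^sup>2) < energy \<omega>"
      and 2: "\<not> ennreal (\<mu>\<^sup>2) < d \<omega>" and 3: "\<not> \<mu>\<^sup>2 < V \<omega>"
    have "energy \<omega> \<le> 2 * ennreal (V \<omega>) + 2 * d \<omega>" by (rule le[OF \<omega>])
    also have "\<dots> \<le> 2 * ennreal (\<mu>\<^sup>2) + 2 * ennreal (\<mu>\<^sup>2)"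
      using 2 3 by (intro add_mono mult_left_mono ennreal_leI) auto
    also have "\<dots> = ennreal (4 * \<mu>\<^sup>2)"
      by (simp add: ennreal_mult flip: distrib_right)
    finally show False using 1 by simp
  qed
  then have "prob {\<omega>\<in>space M. energy \<omega> > ennreal (4 * \<mu>\<^sup>2)} \<le>
      prob ({\<omega>\<in>space M. V \<omega> > \<mu>\<^sup>2} \<union> {\<omega>\<in>space M. d \<omega> > ennreal (\<mu>\<^sup>2)})"
    by (intro finite_measure_mono) measurable
  also have "\<dots> \<le> prob {\<omega>\<in>space M. V \<omega> > \<mu>\<^sup>2} + prob {\<omega>\<in>space M. d \<omega> > ennreal (\<mu>\<^sup>2)}"
    by (intro measure_Un_le) measurable
  also have "prob {\<omega>\<in>space M. V \<omega> > \<mu>\<^sup>2} \<le> (4 * expectation (\<lambda>\<omega>. \<bar>X t \<omega>\<bar>) + 8) / \<mu> + 4 * prob (deviates (I k) 1)"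
  proof -
    from Q[of t] t obtain Q' where Q': "integrable M Q'" "expectation Q' \<le> 1"
      "\<And>\<omega>. 0 \<le> Q' \<omega> \<and> (\<forall>j<N. (\<xi> j \<omega> \<bullet> (B (min t (q (Suc j))) \<omega> - B (min t (q j)) \<omega>))\<^sup>2 \<le> Q' \<omega>)"
      by auto
    show ?thesis unfolding V_def
      by (rule step_weak_type[OF X sd \<mu> Q' deviates_event[OF simple]])
        (auto simp: deviates_def I_eq not_less)
  qed
  finally show ?thesis using k by (simp add: d_def add_divide_distrib)
qed

lemma not_martingale:
  assumes \<alpha>: "0 < \<alpha>" "\<alpha> < 1"
    and inf: "(\<integral>\<^sup>+\<omega>. ennreal ((LINT s:{0..t}|lborel. (norm (f s \<omega>))\<^sup>2) powr (\<alpha> / 2)) \<partial>M) = \<infinity>"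
  shows "\<not> martingale_upto M F t X"
proof
  assume X: "martingale_upto M F t X"
  define Y where "Y \<omega> = sqrt (enn2real (energy \<omega>))" for \<omega>
  have "(\<integral>\<^sup>+\<omega>. ennreal (Y \<omega> powr \<alpha>) \<partial>M) < \<infinity>"
  proof (rule weak_type_imp_powr_finite[OF _ _ _ \<alpha>])
    show [measurable]: "Y \<in> borel_measurable M" unfolding Y_def[abs_def] by measurable
    show "0 \<le> Y \<omega>" for \<omega> by (simp add: Y_def)
    fix \<mu> :: real assume \<mu>: "1 \<le> \<mu>"
    have "prob {\<omega>\<in>space M. 2 * \<mu> < Y \<omega>} \<le> prob {\<omega>\<in>space M. energy \<omega> > ennreal (4 * \<mu>\<^sup>2)}"
    proof (rule finite_measure_mono)
      show "{\<omega>\<in>space M. 2 * \<mu> < Y \<omega>} \<subseteq> {\<omega>\<in>space M. energy \<omega> > ennreal (4 * \<mu>\<^sup>2)}"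
      proof safe
        fix \<omega> assume "2 * \<mu> < Y \<omega>"
        then have "(2 * \<mu>)\<^sup>2 < (Y \<omega>)\<^sup>2" using \<mu> by (intro power_strict_mono) auto
        then have *: "4 * \<mu>\<^sup>2 < enn2real (energy \<omega>)" by (simp add: Y_def)
        show "ennreal (4 * \<mu>\<^sup>2) < energy \<omega>"
        proof (cases "energy \<omega>")
          case (real x)
          with * show ?thesis by (simp add: ennreal_less_iff)
        next
          case top
          then show ?thesis by simp
        qed
      qed
      show "{\<omega>\<in>space M. energy \<omega> > ennreal (4 * \<mu>\<^sup>2)} \<in> events" by measurable
    qed
    also note energy_weak_type[OF X \<mu>]
    finally show "prob {\<omega>\<in>space M. 2 * \<mu> < Y \<omega>} \<le> (4 * expectation (\<lambda>\<omega>. \<bar>X t \<omega>\<bar>) + 13) / \<mu>" .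
  qed
  also have "(\<integral>\<^sup>+\<omega>. ennreal (Y \<omega> powr \<alpha>) \<partial>M) =
      (\<integral>\<^sup>+\<omega>. ennreal ((LINT s:{0..t}|lborel. (norm (f s \<omega>))\<^sup>2) powr (\<alpha> / 2)) \<partial>M)"
    by (intro nn_integral_cong) (simp add: LINT_eq_energy Y_def powr_half_sqrt[symmetric] powr_powr)
  finally show False using inf by simp
qed

end

section \<open>The stochastic integral is a local martingale\<close>

context ito_integral_process
begin

text \<open>Pass to a subsequence along which the probabilities of a deviation of more than \<open>2\<^bsup>-i\<^esup>\<close> are
  summable, and use the Borel-Cantelli lemma.\<close>

lemma as_approximation:
  obtains I where "\<And>i::nat. \<exists>\<phi>. simple_integral M F B t \<phi> (I i)"
    "AE \<omega> in M. \<forall>\<^sub>F i in sequentially. \<forall>r\<in>{0..t}. \<bar>I i r \<omega> - X r \<omega>\<bar> \<le> (1 / 2) ^ i"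
proof -
  obtain \<phi> I where simple: "\<And>k::nat. simple_integral M F B t (\<phi> k) (I k)"
    and "\<And>\<epsilon>. 0 < \<epsilon> \<Longrightarrow> (\<lambda>k. prob {\<omega>\<in>space M.
       (\<integral>\<^sup>+s. ennreal ((norm (\<phi> k s \<omega> - f s \<omega>))\<^sup>2) \<partial>\<L>) > ennreal \<epsilon>}) \<longlonglongrightarrow> 0"
    and I: "\<And>\<epsilon>. 0 < \<epsilon> \<Longrightarrow> (\<lambda>k. prob (deviates (I k) \<epsilon>)) \<longlonglongrightarrow> 0"
    by (rule approximating_simple_integrals) blast
  have "\<exists>k. prob (deviates (I k) ((1 / 2) ^ i)) < (1 / 2) ^ i" for i :: nat
  proof -
    have "\<forall>\<^sub>F k in sequentially. prob (deviates (I k) ((1 / 2) ^ i)) < (1 / 2) ^ i"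
      by (rule order_tendstoD(2)[OF I]) auto
    then show ?thesis by (auto dest: eventually_happens)
  qed
  then obtain k where k: "\<And>i. prob (deviates (I (k i)) ((1 / 2) ^ i)) < (1 / 2) ^ i" by metis
  have "AE \<omega> in M. \<forall>\<^sub>F i in sequentially. \<omega> \<in> space M - deviates (I (k i)) ((1 / 2) ^ i)"
  proof (rule borel_cantelli_AE1)
    show "summable (\<lambda>i. prob (deviates (I (k i)) ((1 / 2) ^ i)))"
      by (rule summable_comparison_test'[of "\<lambda>i. (1 / 2) ^ i" 0])
        (use k in \<open>auto intro: summable_geometric less_imp_le\<close>)
  qed (use deviates_event[OF simple] in \<open>auto simp: emeasure_eq_measure\<close>)
  then have "AE \<omega> in M. \<forall>\<^sub>F i in sequentially. \<forall>r\<in>{0..t}. \<bar>I (k i) r \<omega> - X r \<omega>\<bar> \<le> (1 / 2) ^ i"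
    by eventually_elim (auto simp: deviates_def not_less elim: eventually_mono)
  then show thesis using simple by (intro that[of "\<lambda>i. I (k i)"]) auto
qed

lemma X_zero: "AE \<omega> in M. X 0 \<omega> = 0"
proof -
  obtain I where I: "\<And>i::nat. \<exists>\<phi>. simple_integral M F B t \<phi> (I i)"
    and ae: "AE \<omega> in M. \<forall>\<^sub>F i in sequentially. \<forall>r\<in>{0..t}. \<bar>I i r \<omega> - X r \<omega>\<bar> \<le> (1 / 2) ^ i"
    by (rule as_approximation) blast
  have I0: "I i 0 \<omega> = 0" for i \<omega>
  proof -
    obtain \<phi> where "simple_integral M F B t \<phi> (I i)" using I by blast
    from simple_integral_fine_step[OF this zero_less_one]
    obtain q \<xi> N where sd: "step_data M F t q \<xi> N" and eq: "I i = step_integral B q \<xi> N" by metis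
    show ?thesis unfolding eq step_integral_def
      using step_data_bounds(1)[OF sd] by (intro sum.neutral) (simp add: min_absorb1)
  qed
  from ae show ?thesis
  proof eventually_elim
    case (elim \<omega>)
    then have "\<forall>\<^sub>F i in sequentially. \<bar>X 0 \<omega>\<bar> \<le> (1 / 2) ^ i"
    proof eventually_elim
      case (elim i)
      from bspec[OF this, of 0] t show ?case by (simp add: I0)
    qed
    moreover have "(\<lambda>i. (1 / 2 :: real) ^ i) \<longlonglongrightarrow> 0" by (intro LIMSEQ_realpow_zero) auto
    ultimately have "\<bar>X 0 \<omega>\<bar> \<le> 0" by (intro tendsto_lowerbound) auto
    then show ?case by simp
  qed
qed

text \<open>A deterministic statement about one path. The index at which the approximation \<open>Y\<^sub>i\<close> is stopped is
  the first one with \<open>\<tau> \<le> q\<^sub>j\<close>, as soon as \<open>|Y\<^sub>i - x| \<le> 1\<close>: before \<open>\<tau>\<close> the bound \<open>|x| \<le> c\<close> excludes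
  \<open>|Y\<^sub>i| > c + 1\<close>. So the stopping grid points converge to \<open>\<tau>\<close> with the mesh.\<close>

lemma stopped_path_convergence:
  fixes Y :: "nat \<Rightarrow> real \<Rightarrow> real" and x :: "real \<Rightarrow> real"
  assumes x: "continuous_on {0..t} x" and \<tau>: "\<tau> \<in> {0..t}" and u: "u \<in> {0..t}"
    and c: "\<And>r. 0 \<le> r \<Longrightarrow> r \<le> \<tau> \<Longrightarrow> \<bar>x r\<bar> \<le> c"
    and Y: "\<forall>\<^sub>F i in sequentially. \<forall>r\<in>{0..t}. \<bar>Y i r - x r\<bar> \<le> (1 / 2) ^ i"
    and sd: "\<And>i. step_data M F t (q i) (\<xi> i) (N i)"
    and mesh: "\<And>i j. j < N i \<Longrightarrow> q i (Suc j) - q i j \<le> (1 / 4) ^ i"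
    and P: "\<And>i j. P i j \<omega> \<longleftrightarrow> \<tau> \<le> q i j \<or> c + 1 < \<bar>Y i (q i j)\<bar>"
  shows "(\<lambda>i. Y i (min u (q i (first_index (P i) (N i) \<omega>)))) \<longlonglongrightarrow> x (min u \<tau>)"
proof -
  let ?T = "\<lambda>i. first_index (P i) (N i) \<omega>"
  let ?v = "\<lambda>i. min u (q i (?T i))"
  have qT: "q i (?T i) \<in> {0..t}" for i
    using step_data_bounds[OF sd first_index_le[of "P i" "N i" \<omega>]] by simp
  then have v: "?v i \<in> {0..t}" for i using u by (auto simp: min_def)
  have "\<forall>\<^sub>F i in sequentially. norm (q i (?T i) - \<tau>) \<le> (1 / 4) ^ i"
    using Y
  proof eventually_elim
    case (elim i)
    have "\<tau> \<le> q i (?T i)"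
    proof (cases "?T i = N i")
      case True
      then show ?thesis using sd[of i] \<tau> by (simp add: step_data_def)
    next
      case False
      with first_index_hit[of "P i" "N i" \<omega>] have "P i (?T i) \<omega>" by simp
      then consider "\<tau> \<le> q i (?T i)" | "c + 1 < \<bar>Y i (q i (?T i))\<bar>" using P by blast
      then show ?thesis
      proof cases
        case 2
        have "\<bar>Y i (q i (?T i)) - x (q i (?T i))\<bar> \<le> 1"
          using elim qT[of i] power_le_one[of "1 / 2 :: real" i] by force
        with 2 have "\<not> \<bar>x (q i (?T i))\<bar> \<le> c" by linarith
        then show ?thesis using c[of "q i (?T i)"] qT[of i] by force
      qed
    qed
    moreover have "q i (?T i) - \<tau> \<le> (1 / 4) ^ i"
    proof (cases "?T i")
      case 0
      then have "q i (?T i) - \<tau> \<le> 0" using sd[of i] \<tau> by (simp add: step_data_def)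
      then show ?thesis by (rule order_trans) simp
    next
      case (Suc j)
      then have "\<not> P i j \<omega>" by (intro not_P_before_first_index[of j "P i" "N i"]) simp
      then have "q i j < \<tau>" using P by force
      moreover have "j < N i" using Suc first_index_le[of "P i" "N i" \<omega>] by simp
      ultimately show ?thesis using mesh[of j i] Suc by simp
    qed
    ultimately show ?case by simp
  qed
  then have "(\<lambda>i. q i (?T i) - \<tau>) \<longlonglongrightarrow> 0"
    by (rule Lim_null_comparison) (intro LIMSEQ_realpow_zero, auto)
  then have "(\<lambda>i. q i (?T i)) \<longlonglongrightarrow> \<tau>" by (rule Lim_null[THEN iffD2])
  then have "?v \<longlonglongrightarrow> min u \<tau>" by (intro tendsto_min tendsto_const)
  moreover have "min u \<tau> \<in> {0..t}" using u \<tau> by (auto simp: min_def)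
  ultimately have "(\<lambda>i. x (?v i)) \<longlonglongrightarrow> x (min u \<tau>)"
    using x v unfolding continuous_on_sequentially by (auto simp: o_def)
  moreover have "(\<lambda>i. Y i (?v i) - x (?v i)) \<longlonglongrightarrow> 0"
  proof (rule Lim_null_comparison)
    show "\<forall>\<^sub>F i in sequentially. norm (Y i (?v i) - x (?v i)) \<le> (1 / 2) ^ i"
      using Y by eventually_elim (use v in auto)
    show "(\<lambda>i. (1 / 2 :: real) ^ i) \<longlonglongrightarrow> 0" by (intro LIMSEQ_realpow_zero) auto
  qed
  ultimately show ?thesis using tendsto_add by fastforce
qed

text \<open>The approximating step integrals, stopped on their grids as in the previous lemma, are martingales
  \<open>J\<^sub>i\<close> that converge almost surely to the stopped process \<open>Z\<close>. Their expectations over any event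
  converge as well: truncated at the level \<open>|c| + 1\<close> they converge by dominated convergence, and the
  truncation removes at most the overshoot, whose expectation tends to zero. The limit therefore
  inherits the martingale property.\<close>

lemma bounded_stopped_martingale:
  assumes \<tau>: "\<And>\<omega>. \<omega> \<in> space M \<Longrightarrow> \<tau> \<omega> \<in> {0..t}"
    and stop: "\<And>s. s \<in> {0..t} \<Longrightarrow> Measurable.pred (F s) (\<lambda>\<omega>. \<tau> \<omega> \<le> s)"
    and c: "AE \<omega> in M. \<forall>r. 0 \<le> r \<and> r \<le> \<tau> \<omega> \<longrightarrow> \<bar>X r \<omega>\<bar> \<le> c"
  shows "martingale_upto M F t (\<lambda>r \<omega>. X (min r (\<tau> \<omega>)) \<omega> - X 0 \<omega>)"
proof -
  obtain I where I: "\<And>i::nat. \<exists>\<phi>. simple_integral M F B t \<phi> (I i)"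
    and ae: "AE \<omega> in M. \<forall>\<^sub>F i in sequentially. \<forall>r\<in>{0..t}. \<bar>I i r \<omega> - X r \<omega>\<bar> \<le> (1 / 2) ^ i"
    by (rule as_approximation) blast
  have "\<exists>q \<xi> N. step_data M F t q \<xi> N \<and> (\<forall>j<N. q (Suc j) - q j \<le> (1 / 4) ^ i) \<and>
      I i = step_integral B q \<xi> N \<and>
      (\<forall>u\<ge>0. \<exists>Q. integrable M Q \<and> expectation Q \<le> (1 / 4) ^ i \<and>
        (\<forall>\<omega>. 0 \<le> Q \<omega> \<and> (\<forall>j<N. (\<xi> j \<omega> \<bullet> (B (min u (q (Suc j))) \<omega> - B (min u (q j)) \<omega>))\<^sup>2 \<le> Q \<omega>)))" for i
  proof -
    obtain \<phi> where \<phi>: "simple_integral M F B t \<phi> (I i)" using I by blast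
    have "0 < (1 / 4 :: real) ^ i" by simp
    show ?thesis by (rule simple_integral_fine_step[OF \<phi> \<open>0 < (1 / 4 :: real) ^ i\<close>]) blast
  qed
  then obtain q \<xi> N where sd: "\<And>i. step_data M F t (q i) (\<xi> i) (N i)"
    and mesh: "\<And>i j. j < N i \<Longrightarrow> q i (Suc j) - q i j \<le> (1 / 4) ^ i"
    and I_eq: "\<And>i. I i = step_integral B (q i) (\<xi> i) (N i)"
    and Q: "\<And>i u. 0 \<le> u \<Longrightarrow> \<exists>Q. integrable M Q \<and> expectation Q \<le> (1 / 4) ^ i \<and>
        (\<forall>\<omega>. 0 \<le> Q \<omega> \<and> (\<forall>j<N i. (\<xi> i j \<omega> \<bullet> (B (min u (q i (Suc j))) \<omega> - B (min u (q i j)) \<omega>))\<^sup>2 \<le> Q \<omega>))"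
    by metis
  \<comment> \<open>The absolute value of \<open>c\<close> makes the level nonnegative whatever \<open>c\<close> is.\<close>
  define P where "P i j \<omega> \<longleftrightarrow> \<tau> \<omega> \<le> q i j \<or> \<bar>c\<bar> + 1 < \<bar>I i (q i j) \<omega>\<bar>" for i j \<omega>
  define J where "J i = step_integral B (q i) (stopped_coeff (P i) (\<xi> i)) (N i)" for i
  define Z where "Z r \<omega> = X (min r (\<tau> \<omega>)) \<omega> - X 0 \<omega>" for r \<omega>
  have sd': "step_data M F t (q i) (stopped_coeff (P i) (\<xi> i)) (N i)" for i
  proof (rule step_data_stopped[OF sd])
    fix j assume j: "j < N i"
    have qj: "q i j \<in> {0..t}" using step_data_bounds[OF sd[of i], of j] j by simp
    have [measurable]: "I i (q i j) \<in> borel_measurable (F (q i j))"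
      unfolding I_eq using qj by (intro step_integral_adapted[OF sd]) simp
    note [measurable] = stop[OF qj]
    show "Measurable.pred (F (q i j)) (P i j)" unfolding P_def by measurable
  qed
  have lim: "AE \<omega> in M. (\<lambda>i. J i u \<omega>) \<longlonglongrightarrow> Z u \<omega>" if u: "u \<in> {0..t}" for u
    using ae X_continuous X_zero c AE_space
  proof eventually_elim
    case (elim \<omega>)
    have "(\<lambda>i. I i (min u (q i (first_index (P i) (N i) \<omega>))) \<omega>) \<longlonglongrightarrow> X (min u (\<tau> \<omega>)) \<omega>"
    proof (rule stopped_path_convergence[where c = "\<bar>c\<bar>" and Y = "\<lambda>i r. I i r \<omega>" and x = "\<lambda>r. X r \<omega>", OF _ _ u])
      show "\<bar>X r \<omega>\<bar> \<le> \<bar>c\<bar>" if "0 \<le> r" "r \<le> \<tau> \<omega>" for r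
        using elim(4) that by (meson abs_ge_self order_trans)
    qed (use elim \<tau> sd mesh in \<open>auto simp: P_def\<close>)
    then show ?case
      unfolding J_def stopped_step_integral[OF sd] I_eq[symmetric] Z_def using elim(3) by simp
  qed
  have Z_measurable: "Z u \<in> borel_measurable (F u)" if u: "u \<in> {0..t}" for u
    by (rule measurable_F_AE_LIMSEQ[OF _ _ lim[OF u]])
      (use u in \<open>auto simp: J_def intro!: step_integral_adapted[OF sd']\<close>)
  have Z_measurable_M [measurable]: "Z u \<in> borel_measurable M" if "u \<in> {0..t}" for u
    using measurable_F_imp_M[OF _ Z_measurable[OF that]] that by simp
  have J_measurable [measurable]: "J i u \<in> borel_measurable M" if "u \<in> {0..t}" for i u
    unfolding J_def using step_integral_adapted[OF sd', of u i] that by (auto intro: measurable_F_imp_M)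
  have Z_bound: "AE \<omega> in M. \<bar>Z u \<omega>\<bar> \<le> \<bar>c\<bar>" if u: "u \<in> {0..t}" for u
    using c X_zero AE_space
  proof eventually_elim
    case (elim \<omega>)
    have "\<bar>X (min u (\<tau> \<omega>)) \<omega>\<bar> \<le> c" using elim(1) \<tau>[OF elim(3)] u by simp
    then show ?case using elim(2) by (simp add: Z_def)
  qed
  have Z_int: "integrable M (Z u)" if u: "u \<in> {0..t}" for u
    by (rule integrable_const_bound[OF _ Z_measurable_M[OF u]]) (use Z_bound[OF u] in simp)
  have conv: "(\<lambda>i. LINT \<omega>:A|M. J i u \<omega>) \<longlonglongrightarrow> (LINT \<omega>:A|M. Z u \<omega>)"
    if u: "u \<in> {0..t}" and A [measurable]: "A \<in> events" for u A
  proof -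
    note [measurable] = Z_measurable_M[OF u] J_measurable[OF u]
    let ?b = "\<bar>c\<bar> + 1"
    let ?clip = "\<lambda>y. max (- ?b) (min ?b y)"
    have Ji: "integrable M (J i u)" for i
      unfolding J_def using u by (intro step_integral_integrable[OF sd']) simp
    have clip_int: "integrable M (\<lambda>\<omega>. indicat_real A \<omega> *\<^sub>R ?clip (J i u \<omega>))" for i
      by (rule integrable_const_bound[of _ ?b]) (auto simp: indicator_def)
    have clip_conv: "(\<lambda>i. LINT \<omega>:A|M. ?clip (J i u \<omega>)) \<longlonglongrightarrow> (LINT \<omega>:A|M. Z u \<omega>)"
      unfolding set_lebesgue_integral_def
    proof (rule integral_dominated_convergence[where w = "\<lambda>_. ?b"])
      show "AE \<omega> in M. (\<lambda>i. indicat_real A \<omega> *\<^sub>R ?clip (J i u \<omega>)) \<longlonglongrightarrow> indicat_real A \<omega> *\<^sub>R Z u \<omega>"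
        using lim[OF u] Z_bound[OF u]
      proof eventually_elim
        case (elim \<omega>)
        have "(\<lambda>i. indicat_real A \<omega> *\<^sub>R ?clip (J i u \<omega>)) \<longlonglongrightarrow> indicat_real A \<omega> *\<^sub>R ?clip (Z u \<omega>)"
          by (intro tendsto_intros elim(1))
        moreover have "?clip (Z u \<omega>) = Z u \<omega>" using elim(2) by auto
        ultimately show ?case by simp
      qed
      show "AE \<omega> in M. norm (indicat_real A \<omega> *\<^sub>R ?clip (J i u \<omega>)) \<le> ?b" for i
        by (auto simp: indicator_def)
    qed (use u in auto)
    have "(\<lambda>i. (LINT \<omega>:A|M. J i u \<omega>) - (LINT \<omega>:A|M. ?clip (J i u \<omega>))) \<longlonglongrightarrow> 0"
    proof (rule Lim_null_comparison)
      show "(\<lambda>i. 2 * (1 / 2 :: real) ^ i) \<longlonglongrightarrow> 0"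
        by (intro tendsto_mult_right_zero LIMSEQ_realpow_zero) auto
      show "\<forall>\<^sub>F i in sequentially. norm ((LINT \<omega>:A|M. J i u \<omega>) - (LINT \<omega>:A|M. ?clip (J i u \<omega>))) \<le> 2 * (1 / 2) ^ i"
      proof (rule always_eventually, rule allI)
        fix i
        obtain Q' where Q': "integrable M Q'" "expectation Q' \<le> (1 / 4) ^ i"
          "\<And>\<omega>. 0 \<le> Q' \<omega>"
          "\<And>\<omega> j. j < N i \<Longrightarrow> (\<xi> i j \<omega> \<bullet> (B (min u (q i (Suc j))) \<omega> - B (min u (q i j)) \<omega>))\<^sup>2 \<le> Q' \<omega>"
          using Q[of u i] u by auto
        \<comment> \<open>The grids were chosen with \<open>E Q \<le> \<delta>\<^sup>2\<close> because \<open>\<surd>Q \<le> \<delta> + Q / \<delta>\<close> then has expectation at most \<open>2 \<delta>\<close>.\<close>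
        let ?\<delta> = "(1 / 2 :: real) ^ i"
        have \<delta>: "0 < ?\<delta>" "(1 / 4 :: real) ^ i = ?\<delta> * ?\<delta>" by (auto simp flip: power_mult_distrib)
        have le: "\<bar>J i u \<omega> - ?clip (J i u \<omega>)\<bar> \<le> ?\<delta> + Q' \<omega> / ?\<delta>" if \<omega>: "\<omega> \<in> space M" for \<omega>
        proof -
          have "\<bar>J i u \<omega>\<bar> \<le> ?b + sqrt (Q' \<omega>)"
            unfolding J_def by (rule stopped_step_integral_le[OF sd]) (use Q' in \<open>auto simp: P_def I_eq\<close>)
          then have "\<bar>J i u \<omega> - ?clip (J i u \<omega>)\<bar> \<le> sqrt (Q' \<omega>)" using Q'(3)[of \<omega>] by (auto simp: max_def min_def)
          also have "sqrt (Q' \<omega>) \<le> ?\<delta> + Q' \<omega> / ?\<delta>"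
          proof (cases "sqrt (Q' \<omega>) \<le> ?\<delta>")
            case True
            moreover have "0 \<le> Q' \<omega> / ?\<delta>" using Q'(3) \<delta> by simp
            ultimately show ?thesis by linarith
          next
            case False
            have "sqrt (Q' \<omega>) * ?\<delta> \<le> sqrt (Q' \<omega>) * sqrt (Q' \<omega>)"
              using False Q'(3) by (intro mult_left_mono) auto
            then have "sqrt (Q' \<omega>) \<le> Q' \<omega> / ?\<delta>" using \<delta>(1) Q'(3)[of \<omega>] by (simp add: pos_le_divide_eq)
            with \<delta> show ?thesis by linarith
          qed
          finally show ?thesis .
        qed
        have i1: "integrable M (\<lambda>\<omega>. indicat_real A \<omega> *\<^sub>R J i u \<omega>)"
          using Ji A by (intro integrable_mult_indicator)
        have i2: "integrable M (\<lambda>\<omega>. ?\<delta> + Q' \<omega> / ?\<delta>)" using Q'(1) by simp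
        have "norm ((LINT \<omega>:A|M. J i u \<omega>) - (LINT \<omega>:A|M. ?clip (J i u \<omega>))) =
            norm (expectation (\<lambda>\<omega>. indicat_real A \<omega> *\<^sub>R J i u \<omega> - indicat_real A \<omega> *\<^sub>R ?clip (J i u \<omega>)))"
          unfolding set_lebesgue_integral_def using i1 clip_int[of i]
          by (subst Bochner_Integration.integral_diff) auto
        also have "\<dots> \<le> expectation (\<lambda>\<omega>. ?\<delta> + Q' \<omega> / ?\<delta>)"
        proof (rule order_trans[OF integral_norm_bound], rule integral_mono[OF _ i2])
          show "integrable M (\<lambda>\<omega>. norm (indicat_real A \<omega> *\<^sub>R J i u \<omega> - indicat_real A \<omega> *\<^sub>R ?clip (J i u \<omega>)))"
            using i1 clip_int[of i] by (intro integrable_norm Bochner_Integration.integrable_diff)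
          show "norm (indicat_real A \<omega> *\<^sub>R J i u \<omega> - indicat_real A \<omega> *\<^sub>R ?clip (J i u \<omega>)) \<le> ?\<delta> + Q' \<omega> / ?\<delta>"
            if "\<omega> \<in> space M" for \<omega>
            using le[OF that] by (cases "\<omega> \<in> A") auto
        qed
        also have "\<dots> = ?\<delta> + expectation Q' / ?\<delta>" using Q'(1) by (simp add: prob_space)
        also have "\<dots> \<le> ?\<delta> + ?\<delta>"
          using Q'(2) \<delta> by (simp add: pos_divide_le_eq del: power_one_over)
        finally show "norm ((LINT \<omega>:A|M. J i u \<omega>) - (LINT \<omega>:A|M. ?clip (J i u \<omega>))) \<le> 2 * ?\<delta>" by simp
      qed
    qed
    from tendsto_add[OF this clip_conv] show ?thesis by simp
  qed
  have "martingale_upto M F t Z"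
  proof (rule martingale_uptoI)
    fix s r A assume sr: "0 \<le> s" "s \<le> r" "r \<le> t" and A: "A \<in> sets (F s)"
    have AM: "A \<in> events" using sets_F_subset[OF sr(1) A] .
    have "(LINT \<omega>:A|M. J i r \<omega>) = (LINT \<omega>:A|M. J i s \<omega>)" for i
      unfolding J_def by (rule martingale_upto_set_integral[OF step_integral_martingale[OF sd'] sr A])
    with conv[of r A] conv[of s A] AM sr show "(LINT \<omega>:A|M. Z r \<omega>) = (LINT \<omega>:A|M. Z s \<omega>)"
      by (auto intro: LIMSEQ_unique)
  qed (use Z_measurable Z_int in auto)
  then show ?thesis by (simp add: Z_def[abs_def])
qed

definition good_paths :: "'w set" where
  "good_paths = {\<omega>\<in>space M. continuous_on {0..t} (\<lambda>r. X r \<omega>) \<and> X 0 \<omega> = 0}"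

text \<open>Inserting \<open>t\<close> into the set gives the value \<open>t\<close> to paths that do not reach the level. Paths outside
  \<open>good_paths\<close> form a null set; they too receive the value \<open>t\<close>, so that all properties demanded of the
  localizing times for every path hold.\<close>

definition hitting_time :: "nat \<Rightarrow> 'w \<Rightarrow> real" where
  "hitting_time n \<omega> =
    (if \<omega> \<in> good_paths then Inf (insert t {r\<in>{0..t}. real n \<le> \<bar>X r \<omega>\<bar>}) else t)"

lemma AE_good_paths: "AE \<omega> in M. \<omega> \<in> good_paths"
  using X_continuous X_zero AE_space by eventually_elim (simp add: good_paths_def)

lemma bad_paths_null: "space M - good_paths \<in> null_sets M"
proof -
  have "{\<omega>\<in>space M. \<not> \<omega> \<in> good_paths} \<in> null_sets M"
    using AE_good_paths unfolding AE_iff_null_sets .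
  then show ?thesis by (simp add: set_diff_eq)
qed

lemma hitting_time_mem:
  assumes \<omega>: "\<omega> \<in> good_paths"
  shows "hitting_time n \<omega> \<in> insert t {r\<in>{0..t}. real n \<le> \<bar>X r \<omega>\<bar>}"
proof -
  have c: "continuous_on {0..t} (\<lambda>r. \<bar>X r \<omega>\<bar>)"
    using \<omega> by (auto simp: good_paths_def intro!: continuous_intros)
  have "closed {r\<in>{0..t}. real n \<le> \<bar>X r \<omega>\<bar>}"
    using c by (intro continuous_on_closed_Collect_le[of _ "\<lambda>_. real n"] continuous_on_const) auto
  then have "Inf (insert t {r\<in>{0..t}. real n \<le> \<bar>X r \<omega>\<bar>}) \<in> insert t {r\<in>{0..t}. real n \<le> \<bar>X r \<omega>\<bar>}"
    using t by (intro closed_contains_Inf bdd_belowI[of _ 0]) auto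
  then show ?thesis using \<omega> by (simp add: hitting_time_def)
qed

lemma hitting_time_range: "hitting_time n \<omega> \<in> {0..t}"
proof (cases "\<omega> \<in> good_paths")
  case True
  then show ?thesis using hitting_time_mem[OF True, of n] t by auto
next
  case False
  then show ?thesis using t by (simp add: hitting_time_def)
qed

lemma hitting_time_le:
  assumes "\<omega> \<in> good_paths" "r \<in> {0..t}" "real n \<le> \<bar>X r \<omega>\<bar>"
  shows "hitting_time n \<omega> \<le> r"
  using assms t by (auto simp: hitting_time_def intro!: cInf_lower bdd_belowI[of _ 0])

lemma hitting_time_mono: "hitting_time n \<omega> \<le> hitting_time (Suc n) \<omega>"
proof (cases "\<omega> \<in> good_paths")
  case True
  then show ?thesis using t unfolding hitting_time_def
    by (simp only: if_True, intro cInf_superset_mono bdd_belowI[of _ 0]) auto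
qed (simp add: hitting_time_def)

text \<open>Strictly before the hitting time the path is below the level by definition of the infimum, and at the
  hitting time by continuity. If the hitting time is zero, the bound holds because the path starts at
  zero.\<close>

lemma before_hitting_time:
  assumes \<omega>: "\<omega> \<in> good_paths" and r: "0 \<le> r" "r \<le> hitting_time n \<omega>"
  shows "\<bar>X r \<omega>\<bar> \<le> real n"
proof -
  let ?h = "hitting_time n \<omega>"
  have h: "0 \<le> ?h" "?h \<le> t" using hitting_time_range[of n \<omega>] by auto
  have less: "\<bar>X s \<omega>\<bar> < real n" if "0 \<le> s" "s < ?h" for s
    using hitting_time_le[OF \<omega>, of s n] that h by force
  show ?thesis
  proof (cases "?h = 0")
    case True
    with r \<omega> show ?thesis by (simp add: good_paths_def)
  next
    case False
    with h have h0: "0 < ?h" by simp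
    have c: "continuous_on {0..?h} (\<lambda>r. \<bar>X r \<omega>\<bar>)"
      using \<omega> h by (intro continuous_intros) (auto simp: good_paths_def intro: continuous_on_subset)
    have "(\<exists>s\<in>{0..?h}. real n < \<bar>X s \<omega>\<bar>) \<longleftrightarrow> (\<exists>s\<in>{0..<?h}. real n < \<bar>X s \<omega>\<bar>)"
      using h0 by (intro exceeds_on_dense_iff[OF c]) auto
    moreover have "\<not> (\<exists>s\<in>{0..<?h}. real n < \<bar>X s \<omega>\<bar>)"
      using less by (auto simp: not_less intro: less_imp_le)
    ultimately show ?thesis using r by (force simp: not_less)
  qed
qed

text \<open>The level \<open>n\<close> is reached by time \<open>s\<close> if and only if the supremum of \<open>|X|\<close> over \<open>[0, s]\<close> is at
  least \<open>n\<close>, by compactness; the supremum is computed over a countable dense set of times.\<close>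

lemma hitting_time_stopping:
  assumes s: "s \<in> {0..t}"
  shows "Measurable.pred (F s) (\<lambda>\<omega>. hitting_time n \<omega> \<le> s)"
proof (cases "s = t")
  case True
  then show ?thesis using hitting_time_range[of n] by simp
next
  case False
  then have st: "0 \<le> s" "s < t" using s by auto
  obtain T where T: "countable T" "T \<subseteq> {0..s}" "{0..s} \<subseteq> closure T" by (rule separable)
  define G where "G = {\<omega>\<in>space (F s). \<forall>m::nat. \<exists>q\<in>T. real n - 1 / real (Suc m) < \<bar>X q \<omega>\<bar>}"
  have "{\<omega>\<in>space (F s). real n - 1 / real (Suc m) < \<bar>X q \<omega>\<bar>} \<in> sets (F s)" if q: "q \<in> T" for m q
  proof -
    have "X q \<in> borel_measurable (F s)"
      using measurable_F_mono[OF _ _ X_measurable[of q], of s] q T(2) st by auto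
    then show ?thesis by measurable
  qed
  then have "(\<Inter>m::nat. \<Union>q\<in>T. {\<omega>\<in>space (F s). real n - 1 / real (Suc m) < \<bar>X q \<omega>\<bar>}) \<in> sets (F s)"
    using T(1) by (intro sets.countable_INT sets.countable_UN') auto
  moreover have "(\<Inter>m::nat. \<Union>q\<in>T. {\<omega>\<in>space (F s). real n - 1 / real (Suc m) < \<bar>X q \<omega>\<bar>}) = G"
    unfolding G_def by blast
  ultimately have G: "G \<in> sets (F s)" by simp
  have eq: "hitting_time n \<omega> \<le> s \<longleftrightarrow> \<omega> \<in> G" if \<omega>: "\<omega> \<in> good_paths" for \<omega>
  proof -
    have c: "continuous_on {0..s} (\<lambda>r. \<bar>X r \<omega>\<bar>)"
      using \<omega> st by (intro continuous_intros) (auto simp: good_paths_def intro: continuous_on_subset)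
    have "hitting_time n \<omega> \<le> s \<longleftrightarrow> (\<exists>r\<in>{0..s}. real n \<le> \<bar>X r \<omega>\<bar>)"
      using hitting_time_mem[OF \<omega>, of n] hitting_time_le[OF \<omega>, of _ n] st by fastforce
    also have "\<dots> \<longleftrightarrow> (\<forall>m::nat. \<exists>r\<in>{0..s}. real n - 1 / real (Suc m) < \<bar>X r \<omega>\<bar>)"
    proof
      assume "\<exists>r\<in>{0..s}. real n \<le> \<bar>X r \<omega>\<bar>"
      then obtain r where r: "r \<in> {0..s}" "real n \<le> \<bar>X r \<omega>\<bar>" by blast
      show "\<forall>m::nat. \<exists>r\<in>{0..s}. real n - 1 / real (Suc m) < \<bar>X r \<omega>\<bar>"
      proof
        fix m
        have "0 < 1 / real (Suc m)" by simp
        with r(2) have "real n - 1 / real (Suc m) < \<bar>X r \<omega>\<bar>" by linarith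
        with r(1) show "\<exists>r\<in>{0..s}. real n - 1 / real (Suc m) < \<bar>X r \<omega>\<bar>" by blast
      qed
    next
      assume *: "\<forall>m::nat. \<exists>r\<in>{0..s}. real n - 1 / real (Suc m) < \<bar>X r \<omega>\<bar>"
      have "{0..s} \<noteq> {}" using st by simp
      then obtain r where r: "r \<in> {0..s}" "\<And>y. y \<in> {0..s} \<Longrightarrow> \<bar>X y \<omega>\<bar> \<le> \<bar>X r \<omega>\<bar>"
        using continuous_attains_sup[OF compact_Icc _ c] by blast
      have "real n \<le> \<bar>X r \<omega>\<bar>"
      proof (rule ccontr)
        assume "\<not> real n \<le> \<bar>X r \<omega>\<bar>"
        then obtain m where "inverse (real (Suc m)) < real n - \<bar>X r \<omega>\<bar>"
          using reals_Archimedean[of "real n - \<bar>X r \<omega>\<bar>"] by auto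
        moreover obtain y where "y \<in> {0..s}" "real n - 1 / real (Suc m) < \<bar>X y \<omega>\<bar>" using * by blast
        ultimately show False using r(2)[of y] by (simp add: inverse_eq_divide)
      qed
      with r(1) show "\<exists>r\<in>{0..s}. real n \<le> \<bar>X r \<omega>\<bar>" by blast
    qed
    also have "\<dots> \<longleftrightarrow> (\<forall>m::nat. \<exists>q\<in>T. real n - 1 / real (Suc m) < \<bar>X q \<omega>\<bar>)"
      using exceeds_on_dense_iff[OF c T(2,3)] by simp
    finally show ?thesis using \<omega> st by (simp add: G_def space_F good_paths_def)
  qed
  have "{\<omega>\<in>space (F s). hitting_time n \<omega> \<le> s} = G - (space M - good_paths)"
    using eq st by (auto simp: space_F G_def hitting_time_def split: if_splits)
  also have "\<dots> \<in> sets (F s)" using G null_sets_F[OF st(1) bad_paths_null] by (rule sets.Diff)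
  finally show ?thesis by (simp add: pred_def)
qed

lemma hitting_time_eventually:
  assumes \<omega>: "\<omega> \<in> good_paths"
  shows "\<exists>n. hitting_time n \<omega> = t"
proof -
  have c: "continuous_on {0..t} (\<lambda>r. \<bar>X r \<omega>\<bar>)"
    using \<omega> by (intro continuous_intros) (auto simp: good_paths_def)
  have "{0..t} \<noteq> {}" using t by simp
  then obtain r where r: "\<And>y. y \<in> {0..t} \<Longrightarrow> \<bar>X y \<omega>\<bar> \<le> \<bar>X r \<omega>\<bar>"
    using continuous_attains_sup[OF compact_Icc _ c] by blast
  obtain n :: nat where n: "\<bar>X r \<omega>\<bar> < real n" using reals_Archimedean2 by blast
  have "hitting_time n \<omega> = t" using hitting_time_mem[OF \<omega>, of n] r n by fastforce
  then show ?thesis ..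
qed

lemma local_martingale: "local_martingale_upto M F t X"
  unfolding local_martingale_upto_def
proof (intro conjI exI[of _ hitting_time] ballI allI)
  show "AE \<omega> in M. cadlag_upto t (\<lambda>r. X r \<omega>)"
    using X_continuous
  proof eventually_elim
    case (elim \<omega>)
    show ?case unfolding cadlag_upto_def
    proof (intro conjI ballI)
      fix r assume r: "r \<in> {0..<t}"
      have "continuous_on {r..t} (\<lambda>r. X r \<omega>)" using elim r by (auto intro: continuous_on_subset)
      then have "continuous (at r within {r..t}) (\<lambda>r. X r \<omega>)"
        using r by (simp add: continuous_on_eq_continuous_within)
      then show "continuous (at_right r) (\<lambda>r. X r \<omega>)"
        using r by (simp add: at_within_Icc_at_right)
    next
      fix r assume r: "r \<in> {0<..t}"
      have "continuous_on {0..r} (\<lambda>r. X r \<omega>)" using elim r by (auto intro: continuous_on_subset)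
      then have "continuous (at r within {0..r}) (\<lambda>r. X r \<omega>)"
        using r by (simp add: continuous_on_eq_continuous_within)
      then have "((\<lambda>r. X r \<omega>) \<longlongrightarrow> X r \<omega>) (at_left r)"
        using r by (simp add: continuous_within at_within_Icc_at_left)
      then show "\<exists>l. ((\<lambda>r. X r \<omega>) \<longlongrightarrow> l) (at_left r)" by blast
    qed
  qed
  show "AE \<omega> in M. \<exists>n. hitting_time n \<omega> = t"
    using AE_good_paths by eventually_elim (rule hitting_time_eventually)
  show "martingale_upto M F t (\<lambda>r \<omega>. X (min r (hitting_time n \<omega>)) \<omega> - X 0 \<omega>)" for n
  proof (rule bounded_stopped_martingale[where c = "real n"])
    show "AE \<omega> in M. \<forall>r. 0 \<le> r \<and> r \<le> hitting_time n \<omega> \<longrightarrow> \<bar>X r \<omega>\<bar> \<le> real n"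
      using AE_good_paths by eventually_elim (auto intro: before_hitting_time)
  qed (use hitting_time_range hitting_time_stopping in auto)
qed (use X_measurable hitting_time_range hitting_time_mono hitting_time_stopping in auto)

end

section \<open>The strict local martingale property\<close>

theorem corollary4:
  fixes M :: "'w measure"
    and F :: "real \<Rightarrow> 'w measure"
    and B f :: "real \<Rightarrow> 'w \<Rightarrow> real ^ 'd"
    and X :: "real \<Rightarrow> 'w \<Rightarrow> real"
    and t \<alpha> :: real
  assumes "usual_filtered_prob_space M F"
    and "brownian_motion M F B"
    and "0 < t"
    and "progressively_measurable F f"
    and "AE \<omega> in M. set_integrable lborel {0..t} (\<lambda>s. (norm (f s \<omega>))\<^sup>2)"
    and "0 < \<alpha>" and "\<alpha> < 1"
    and "(\<integral>\<^sup>+\<omega>. ennreal ((LINT s:{0..t}|lborel. (norm (f s \<omega>))\<^sup>2) powr (\<alpha> / 2)) \<partial>M) = \<infinity>"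
    and "ito_integral M F B t f X"
  shows "strict_local_martingale_upto M F t X"
proof -
  interpret usual_filtered_prob_space M F by (rule assms(1))
  interpret ito_integral_process M F B t f X by unfold_locales (use assms in auto)
  show ?thesis
    unfolding strict_local_martingale_upto_def
    using local_martingale not_martingale[OF assms(6-8)] by blast
qed

end
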